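(* Let $n\ge 2$ and let $\lambda>0$. Let $K\subset\mathbb{R}^n$ be a $\lambda$-convex body and let $L\subset\mathbb{R}^n$ be a $\lambda$-convex lens. If $r(K)=r(L)$, then $$V_1(K)\le V_1(L),$$ with equality if and only if $K$ is a $\lambda$-convex lens.
   Context: A convex body in $\mathbb{R}^n$ is a compact convex subset with non-empty interior. For $\lambda>0$, a convex body $K\subset\mathbb{R}^n$ is called $\lambda$-convex if for every $p\in\partial K$ there exist a neighborhood $U_p$ of $p$ and a closed ball $B_{\lambda,p}$ of radius $1/\lambda$ such that $p\in\partial B_{\lambda,p}$ and $U_p\cap K\subset B_{\lambda,p}$. (By Blaschke's rolling theorem, $\lambda$-convex bodies are exactly the convex bodies that are intersections of finitely or infinitely many closed balls of radius $1/\lambda$.) A $\lambda$-convex lens is a convex body that is the intersection of two closed balls of radius $1/\lambda$ (a single ball of radius $1/\lambda$ is the degenerate case in which the two balls coincide). The inradius $r(K)$ of a convex body $K$ is the radius of a largest ball contained in $K$. The intrinsic volumes $V_j(K)$ are defined by the Steiner formula: for every $\varepsilon>0$, $\mathrm{Vol}(K+\varepsilon \mathbf{B})=\sum_{j=0}^n \kappa_{n-j}V_j(K)\varepsilon^{n-j}$, where $\mathrm{Vol}$ is Lebesgue measure, $\mathbf{B}$ is the closed unit Euclidean ball in $\mathbb{R}^n$, $+$ is Minkowski addition, and $\kappa_m$ is the volume of the unit ball in $\mathbb{R}^m$. In particular, $V_1(K)=\frac{1}{\kappa_{n-1}}\int_{\mathbb{S}^{n-1}}h_K(u)\,du$, where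 $h_K(u)=\max_{y\in K}\langle u,y\rangle$ is the support function and $du$ is the standard surface measure on the unit sphere $\mathbb{S}^{n-1}$; thus $V_1(K)$ is a fixed positive multiple (depending on $n$) of the mean width of $K$. *)

theory Defs
  imports "HOL-Analysis.Analysis"
begin

definition convex_body :: "'a::euclidean_space set \<Rightarrow> bool" where
  "convex_body K \<longleftrightarrow> compact K \<and> convex K \<and> interior K \<noteq> {}"

definition lam_convex_body :: "real \<Rightarrow> 'a::euclidean_space set \<Rightarrow> bool" where
  "lam_convex_body lam K \<longleftrightarrow> convex_body K \<and>
     (\<forall>p\<in>frontier K. \<exists>U c. open U \<and> p \<in> U \<and> p \<in> sphere c (1 / lam) \<and>
        U \<inter> K \<subseteq> cball c (1 / lam))"

(* The centres a and b may coincide: a single ball is the degenerate lens. *)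
definition lam_convex_lens :: "real \<Rightarrow> 'a::euclidean_space set \<Rightarrow> bool" where
  "lam_convex_lens lam L \<longleftrightarrow> convex_body L \<and>
     (\<exists>a b. L = cball a (1 / lam) \<inter> cball b (1 / lam))"

(* A largest contained ball exists for convex bodies, by compactness. *)
definition inradius :: "'a::euclidean_space set \<Rightarrow> real" where
  "inradius K = (GREATEST r. 0 < r \<and> (\<exists>c. cball c r \<subseteq> K))"

(* K + (...) is the Minkowski sum from Set_Algebras, and unit_ball_vol (real m) is the
   volume of the unit ball in dimension m. *)
definition steiner_coeffs :: "'a::euclidean_space set \<Rightarrow> (nat \<Rightarrow> real) \<Rightarrow> bool" where
  "steiner_coeffs K V \<longleftrightarrow>
     (\<forall>\<epsilon>>0. measure lebesgue (K + (\<lambda>b. \<epsilon> *\<^sub>R b) ` cball 0 1) =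
        (\<Sum>j=0..DIM('a). unit_ball_vol (real (DIM('a) - j)) * V j * \<epsilon> ^ (DIM('a) - j)))"

(* The Steiner formula only constrains V j for j \<le> DIM('a); setting the rest to zero
   makes V unique, as a polynomial is determined by its values on the positive reals. *)
definition intrinsic_volume :: "nat \<Rightarrow> 'a::euclidean_space set \<Rightarrow> real" where
  "intrinsic_volume j K = (THE V. steiner_coeffs K V \<and> (\<forall>i>DIM('a). V i = 0)) j"

end

theory Submission
  imports Defs
begin

text \<open>Put \<open>R = 1 / lam\<close>, let \<open>r\<close> be the common inradius and \<open>\<rho> = R - r\<close>. A comparison with circular arcs of
  radius larger than \<open>R\<close> shows that the balls of radius \<open>R\<close> supporting \<open>K\<close> locally contain it globally. At
  the points where a largest inscribed ball touches the boundary, this places \<open>K\<close> in the balls of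
  radius \<open>R\<close> about \<open>- \<rho> u\<close>, where \<open>u\<close> runs through the contact normals (the inscribed ball being centred
  at \<open>0\<close>), and maximality gives weights with \<open>\<Sum> w u = 0\<close>.

  Let \<open>L u\<close> be the lens of inradius \<open>r\<close> with axis \<open>u\<close>. For every unit vector \<open>v\<close>, the support functions satisfy
  \<open>h K v + h K (- v) \<le> 2 (\<Sum> w h (L u) v)\<close>. Integrating over \<open>v\<close> yields the inequality, since all \<open>L u\<close> are
  congruent. In the case of equality, taking for \<open>v\<close> a contact normal forces \<open>- v\<close> to be one as well,
  so \<open>K\<close> is contained in, and then equal to, a lens.

  That the first intrinsic volume is a multiple of the integral of the support function follows
  from the first order expansion of the volume of \<open>B + s K\<close>. The Steiner formula itself, needed for the
  intrinsic volumes to exist, holds for polytopes by sorting points by the face that contains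
  their projection, and for convex bodies by approximation.\<close>


section \<open>Supporting balls of fixed radius\<close>

text \<open>The width inequality rests on a pencil of balls. Averaging the squared inequalities
  \<open>norm (x + \<rho> *\<^sub>R u) \<le> R\<close> with the weights removes the linear term and
  puts \<open>K\<close> in the ball of radius sqrt (R^2 - \<rho>^2) about 0. Together with the ball
  about - \<rho> u this confines \<open>K\<close> to all balls of radius sqrt (R^2 - \<rho>^2 +
  \<rho>^2 \<tau>^2) about - \<rho> \<tau> u with \<tau> between 0 and 1, the balls through the edge
  of the lens. The support function of the lens is the minimum over \<tau> of the bounds given by
  these balls, hence concave and nonincreasing in the absolute value of
  \<open>u \<bullet> v\<close>. Opposite directions are treated together because h K v is bounded
  through the contact normal with the largest \<open>u \<bullet> v\<close> and h K (- v) through the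
  one with the smallest; the concavity estimate controls the sum of the two bounds. Integrals over
  the sphere appear as integrals over the unit ball of functions of \<open>sgn x\<close>, so that
  the behaviour of Lebesgue measure under linear maps suffices.\<close>

lemma unit_orthogonal_exists:
  fixes D y :: "'a::euclidean_space"
  assumes "DIM('a) \<ge> 2" "y \<bullet> D = 0"
  obtains w where "norm w = 1" "w \<bullet> D = 0" "y = norm y *\<^sub>R w"
proof (cases "y = 0")
  \<comment> \<open>In \<open>local_supporting_ball_is_global\<close> this case occurs when the
    chord is a diameter of the comparison circle; any orthogonal direction will do, and dimension at
    least 2 provides one.\<close>
  case True
  obtain x where "x \<noteq> 0" "orthogonal D x"
    using orthogonal_to_vector_exists[OF assms(1)] by blast
  then show ?thesis
    using that[of "sgn x"] True
    by (auto simp: norm_sgn sgn_div_norm orthogonal_def inner_commute)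
next
  case False
  then show ?thesis using that[of "sgn y"] assms(2) by (auto simp: norm_sgn sgn_div_norm)
qed

text \<open>Suppose \<open>q \<in> K\<close> lies outside the ball at \<open>p\<close>, and consider the arc from \<open>p\<close> to \<open>q\<close> that is tangent to
  the ball at \<open>p\<close>; its radius \<open>R0\<close> exceeds \<open>R\<close>, so it leaves \<open>K\<close> near \<open>p\<close>. Move the arc towards its chord
  by the least amount \<open>\<delta>\<close> for which the part beyond the chord lies in \<open>K\<close>. It then touches
  the boundary of \<open>K\<close> at an inner point \<open>P\<close>, where no ball of radius \<open>R < R0\<close> can contain it locally.\<close>
lemma local_supporting_ball_is_global:
  fixes K :: "'a::euclidean_space set"
  assumes dim: "DIM('a) \<ge> 2" and K: "convex K" "closed K" and R: "R > 0"
    and loc: "\<And>p. p \<in> frontier K \<Longrightarrow>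
      \<exists>U c. open U \<and> p \<in> U \<and> p \<in> sphere c R \<and> U \<inter> K \<subseteq> cball c R"
    and p: "p \<in> frontier K" "open U" "p \<in> U" "p \<in> sphere c R" "U \<inter> K \<subseteq> cball c R"
  shows "K \<subseteq> cball c R"
proof (rule ccontr)
  assume "\<not> K \<subseteq> cball c R"
  then obtain q where q: "q \<in> K" "q \<notin> cball c R" by blast
  have pK: "p \<in> K" using p(1) K(2) by (simp add: frontier_def)
  define D where "D = q - p"
  define k where "k = D \<bullet> (p - c)"
  have npc: "norm (p - c) = R" using p(4) by (simp add: dist_norm norm_minus_commute)
  have pc: "(p - c) \<bullet> (p - c) = R\<^sup>2" using npc by (simp add: dot_square_norm)
  have k': "(p - c) \<bullet> D = k" by (simp add: k_def inner_commute)
  have nrm: "(norm (p + x - c))\<^sup>2 = x \<bullet> x + 2 * (x \<bullet> (p - c)) + R\<^sup>2" for x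
  proof -
    have "p + x - c = x + (p - c)" by simp
    then show ?thesis unfolding power2_norm_eq_inner
      using pc by (simp only: inner_add_left inner_add_right) (simp add: inner_commute)
  qed
  have "R < norm (q - c)" using q(2) by (simp add: dist_norm norm_minus_commute)
  then have "R\<^sup>2 < (norm (q - c))\<^sup>2" using R by (simp add: power_strict_mono)
  then have big: "D \<bullet> D + 2 * k > 0" using nrm[of D] by (simp add: D_def k_def)
  have D0: "D \<noteq> 0" using q p(3,5) pK by (auto simp: D_def)
  then have DD: "D \<bullet> D > 0" by simp
  \<comment> \<open>The start of the chord lies in \<open>U \<inter> K\<close>, hence in the ball,
    so the chord makes a strictly obtuse angle with the outer normal \<open>p - c\<close>.\<close>
  have kneg: "k < 0"
  proof -
    have "((\<lambda>e. p + e *\<^sub>R D) \<longlongrightarrow> p + 0 *\<^sub>R D) (at_right (0::real))"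
      by (intro tendsto_intros)
    then have "((\<lambda>e. p + e *\<^sub>R D) \<longlongrightarrow> p) (at_right (0::real))" by simp
    then have "\<forall>\<^sub>F e in at_right (0::real). p + e *\<^sub>R D \<in> U"
      using p(2,3) topological_tendstoD by blast
    moreover have "\<forall>\<^sub>F e in at_right (0::real). e > 0" by (rule eventually_at_right_less)
    moreover have "\<forall>\<^sub>F e in at_right (0::real). e < 1"
      by (rule eventually_at_rightI[of _ 1]) auto
    ultimately have "\<forall>\<^sub>F e in at_right (0::real). p + e *\<^sub>R D \<in> U \<and> e > 0 \<and> e < 1"
      by eventually_elim auto
    then obtain e where e: "p + e *\<^sub>R D \<in> U" "e > 0" "e < 1"
      using eventually_happens trivial_limit_at_right_real by blast
    have "p + e *\<^sub>R D = (1 - e) *\<^sub>R p + e *\<^sub>R q" by (simp add: D_def algebra_simps)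
    then have "p + e *\<^sub>R D \<in> K" using K(1) pK q(1) e by (simp add: convex_alt)
    then have "norm (p + e *\<^sub>R D - c) \<le> R" using e p(5) by (auto simp: dist_norm norm_minus_commute)
    then have "(norm (p + e *\<^sub>R D - c))\<^sup>2 \<le> R\<^sup>2" by (simp add: power_mono)
    then have "e * (e * (D \<bullet> D) + 2 * k) \<le> 0"
      unfolding nrm by (simp add: k_def algebra_simps)
    then have "e * (D \<bullet> D) + 2 * k \<le> 0" using e by (simp add: mult_le_0_iff)
    moreover have "e * (D \<bullet> D) > 0" using e DD by simp
    ultimately show ?thesis by simp
  qed
  \<comment> \<open>Chosen so that the sphere of radius \<open>\<sigma> * R\<close> tangent to the
    ball at \<open>p\<close>, with centre \<open>Z\<close> on the ray from \<open>p\<close> through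
    \<open>c\<close>, also passes through \<open>q\<close>; \<open>\<sigma> > 1\<close> because
    \<open>q\<close> is outside the ball.\<close>
  define \<sigma> where "\<sigma> = (D \<bullet> D) / (- 2 * k)"
  have \<sigma>1: "\<sigma> > 1" using big kneg by (simp add: \<sigma>_def field_simps)
  have \<sigma>k: "2 * \<sigma> * k = - (D \<bullet> D)" using kneg by (simp add: \<sigma>_def field_simps)
  define R0 where "R0 = \<sigma> * R"
  have R0: "R0 > R" using \<sigma>1 R by (simp add: R0_def)
  define Z where "Z = p - \<sigma> *\<^sub>R (p - c)"
  define m where "m = p + (1/2) *\<^sub>R D"
  have mZ: "m - Z = \<sigma> *\<^sub>R (p - c) + (1/2) *\<^sub>R D" by (simp add: m_def Z_def)
  have "(m - Z) \<bullet> D = \<sigma> * k + (D \<bullet> D) / 2"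
    by (simp add: mZ inner_add_left k')
  then have "(m - Z) \<bullet> D = 0" using \<sigma>k by simp
  from unit_orthogonal_exists[OF dim this] obtain w where
    w: "norm w = 1" "w \<bullet> D = 0" "m - Z = norm (m - Z) *\<^sub>R w" by blast
  define h where "h = norm (m - Z)"
  have h0: "h \<ge> 0" by (simp add: h_def)
  have ww: "w \<bullet> w = 1" using w(1) by (simp add: dot_square_norm)
  have wD: "D \<bullet> w = 0" using w(2) by (simp add: inner_commute)
  define l where "l = norm D / 2"
  have l0: "l > 0" using D0 by (simp add: l_def)
  define e where "e = (1 / norm D) *\<^sub>R D"
  have De: "D = (2 * l) *\<^sub>R e" using D0 by (simp add: e_def l_def)
  have ee: "e \<bullet> e = 1" using D0 by (simp add: e_def dot_square_norm power2_eq_square)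
  have ew: "e \<bullet> w = 0" "w \<bullet> e = 0" using w(2) wD by (simp_all add: e_def)
  have DDl: "D \<bullet> D = 4 * l\<^sup>2" by (simp add: l_def dot_square_norm power2_eq_square)
  have h2: "h\<^sup>2 = R0\<^sup>2 - l\<^sup>2"
  proof -
    have "h\<^sup>2 = (m - Z) \<bullet> (m - Z)" by (simp add: h_def power2_norm_eq_inner)
    also have "\<dots> = \<sigma>\<^sup>2 * R\<^sup>2 + \<sigma> * k + (D \<bullet> D) / 4"
      unfolding mZ by (simp only: inner_add_left inner_add_right inner_scaleR_left inner_scaleR_right pc)
        (simp add: k_def inner_commute power2_eq_square algebra_simps)
    also have "\<dots> = R0\<^sup>2 - l\<^sup>2" using \<sigma>k DDl by (simp add: R0_def power_mult_distrib)
    finally show ?thesis .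
  qed
  have mq: "m = Z + h *\<^sub>R w" using w(3) unfolding h_def by (metis add.commute diff_add_cancel)
  \<comment> \<open>Coordinates in the plane of the arc: \<open>t\<close> runs along the chord from
    \<open>p\<close> (-1) to \<open>q\<close> (1), and \<open>s\<close> is the height above it.
    \<open>\<psi>\<close> is the height of the arc on the side away from \<open>Z\<close>, so
    \<open>S t (max 0 (\<psi> t - \<delta>))\<close> is that arc lowered by \<open>\<delta>\<close>
    and cut off at the chord.\<close>
  define S where "S t s = m + (t * l) *\<^sub>R e + s *\<^sub>R w" for t s :: real
  define \<zeta> where "\<zeta> t = sqrt (R0\<^sup>2 - (t * l)\<^sup>2)" for t :: real
  define \<psi> where "\<psi> t = \<zeta> t - h" for t :: real
  have tl: "(t * l)\<^sup>2 \<le> l\<^sup>2" if "t \<in> {-1..1}" for t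
    using that l0 by (simp add: power_mult_distrib abs_square_le_1 abs_le_iff)
  have \<psi>0: "\<psi> t \<ge> 0" if "t \<in> {-1..1}" for t
  proof -
    have "h\<^sup>2 \<le> R0\<^sup>2 - (t * l)\<^sup>2" using tl[OF that] h2 by simp
    then have "h \<le> \<zeta> t" unfolding \<zeta>_def using real_le_rsqrt by blast
    then show ?thesis by (simp add: \<psi>_def)
  qed
  have \<psi>e: "\<psi> t = 0" if "t = 1 \<or> t = -1" for t
  proof -
    have "(t * l)\<^sup>2 = l\<^sup>2" using that by auto
    then have "\<zeta> t = sqrt (h\<^sup>2)" using h2 by (simp add: \<zeta>_def)
    then show ?thesis using h0 by (simp add: \<psi>_def)
  qed
  have qe: "q = p + (2 * l) *\<^sub>R e" using De D_def by (metis add.commute diff_add_cancel)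
  have Sp: "S (-1) 0 = p" "S 1 0 = q"
    unfolding S_def m_def De qe by (simp_all flip: scaleR_add_left)
  have chord: "S t 0 \<in> K" if "t \<in> {-1..1}" for t
  proof -
    have "S t 0 = ((1 - t)/2) *\<^sub>R p + ((1 + t)/2) *\<^sub>R q"
    proof -
      have "((1 - t)/2) *\<^sub>R p + ((1 + t)/2) *\<^sub>R q = ((1 - t)/2 + (1 + t)/2) *\<^sub>R p + ((1 + t)/2 * (2 * l)) *\<^sub>R e"
        unfolding qe scaleR_add_right scaleR_add_left by simp
      also have "(1 - t)/2 + (1 + t)/2 = 1" by (simp add: field_simps)
      also have "(1 + t)/2 * (2 * l) = l + t * l" by (simp add: field_simps)
      finally show ?thesis unfolding S_def m_def De by (simp add: scaleR_add_left)
    qed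
    then show ?thesis using K(1) pK q(1) that by (simp add: convex_def field_simps)
  qed
  have cont\<psi>: "continuous_on UNIV \<psi>" unfolding \<psi>_def \<zeta>_def by (intro continuous_intros)
  have limS: "((\<lambda>n. S (f n) (g n)) \<longlongrightarrow> S t s) F" if "(f \<longlongrightarrow> t) F" "(g \<longlongrightarrow> s) F"
    for f g t s and F :: "'x filter"
    unfolding S_def using that by (intro tendsto_intros)
  have lim\<psi>: "((\<lambda>n. \<psi> (f n)) \<longlongrightarrow> \<psi> t) F" if "(f \<longlongrightarrow> t) F" for f t and F :: "'x filter"
    using continuous_on_tendsto_compose[OF cont\<psi> that] by simp
  define Q where "Q \<delta> \<longleftrightarrow> (\<forall>t\<in>{-1..1}. S t (max 0 (\<psi> t - \<delta>)) \<in> K)" for \<delta>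
  have "compact (\<psi> ` {-1..1})"
    using cont\<psi> compact_continuous_image continuous_on_subset by blast
  then have "bounded (\<psi> ` {-1..1})" by (rule compact_imp_bounded)
  then obtain M where "\<forall>x\<in>\<psi> ` {-1..1}. \<bar>x\<bar> \<le> M" unfolding bounded_real by blast
  then have M: "\<psi> t \<le> M" if "t \<in> {-1..1}" for t using that by (auto dest: abs_le_D1)
  have QM: "Q (max M 0)"
    unfolding Q_def
  proof
    fix t :: real assume t: "t \<in> {-1..1}"
    have "max 0 (\<psi> t - max M 0) = 0" using M[OF t] by auto
    then show "S t (max 0 (\<psi> t - max M 0)) \<in> K" using chord[OF t] by simp
  qed
  \<comment> \<open>On the larger tangent circle \<open>2 * ((x - p) \<bullet> (p - c))\<close>
    equals - |x - p|^2 / \<sigma>, so |x - c|^2 - R^2 = (1 - 1/\<sigma>) |x - p|^2 > 0: the arc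
    leaves the ball at once.\<close>
  have notQ0: "\<not> Q 0"
  proof
    assume Q0: "Q 0"
    have "((\<lambda>t. S t (\<psi> t)) \<longlongrightarrow> S (-1) (\<psi> (-1))) (at_right (-1))"
      by (intro limS lim\<psi> tendsto_intros)
    then have "((\<lambda>t. S t (\<psi> t)) \<longlongrightarrow> p) (at_right (-1))" using Sp \<psi>e by simp
    then have "\<forall>\<^sub>F t in at_right (-1). S t (\<psi> t) \<in> U"
      using p(2,3) topological_tendstoD by blast
    moreover have "\<forall>\<^sub>F t in at_right (-1::real). t > -1" by (rule eventually_at_right_less)
    moreover have "\<forall>\<^sub>F t in at_right (-1::real). t < 1"
      by (rule eventually_at_rightI[of _ 1]) auto
    ultimately have "\<forall>\<^sub>F t in at_right (-1). S t (\<psi> t) \<in> U \<and> t > -1 \<and> t < 1"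
      by eventually_elim auto
    then obtain t where t: "S t (\<psi> t) \<in> U" "t > -1" "t < 1"
      using eventually_happens trivial_limit_at_right_real by blast
    define x where "x = S t (\<psi> t)"
    have "x \<in> K" using Q0 t \<psi>0[of t] unfolding Q_def x_def by (metis atLeastAtMost_iff diff_0_right less_imp_le max.absorb2)
    then have "norm (x - c) \<le> R" using t p(5) by (auto simp: x_def dist_norm norm_minus_commute)
    then have 1: "(norm (p + (x - p) - c))\<^sup>2 \<le> R\<^sup>2" by (simp add: power_mono)
    have xZ: "x - Z = (t * l) *\<^sub>R e + \<zeta> t *\<^sub>R w" by (simp add: x_def S_def mq \<psi>_def algebra_simps)
    have "R0\<^sup>2 - (t * l)\<^sup>2 \<ge> 0" using tl[of t] t h2 by (smt (verit) atLeastAtMost_iff zero_le_power2)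
    then have z2: "(\<zeta> t)\<^sup>2 = R0\<^sup>2 - (t * l)\<^sup>2" by (simp add: \<zeta>_def)
    have "(x - Z) \<bullet> (x - Z) = (t * l)\<^sup>2 + (\<zeta> t)\<^sup>2"
      unfolding xZ by (simp add: inner_add_left inner_add_right ee ew ww power2_eq_square)
    then have 2: "(x - Z) \<bullet> (x - Z) = R0\<^sup>2" using z2 by simp
    have "x - Z = (x - p) + \<sigma> *\<^sub>R (p - c)" by (simp add: Z_def)
    then have "(x - p) \<bullet> (x - p) + 2 * \<sigma> * ((x - p) \<bullet> (p - c)) + \<sigma>\<^sup>2 * R\<^sup>2 = R0\<^sup>2"
      using 2 by (simp only: inner_add_left inner_add_right inner_scaleR_left inner_scaleR_right pc)
        (simp add: inner_commute power2_eq_square algebra_simps)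
    then have 3: "2 * ((x - p) \<bullet> (p - c)) = - ((x - p) \<bullet> (x - p)) / \<sigma>"
      using \<sigma>1 by (simp add: R0_def power_mult_distrib field_simps)
    have "x \<noteq> p"
    proof
      assume "x = p"
      have "(x - m) \<bullet> e = t * l" by (simp add: x_def S_def inner_add_left ee ew)
      moreover have "(p - m) \<bullet> e = - l" by (simp add: m_def De ee)
      ultimately have "t * l = - l" using \<open>x = p\<close> by simp
      then show False using l0 t(2) by (metis mult_minus1 mult_right_cancel less_irrefl)
    qed
    then have "(x - p) \<bullet> (x - p) > 0" by simp
    then have "(x - p) \<bullet> (x - p) / \<sigma> < (x - p) \<bullet> (x - p)" using \<sigma>1 by (simp add: field_simps)
    then show False using 1 3 unfolding nrm by simp
  qed
  define \<Delta> where "\<Delta> = {\<delta>. \<delta> \<ge> 0 \<and> Q \<delta>}"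
  define \<delta> where "\<delta> = Inf \<Delta>"
  have bdd: "bdd_below \<Delta>" by (rule bdd_belowI[of _ 0]) (simp add: \<Delta>_def)
  have ne: "\<Delta> \<noteq> {}" using QM by (auto simp: \<Delta>_def intro: exI[of _ "max M 0"])
  have "closed \<Delta>"
    unfolding closed_sequential_limits
  proof (intro allI impI)
    fix f a assume fa: "(\<forall>n. f n \<in> \<Delta>) \<and> f \<longlonglongrightarrow> a"
    then have "a \<ge> 0" by (intro LIMSEQ_le_const[of f]) (auto simp: \<Delta>_def)
    moreover have "Q a" unfolding Q_def
    proof
      fix t :: real assume t: "t \<in> {-1..1}"
      have "(\<lambda>n. S t (max 0 (\<psi> t - f n))) \<longlonglongrightarrow> S t (max 0 (\<psi> t - a))"
        using fa by (intro limS tendsto_intros) auto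
      then show "S t (max 0 (\<psi> t - a)) \<in> K"
        by (rule closed_sequentially[OF K(2), rotated]) (use fa t in \<open>auto simp: \<Delta>_def Q_def\<close>)
    qed
    ultimately show "a \<in> \<Delta>" by (simp add: \<Delta>_def)
  qed
  then have "\<delta> \<in> \<Delta>" using closed_contains_Inf[OF ne bdd] by (simp add: \<delta>_def)
  then have Qd: "Q \<delta>" and "\<delta> \<ge> 0" by (auto simp: \<Delta>_def)
  then have dpos: "\<delta> > 0" using notQ0 by (cases "\<delta> = 0") auto
  \<comment> \<open>Shifts slightly below the minimum fail at parameters \<open>T n\<close>; the
    failing points are outside \<open>K\<close> and accumulate at \<open>P\<close>, which is
    therefore a boundary point.\<close>
  define d where "d n = \<delta> - \<delta> / real (n + 2)" for n
  have d1: "0 \<le> d n" "d n < \<delta>" for n using dpos by (auto simp: d_def field_simps)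
  have dlim: "d \<longlonglongrightarrow> \<delta>"
  proof -
    have "(\<lambda>n. \<delta> / real (n + 2)) \<longlonglongrightarrow> 0"
      by (rule LIMSEQ_ignore_initial_segment[OF lim_const_over_n])
    then have "(\<lambda>n. \<delta> - \<delta> / real (n + 2)) \<longlonglongrightarrow> \<delta> - 0"
      by (intro tendsto_intros)
    then show ?thesis by (simp add: d_def[abs_def])
  qed
  have "\<exists>t\<in>{-1..1}. S t (max 0 (\<psi> t - d n)) \<notin> K" for n
  proof -
    have "d n \<notin> \<Delta>" using d1(2)[of n] cInf_lower[OF _ bdd] by (force simp: \<delta>_def)
    then show ?thesis using d1(1) by (auto simp: \<Delta>_def Q_def)
  qed
  then obtain T where T: "\<And>n. T n \<in> {-1..1}" "\<And>n. S (T n) (max 0 (\<psi> (T n) - d n)) \<notin> K"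
    by metis
  obtain t r where t: "t \<in> {-1..1}" "strict_mono r" "(T \<circ> r) \<longlonglongrightarrow> t"
    using compact_Icc[of "-1::real" 1] T(1) unfolding compact_def by metis
  have Tgt: "\<psi> (T n) > d n" for n
  proof (rule ccontr)
    assume "\<not> \<psi> (T n) > d n"
    then have "max 0 (\<psi> (T n) - d n) = 0" by simp
    then show False using T(2)[of n] chord[OF T(1)[of n]] by simp
  qed
  have Tlim: "(\<lambda>n. T (r n)) \<longlonglongrightarrow> t" using t(3) by (simp add: o_def)
  have dr: "(\<lambda>n. d (r n)) \<longlonglongrightarrow> \<delta>"
    using LIMSEQ_subseq_LIMSEQ[OF dlim t(2)] by (simp add: o_def)
  have \<psi>t: "\<psi> t \<ge> \<delta>"
    by (rule LIMSEQ_le[OF dr lim\<psi>[OF Tlim]]) (use Tgt less_imp_le in blast)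
  define P where "P = S t (\<psi> t - \<delta>)"
  have PK: "P \<in> K" using Qd t(1) \<psi>t by (auto simp: Q_def P_def max_def split: if_splits)
  have "(\<lambda>n. S (T (r n)) (\<psi> (T (r n)) - d (r n))) \<longlonglongrightarrow> P"
    unfolding P_def by (intro limS lim\<psi> tendsto_intros Tlim dr)
  moreover have "S (T (r n)) (\<psi> (T (r n)) - d (r n)) \<in> - K" for n
    using T(2)[of "r n"] Tgt[of "r n"] by (simp add: max_def)
  ultimately have "P \<in> closure (- K)" unfolding closure_sequential by (intro exI conjI allI) auto
  then have "P \<in> frontier K" using PK K(2) by (simp add: frontier_closures)
  from loc[OF this] obtain U' c' where U': "open U'" "P \<in> U'" "P \<in> sphere c' R" "U' \<inter> K \<subseteq> cball c' R"
    by blast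
  \<comment> \<open>\<open>\<psi>\<close> vanishes at both ends but is at least
    \<open>\<delta> > 0\<close> at \<open>t\<close>, so there is room on either side of
    \<open>P\<close>.\<close>
  have t1: "-1 < t" "t < 1" using t(1) \<psi>t dpos \<psi>e[of t] by (auto simp: less_le)
  have nP: "norm (P - c') = R" using U'(3) by (simp add: dist_norm norm_minus_commute)
  have inball: "norm (x - c') \<le> R" if "x \<in> U'" "x \<in> K" for x
    using that U'(4) by (auto simp: dist_norm norm_minus_commute)
  show False
  proof (cases "\<psi> t = \<delta>")
    \<comment> \<open>\<open>P\<close> is an inner point of the chord, which lies in
      \<open>K\<close>. By the parallelogram law, a boundary point of a ball is never the midpoint
      of a nondegenerate segment inside the ball.\<close>
    case True
    have lim1: "((\<lambda>s. S (t + s) 0) \<longlongrightarrow> S (t + 0) 0) (at_right 0)"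
      by (intro limS tendsto_intros)
    have lim2: "((\<lambda>s. S (t - s) 0) \<longlongrightarrow> S (t - 0) 0) (at_right 0)"
      by (intro limS tendsto_intros)
    have P0: "P = S t 0" using True by (simp add: P_def)
    have "\<forall>\<^sub>F s in at_right 0. S (t + s) 0 \<in> U'"
      using lim1 U'(1,2) P0 topological_tendstoD by fastforce
    moreover have "\<forall>\<^sub>F s in at_right 0. S (t - s) 0 \<in> U'"
      using lim2 U'(1,2) P0 topological_tendstoD by fastforce
    moreover have "\<forall>\<^sub>F s in at_right (0::real). s > 0" by (rule eventually_at_right_less)
    moreover have "\<forall>\<^sub>F s in at_right (0::real). s < min (1 - t) (1 + t)"
      by (rule eventually_at_rightI[of _ "min (1 - t) (1 + t)"]) (use t1 in auto)
    ultimately have "\<forall>\<^sub>F s in at_right 0. S (t + s) 0 \<in> U' \<and> S (t - s) 0 \<in> U' \<and> s > 0 \<and> s < min (1 - t) (1 + t)"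
      by eventually_elim auto
    then obtain s where s: "S (t + s) 0 \<in> U'" "S (t - s) 0 \<in> U'" "s > 0" "s < 1 - t" "s < 1 + t"
      using eventually_happens'[OF trivial_limit_at_right_real] by force
    have "norm (S (t + s) 0 - c') \<le> R" "norm (S (t - s) 0 - c') \<le> R"
      using inball s chord[of "t + s"] chord[of "t - s"] by auto
    then have "(norm (S (t + s) 0 - c'))\<^sup>2 + (norm (S (t - s) 0 - c'))\<^sup>2 \<le> R\<^sup>2 + R\<^sup>2"
      by (intro add_mono power_mono) auto
    moreover have "S (t + s) 0 - c' = (P - c') + (s * l) *\<^sub>R e" "S (t - s) 0 - c' = (P - c') - (s * l) *\<^sub>R e"
      by (simp_all add: P0 S_def algebra_simps)
    moreover have "(norm (x + y))\<^sup>2 + (norm (x - y))\<^sup>2 = 2 * (norm x)\<^sup>2 + 2 * (norm y)\<^sup>2" for x y :: 'a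
      unfolding power2_norm_eq_inner by (simp add: inner_add_left inner_add_right inner_diff_left inner_diff_right)
    ultimately have "2 * (norm (P - c'))\<^sup>2 + 2 * (norm ((s * l) *\<^sub>R e))\<^sup>2 \<le> R\<^sup>2 + R\<^sup>2"
      by simp
    then have "2 * R\<^sup>2 + 2 * (norm ((s * l) *\<^sub>R e))\<^sup>2 \<le> 2 * R\<^sup>2" unfolding nP by simp
    moreover have "(norm ((s * l) *\<^sub>R e))\<^sup>2 > 0" using s l0 ee by auto
    ultimately show False by simp
  next
    case False
    then have gt: "\<psi> t - \<delta> > 0" using \<psi>t by simp
    define a b where "a = t * l" and "b = \<zeta> t"
    have b: "b > 0" using gt dpos h0 by (simp add: b_def \<psi>_def)
    have "R0\<^sup>2 - (t * l)\<^sup>2 \<ge> 0" using tl[of t] t h2 by (smt (verit) zero_le_power2)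
    then have ab: "a\<^sup>2 + b\<^sup>2 = R0\<^sup>2" by (simp add: a_def b_def \<zeta>_def)
    \<comment> \<open>\<open>G \<alpha>\<close> is \<open>P\<close> rotated by \<open>- \<alpha>\<close> about the centre \<open>Z - \<delta> *\<^sub>R w\<close> of the moved arc\<close>
    define G where "G \<alpha> = Z - \<delta> *\<^sub>R w + (cos \<alpha> * a + sin \<alpha> * b) *\<^sub>R e + (cos \<alpha> * b - sin \<alpha> * a) *\<^sub>R w" for \<alpha>
    have GS: "G \<alpha> = S ((cos \<alpha> * a + sin \<alpha> * b) / l) (cos \<alpha> * b - sin \<alpha> * a - h - \<delta>)" for \<alpha>
    proof -
      have "(cos \<alpha> * a + sin \<alpha> * b) / l * l = cos \<alpha> * a + sin \<alpha> * b" using l0 by simp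
      then show ?thesis unfolding G_def S_def mq by (simp add: scaleR_diff_left)
    qed
    have G0: "G 0 = P" by (simp add: GS P_def a_def b_def \<psi>_def) (use l0 in simp)
    have pre: "\<forall>\<^sub>F \<alpha> in at 0. G \<alpha> \<in> U' \<and> G \<alpha> \<in> K"
    proof -
      have limG: "(G \<longlongrightarrow> G 0) (at 0)" unfolding G_def by (intro tendsto_intros)
      have e1: "\<forall>\<^sub>F \<alpha> in at 0. G \<alpha> \<in> U'" using limG U'(1,2) G0 topological_tendstoD by fastforce
      have "((\<lambda>\<alpha>. (cos \<alpha> * a + sin \<alpha> * b) / l) \<longlongrightarrow> (cos 0 * a + sin 0 * b) / l) (at 0)"
        using l0 by (intro tendsto_intros) auto
      then have l1: "((\<lambda>\<alpha>. (cos \<alpha> * a + sin \<alpha> * b) / l) \<longlongrightarrow> t) (at 0)" using l0 by (simp add: a_def)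
      have e2: "\<forall>\<^sub>F \<alpha> in at 0. (cos \<alpha> * a + sin \<alpha> * b) / l < 1"
        using order_tendstoD(2)[OF l1] t1 by blast
      have e3: "\<forall>\<^sub>F \<alpha> in at 0. (cos \<alpha> * a + sin \<alpha> * b) / l > -1"
        using order_tendstoD(1)[OF l1] t1 by blast
      have "((\<lambda>\<alpha>. cos \<alpha> * b - sin \<alpha> * a - h - \<delta>) \<longlongrightarrow> cos 0 * b - sin 0 * a - h - \<delta>) (at 0)"
        by (intro tendsto_intros)
      then have e4: "\<forall>\<^sub>F \<alpha> in at 0. cos \<alpha> * b - sin \<alpha> * a - h - \<delta> > 0"
        by (rule order_tendstoD(1)) (use gt in \<open>simp add: b_def \<psi>_def\<close>)
      show ?thesis using e1 e2 e3 e4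
      proof eventually_elim
        case (elim \<alpha>)
        define t' where "t' = (cos \<alpha> * a + sin \<alpha> * b) / l"
        have t'l: "t' * l = cos \<alpha> * a + sin \<alpha> * b" using l0 by (simp add: t'_def)
        have "(cos \<alpha> * a + sin \<alpha> * b)\<^sup>2 + (cos \<alpha> * b - sin \<alpha> * a)\<^sup>2 = ((sin \<alpha>)\<^sup>2 + (cos \<alpha>)\<^sup>2) * (a\<^sup>2 + b\<^sup>2)"
          by algebra
        then have "R0\<^sup>2 - (t' * l)\<^sup>2 = (cos \<alpha> * b - sin \<alpha> * a)\<^sup>2" using ab t'l by simp
        moreover have "cos \<alpha> * b - sin \<alpha> * a > 0" using elim h0 dpos by simp
        ultimately have "\<zeta> t' = cos \<alpha> * b - sin \<alpha> * a" by (simp add: \<zeta>_def)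
        then have "G \<alpha> = S t' (max 0 (\<psi> t' - \<delta>))" using elim GS[of \<alpha>] by (simp add: t'_def \<psi>_def max_def)
        moreover have "t' \<in> {-1..1}" using elim by (simp add: t'_def)
        ultimately show ?case using Qd elim by (simp add: Q_def)
      qed
    qed
    then obtain \<rho> where \<rho>: "\<rho> > 0" "\<And>\<alpha>. \<alpha> \<noteq> 0 \<Longrightarrow> dist \<alpha> 0 < \<rho> \<Longrightarrow> G \<alpha> \<in> U' \<and> G \<alpha> \<in> K"
      unfolding eventually_at by auto
    define \<alpha> where "\<alpha> = min (\<rho> / 2) 1"
    have \<alpha>: "0 < \<alpha>" "\<alpha> < \<rho>" "\<alpha> \<le> 1" using \<rho>(1) by (auto simp: \<alpha>_def)
    have cos1: "cos \<alpha> < 1" using cos_monotone_0_pi[of 0 \<alpha>] \<alpha> pi_ge_two by simp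
    have gb: "norm (G \<alpha> - c') \<le> R" "norm (G (-\<alpha>) - c') \<le> R"
      using \<rho>(2)[of \<alpha>] \<rho>(2)[of "-\<alpha>"] \<alpha> inball by auto
    define v where "v = Z - \<delta> *\<^sub>R w - c'"
    define ve vw where "ve = v \<bullet> e" and "vw = v \<bullet> w"
    have nG: "(norm (G \<beta> - c'))\<^sup>2 = v \<bullet> v + R0\<^sup>2 + 2 * ((cos \<beta> * a + sin \<beta> * b) * ve + (cos \<beta> * b - sin \<beta> * a) * vw)" for \<beta>
    proof -
      have "G \<beta> - c' = v + (cos \<beta> * a + sin \<beta> * b) *\<^sub>R e + (cos \<beta> * b - sin \<beta> * a) *\<^sub>R w"
        by (simp add: G_def v_def)
      moreover have "(norm (v + x *\<^sub>R e + y *\<^sub>R w))\<^sup>2 = v \<bullet> v + (x\<^sup>2 + y\<^sup>2) + 2 * (x * ve + y * vw)" for x y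
        unfolding power2_norm_eq_inner ve_def vw_def
        by (simp add: inner_add_left inner_add_right ee ew ww inner_commute[of e v]
            inner_commute[of w v] power2_eq_square algebra_simps)
      moreover have "(cos \<beta> * a + sin \<beta> * b)\<^sup>2 + (cos \<beta> * b - sin \<beta> * a)\<^sup>2 = ((sin \<beta>)\<^sup>2 + (cos \<beta>)\<^sup>2) * (a\<^sup>2 + b\<^sup>2)"
          by algebra
      ultimately show ?thesis using ab by simp
    qed
    \<comment> \<open>Let A = \<open>a * ve + b * vw\<close>, the inner product of \<open>v\<close>
      with the radius of the moved arc at \<open>P\<close>. Adding the estimates for
      \<open>\<alpha>\<close> and \<open>-\<alpha>\<close> cancels the sines and leaves cos \<alpha>
      A \<le> A, so A \<ge> 0; then this equation gives R^2 \<ge> R0^2.\<close>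
    have eq0: "R\<^sup>2 = v \<bullet> v + R0\<^sup>2 + 2 * (a * ve + b * vw)"
      using nG[of 0] G0 nP by simp
    have "(norm (G \<alpha> - c'))\<^sup>2 \<le> R\<^sup>2" "(norm (G (-\<alpha>) - c'))\<^sup>2 \<le> R\<^sup>2" using gb by (simp_all add: power_mono)
    then have "(cos \<alpha> * a + sin \<alpha> * b) * ve + (cos \<alpha> * b - sin \<alpha> * a) * vw \<le> a * ve + b * vw"
      "(cos \<alpha> * a - sin \<alpha> * b) * ve + (cos \<alpha> * b + sin \<alpha> * a) * vw \<le> a * ve + b * vw"
      using nG[of \<alpha>] nG[of "-\<alpha>"] eq0 by auto
    then have "cos \<alpha> * (a * ve + b * vw) \<le> a * ve + b * vw" by (simp add: algebra_simps)
    then have "(1 - cos \<alpha>) * (a * ve + b * vw) \<ge> 0" by (simp add: algebra_simps)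
    then have "a * ve + b * vw \<ge> 0" using cos1 by (simp add: zero_le_mult_iff)
    moreover have "v \<bullet> v \<ge> 0" by simp
    moreover have "R0\<^sup>2 > R\<^sup>2" using R0 R by (simp add: power_strict_mono)
    moreover have "2 * (a * ve + b * vw) \<ge> 0" using calculation(1) by simp
    ultimately show False using eq0 by linarith
  qed
qed


section \<open>Contact points of the largest inscribed ball\<close>

text \<open>The largest ball inside \<open>K\<close> about a centre \<open>c\<close> has radius
  \<open>infdist c (- K)\<close>, which is continuous in \<open>c\<close> and so has a maximum on
  the compact set \<open>K\<close>. This maximum gives the \<open>GREATEST\<close> in
  \<open>inradius\<close> its meaning.\<close>

lemma inradius_attained:
  fixes K :: "'a::euclidean_space set"
  assumes "convex_body K"
  shows "0 < inradius K" and "\<exists>c. cball c (inradius K) \<subseteq> K"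
    and "\<And>c r. 0 < r \<Longrightarrow> cball c r \<subseteq> K \<Longrightarrow> r \<le> inradius K"
proof -
  have K: "compact K" "interior K \<noteq> {}" using assms by (auto simp: convex_body_def)
  \<comment> \<open>The distance to an empty set defaults to 0, so this is settled first.\<close>
  have ne: "- K \<noteq> {}" using K(1) compact_imp_bounded not_bounded_UNIV
    by (metis compl_bot_eq double_complement)
  have inside: "infdist c (- K) \<ge> r" if "cball c r \<subseteq> K" for c r
    unfolding infdist_notempty[OF ne]
  proof (rule cINF_greatest[OF ne])
    fix x assume "x \<in> - K"
    then have "x \<notin> cball c r" using that by blast
    then show "r \<le> dist c x" by simp
  qed
  have sub: "cball c r \<subseteq> K" if "r > 0" "infdist c (- K) \<ge> r" for c r
  proof -
    have "ball c r \<subseteq> K"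
      using that infdist_le[of _ "- K" c] by (force simp: dist_commute)
    then have "closure (ball c r) \<subseteq> K" using K(1) by (simp add: closure_minimal compact_imp_closed)
    then show ?thesis using that by simp
  qed
  have "K \<noteq> {}" using K(2) by auto
  moreover have "continuous_on K (\<lambda>c. infdist c (- K))" by (intro continuous_intros)
  ultimately obtain c0 where c0: "c0 \<in> K" "\<forall>y\<in>K. infdist y (- K) \<le> infdist c0 (- K)"
    using continuous_attains_sup[OF K(1)] by blast
  define r where "r = infdist c0 (- K)"
  obtain x e where "e > 0" "cball x e \<subseteq> K"
    using K(2) mem_interior_cball by blast
  then have "x \<in> K" "infdist x (- K) \<ge> e" using inside by auto
  then have rpos: "r > 0" using c0(2) \<open>e > 0\<close> unfolding r_def by force
  have max: "r' \<le> r" if "0 < r'" "cball c r' \<subseteq> K" for c r'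
  proof -
    have "c \<in> K" using that by auto
    then show ?thesis using c0(2) inside[OF that(2)] unfolding r_def by force
  qed
  have "inradius K = r"
    unfolding inradius_def
    by (rule Greatest_equality) (use rpos sub[of r c0] max r_def in auto)
  then show "0 < inradius K" "\<exists>c. cball c (inradius K) \<subseteq> K"
    "\<And>c r. 0 < r \<Longrightarrow> cball c r \<subseteq> K \<Longrightarrow> r \<le> inradius K"
    using rpos sub[of r c0] max r_def by auto
qed

lemma inradius_eqI:
  assumes "0 < r" "cball c r \<subseteq> K" "\<And>c r'. 0 < r' \<Longrightarrow> cball c r' \<subseteq> K \<Longrightarrow> r' \<le> r"
  shows "inradius K = r"
  unfolding inradius_def by (rule Greatest_equality) (use assms in auto)

text \<open>If the contact points lay in an open half-space, the ball could be moved away from them and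
  then enlarged.\<close>
lemma zero_in_hull_contact_normals:
  fixes K :: "'a::euclidean_space set"
  assumes K: "compact K" and r: "0 < r" "cball z r \<subseteq> K"
    and max: "\<And>c r'. 0 < r' \<Longrightarrow> cball c r' \<subseteq> K \<Longrightarrow> r' \<le> r"
  shows "0 \<in> convex hull {u. norm u = 1 \<and> z + r *\<^sub>R u \<in> frontier K}"
proof (rule ccontr)
  define T where "T = {u. norm u = 1 \<and> z + r *\<^sub>R u \<in> frontier K}"
  assume "0 \<notin> convex hull {u. norm u = 1 \<and> z + r *\<^sub>R u \<in> frontier K}"
  then have nT: "0 \<notin> convex hull T" by (simp add: T_def)
  have "T = sphere 0 1 \<inter> (\<lambda>u. z + r *\<^sub>R u) -` frontier K" by (auto simp: T_def)
  moreover have "closed ((\<lambda>u. z + r *\<^sub>R u) -` frontier K)"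
    by (intro closed_vimage frontier_closed continuous_intros)
  ultimately have cT: "compact T" by (simp add: compact_Int_closed)
  then have "closed (convex hull T)" using compact_convex_hull compact_imp_closed by blast
  from separating_hyperplane_closed_0[OF convex_convex_hull this nT] obtain a b
    where ab: "b > 0" "\<forall>x\<in>convex hull T. a \<bullet> x > b" by blast
  have aT: "a \<bullet> u > b" if "u \<in> T" for u using ab(2) that hull_inc by metis
  have bd: "bounded K" using K compact_imp_bounded by blast
  \<comment> \<open>Moved by a multiple of \<open>- a\<close>, the ball cannot lie in
    \<open>interior K\<close>: it would have positive distance from the complement and could be
    enlarged.\<close>
  have "\<exists>y. norm y \<le> 1 \<and> z - (1 / real (Suc n)) *\<^sub>R a + r *\<^sub>R y \<notin> interior K" for n
  proof (rule ccontr)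
    assume "\<not> ?thesis"
    then have H: "z - (1 / real (Suc n)) *\<^sub>R a + r *\<^sub>R y \<in> interior K" if "norm y \<le> 1" for y
      using that by blast
    define c where "c = z - (1 / real (Suc n)) *\<^sub>R a"
    have "cball c r \<subseteq> interior K"
    proof
      fix x assume "x \<in> cball c r"
      then have "norm ((1/r) *\<^sub>R (x - c)) \<le> 1" using r by (simp add: dist_norm norm_minus_commute)
      from H[OF this] show "x \<in> interior K" using r by (simp add: c_def)
    qed
    then have "cball c r \<inter> (- interior K) = {}" by auto
    moreover have "- interior K \<noteq> {}"
      using bd interior_subset not_bounded_UNIV bounded_subset by (metis compl_bot_eq double_complement)
    moreover have "closed (- interior K)" by (simp only: closed_Compl open_interior)
    ultimately have "setdist (cball c r) (- interior K) > 0"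
      using setdist_gt_0_compact_closed[of "cball c r" "- interior K"] r by auto
    then obtain d where d: "d > 0" "d < setdist (cball c r) (- interior K)" using dense by blast
    have "cball c (r + d) \<subseteq> K"
    proof
      fix x assume x: "x \<in> cball c (r + d)"
      show "x \<in> K"
      proof (rule ccontr)
        assume "x \<notin> K"
        then have xn: "x \<in> - interior K" using interior_subset by blast
        then have xc: "dist c x > r" using \<open>cball c r \<subseteq> interior K\<close> by force
        define y where "y = c + (r / dist c x) *\<^sub>R (x - c)"
        have "c \<noteq> x" using xc r by auto
        then have "y \<in> cball c r" using r by (simp add: y_def dist_norm norm_minus_commute)
        then have 1: "d < dist y x" using d setdist_le_dist[OF _ xn, of y "cball c r"] by linarith
        have "y - x = (r / dist c x - 1) *\<^sub>R (x - c)" by (simp add: y_def algebra_simps)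
        then have "dist y x = \<bar>r / dist c x - 1\<bar> * dist c x" by (simp add: dist_norm norm_minus_commute)
        also have "\<dots> = dist c x - r" using xc r \<open>c \<noteq> x\<close> by (simp add: abs_if field_simps)
        finally show False using 1 x by simp
      qed
    qed
    then show False using max[of "r + d" c] r d by simp
  qed
  then obtain Y where Y: "\<And>n. norm (Y n) \<le> 1"
    "\<And>n. z - (1 / real (Suc n)) *\<^sub>R a + r *\<^sub>R Y n \<notin> interior K" by metis
  \<comment> \<open>A limit of directions in which the moved balls leave \<open>interior K\<close>
    is a contact normal of the original ball, hence satisfies
    \<open>a \<bullet> y > b\<close>.\<close>
  have "\<forall>n. Y n \<in> cball 0 1" using Y by simp
  then obtain y s where y: "y \<in> cball 0 1" "strict_mono s" "(Y \<circ> s) \<longlonglongrightarrow> y"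
    using compact_cball[of "0::'a" 1] unfolding compact_def by metis
  have inv: "(\<lambda>n. 1 / real (Suc (s n))) \<longlonglongrightarrow> 0"
    using LIMSEQ_subseq_LIMSEQ[OF LIMSEQ_Suc[OF lim_const_over_n[of 1]] y(2)] by (simp add: o_def)
  have Yl: "(\<lambda>n. Y (s n)) \<longlonglongrightarrow> y" using y(3) by (simp add: o_def)
  have "(\<lambda>n. z - (1 / real (Suc (s n))) *\<^sub>R a + r *\<^sub>R Y (s n)) \<longlonglongrightarrow> z - 0 *\<^sub>R a + r *\<^sub>R y"
    by (intro tendsto_intros inv Yl)
  moreover have "closed (- interior K)" by (simp only: closed_Compl open_interior)
  ultimately have "z - 0 *\<^sub>R a + r *\<^sub>R y \<in> - interior K"
    by (rule closed_sequentially[rotated 2]) (use Y in auto)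
  then have ni: "z + r *\<^sub>R y \<notin> interior K" by simp
  have bi: "ball z r \<subseteq> interior K" using r by (meson ball_subset_cball interior_maximal open_ball order_trans)
  have "z + r *\<^sub>R y \<in> cball z r" using y(1) r by (simp add: dist_norm)
  then have fr: "z + r *\<^sub>R y \<in> frontier K" using r(2) ni closure_subset[of K] by (auto simp: frontier_def)
  have "norm y = 1"
  proof (rule ccontr)
    assume "norm y \<noteq> 1"
    then have "norm y < 1" using y(1) by simp
    then have "z + r *\<^sub>R y \<in> ball z r" using r by (simp add: dist_norm)
    then show False using bi ni by blast
  qed
  then have "y \<in> T" using fr by (simp add: T_def)
  then have ay: "a \<bullet> y > b" by (rule aT)
  have "(\<lambda>n. a \<bullet> Y (s n)) \<longlonglongrightarrow> a \<bullet> y" by (intro tendsto_intros Yl)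
  then have "\<forall>\<^sub>F n in sequentially. a \<bullet> Y (s n) > b" using ay order_tendstoD(1) by blast
  \<comment> \<open>Below the bound \<open>2 * r * b\<close>, the quadratic term of |r Y - t a|^2 is
    smaller than the linear gain, so the escaping point lies in the open inscribed ball after
    all.\<close>
  moreover have "(\<lambda>n. 1 / real (Suc (s n)) * (a \<bullet> a)) \<longlonglongrightarrow> 0 * (a \<bullet> a)" by (intro tendsto_intros inv)
  then have "\<forall>\<^sub>F n in sequentially. 1 / real (Suc (s n)) * (a \<bullet> a) < 2 * r * b"
    by (rule order_tendstoD(2)) (use r ab in simp)
  ultimately have "\<forall>\<^sub>F n in sequentially. a \<bullet> Y (s n) > b \<and> 1 / real (Suc (s n)) * (a \<bullet> a) < 2 * r * b"
    by eventually_elim auto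
  then obtain n where n: "a \<bullet> Y (s n) > b" "1 / real (Suc (s n)) * (a \<bullet> a) < 2 * r * b"
    by (metis (no_types, lifting) eventually_happens sequentially_bot)
  define t where "t = 1 / real (Suc (s n))"
  have t: "t > 0" by (simp add: t_def)
  define v where "v = r *\<^sub>R Y (s n) - t *\<^sub>R a"
  have "(norm v)\<^sup>2 = r\<^sup>2 * (norm (Y (s n)))\<^sup>2 - 2 * (r * t * (a \<bullet> Y (s n))) + t * (t * (a \<bullet> a))"
    unfolding v_def power2_norm_eq_inner
    by (simp add: inner_diff_left inner_diff_right inner_commute[of "Y (s n)" a] power2_eq_square algebra_simps)
  moreover have "r\<^sup>2 * (norm (Y (s n)))\<^sup>2 \<le> r\<^sup>2 * 1"
    using Y(1)[of "s n"] by (intro mult_left_mono) (auto simp: abs_square_le_1)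
  moreover have "t * (t * (a \<bullet> a)) < t * (2 * r * b)"
    using n(2) t unfolding t_def[symmetric] by (intro mult_strict_left_mono)
  moreover have "r * t * b \<le> r * t * (a \<bullet> Y (s n))" using n(1) r t by (intro mult_left_mono) auto
  moreover have "t * (2 * r * b) = 2 * (r * t * b)" by simp
  ultimately have "(norm v)\<^sup>2 < r\<^sup>2" by linarith
  then have "norm v < r" using r by (simp add: power_less_imp_less_base)
  then have "z + v \<in> interior K" using bi by (auto simp: dist_norm subset_eq)
  then show False using Y(2)[of "s n"] by (simp add: v_def t_def algebra_simps)
qed

text \<open>The inclusion gives \<open>dist z c \<le> R - r\<close> and the common boundary point
  the reverse, so the triangle inequality for \<open>(z - c) + r *\<^sub>R u\<close> is an equality
  and \<open>z - c\<close> is a nonnegative multiple of \<open>u\<close>.\<close>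

lemma tangent_ball_centre:
  fixes z :: "'a::euclidean_space"
  assumes r: "0 < r" and u: "norm u = 1" and sub: "cball z r \<subseteq> cball c R"
    and sp: "z + r *\<^sub>R u \<in> sphere c R"
  shows "r \<le> R" and "c = z - (R - r) *\<^sub>R u"
proof -
  have 1: "dist z c + r \<le> R" using sub r by (simp add: cball_subset_cball_iff)
  have 2: "norm ((z - c) + r *\<^sub>R u) = R"
    using sp by (simp add: dist_norm norm_minus_commute algebra_simps)
  have 3: "norm ((z - c) + r *\<^sub>R u) \<le> norm (z - c) + norm (r *\<^sub>R u)" by (rule norm_triangle_ineq)
  have nr: "norm (r *\<^sub>R u) = r" using r u by simp
  have eq: "norm (z - c) = R - r" using 1 2 3 nr by (simp add: dist_norm)
  then have "norm ((z - c) + r *\<^sub>R u) = norm (z - c) + norm (r *\<^sub>R u)" using 2 nr by simp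
  then have "norm (z - c) *\<^sub>R (r *\<^sub>R u) = r *\<^sub>R (z - c)"
    using norm_triangle_eq[of "z - c" "r *\<^sub>R u"] nr by simp
  then have "r *\<^sub>R ((R - r) *\<^sub>R u) = r *\<^sub>R (z - c)" using eq by (simp add: mult.commute)
  then have "(R - r) *\<^sub>R u = z - c" by (rule scaleR_left_imp_eq[rotated]) (use r in simp)
  then show "c = z - (R - r) *\<^sub>R u" by simp
  show "r \<le> R" using eq by (metis diff_ge_0_iff_ge norm_ge_zero)
qed

lemma lam_convex_body_contact_balls:
  fixes K :: "'a::euclidean_space set"
  assumes dim: "DIM('a) \<ge> 2" and lam: "lam > 0" and K: "lam_convex_body lam K"
  obtains z S w where "finite S" "S \<noteq> {}" "\<forall>u\<in>S. norm u = 1" "\<forall>u\<in>S. w u > (0::real)"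
    "sum w S = 1" "(\<Sum>u\<in>S. w u *\<^sub>R u) = 0" "cball z (inradius K) \<subseteq> K" "inradius K \<le> 1 / lam"
    "\<forall>u\<in>S. K \<subseteq> cball (z - (1 / lam - inradius K) *\<^sub>R u) (1 / lam)"
proof -
  have cb: "convex_body K" and loc: "\<And>p. p\<in>frontier K \<Longrightarrow> \<exists>U c. open U \<and> p \<in> U \<and> p \<in> sphere c (1 / lam) \<and>
        U \<inter> K \<subseteq> cball c (1 / lam)" using K by (auto simp: lam_convex_body_def)
  then have cK: "compact K" "convex K" by (auto simp: convex_body_def)
  note inr = inradius_attained[OF cb]
  obtain z where z: "cball z (inradius K) \<subseteq> K" using inr(2) by blast
  define T where "T = {u. norm u = 1 \<and> z + inradius K *\<^sub>R u \<in> frontier K}"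
  have "0 \<in> convex hull T"
    unfolding T_def using zero_in_hull_contact_normals[OF cK(1) inr(1) z] inr(3) by blast
  then obtain S w where S: "finite S" "S \<subseteq> T" "\<forall>u\<in>S. 0 \<le> w u" "sum w S = 1" "(\<Sum>u\<in>S. w u *\<^sub>R u) = 0"
    unfolding convex_hull_explicit by auto
  define S' where "S' = {u\<in>S. w u > 0}"
  have s1: "sum w S' = 1" unfolding S(4)[symmetric] S'_def
    by (rule sum.mono_neutral_left) (use S(1,3) in force)+
  have s2: "(\<Sum>u\<in>S'. w u *\<^sub>R u) = 0" unfolding S(5)[symmetric] S'_def
    by (rule sum.mono_neutral_left) (use S(1,3) in force)+
  \<comment> \<open>At a contact point the supporting ball contains all of \<open>K\<close>, hence
    also the inscribed ball, which touches its sphere there.\<close>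
  have ball: "inradius K \<le> 1 / lam \<and> K \<subseteq> cball (z - (1 / lam - inradius K) *\<^sub>R u) (1 / lam)" if "u \<in> T" for u
  proof -
    have p: "z + inradius K *\<^sub>R u \<in> frontier K" "norm u = 1" using that by (auto simp: T_def)
    from loc[OF p(1)] obtain U c where U: "open U" "z + inradius K *\<^sub>R u \<in> U"
      "z + inradius K *\<^sub>R u \<in> sphere c (1 / lam)" "U \<inter> K \<subseteq> cball c (1 / lam)" by blast
    have sub: "K \<subseteq> cball c (1 / lam)"
      by (rule local_supporting_ball_is_global[OF dim cK(2) compact_imp_closed[OF cK(1)] _ loc p(1) U]) (use lam in simp)
    from tangent_ball_centre[OF inr(1) p(2) order_trans[OF z sub] U(3)] sub show ?thesis by auto
  qed
  have ne: "S' \<noteq> {}" using s1 by auto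
  then obtain u where "u \<in> S'" by blast
  then have "u \<in> T" using S(2) by (auto simp: S'_def)
  show ?thesis
    by (rule that[of S' w z]) (use S s1 s2 z ne ball ball[OF \<open>u \<in> T\<close>] in \<open>auto simp: S'_def T_def subset_eq\<close>)
qed


section \<open>Support functions\<close>

definition support_fun :: "'a::euclidean_space set \<Rightarrow> 'a \<Rightarrow> real" where
  "support_fun K v = (SUP y\<in>K. y \<bullet> v)"

lemma support_fun_upper:
  assumes "bounded K" "x \<in> K"
  shows "x \<bullet> v \<le> support_fun K v"
  unfolding support_fun_def
proof (rule cSUP_upper[OF assms(2)])
  obtain B where "\<forall>y\<in>K. norm y \<le> B" using assms(1) bounded_iff by blast
  then have "y \<bullet> v \<le> B * norm v" if "y \<in> K" for y
    using that norm_cauchy_schwarz[of y v] by (meson mult_right_mono norm_ge_zero order_trans)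
  then show "bdd_above ((\<lambda>y. y \<bullet> v) ` K)" by (auto simp: bdd_above_def)
qed

lemma support_fun_least:
  assumes "K \<noteq> {}" "\<And>x. x \<in> K \<Longrightarrow> x \<bullet> v \<le> M"
  shows "support_fun K v \<le> M"
  unfolding support_fun_def by (rule cSUP_least) (use assms in auto)

lemma support_fun_attained:
  assumes "compact K" "K \<noteq> {}"
  obtains x where "x \<in> K" "x \<bullet> v = support_fun K v"
proof -
  have "continuous_on K (\<lambda>y. y \<bullet> v)" by (intro continuous_intros)
  from continuous_attains_sup[OF assms this] obtain x where x: "x \<in> K" "\<forall>y\<in>K. y \<bullet> v \<le> x \<bullet> v" by blast
  have "support_fun K v = x \<bullet> v"
    by (rule antisym[OF support_fun_least support_fun_upper])
      (use assms x compact_imp_bounded in auto)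
  then show ?thesis using that x by simp
qed

lemma support_fun_mono:
  assumes "K \<subseteq> L" "K \<noteq> {}" "bounded L"
  shows "support_fun K v \<le> support_fun L v"
  using assms by (intro support_fun_least support_fun_upper) auto

lemma support_fun_scale:
  assumes "compact K" "K \<noteq> {}" "c \<ge> 0"
  shows "support_fun K (c *\<^sub>R v) = c * support_fun K v"
proof (rule antisym)
  have b: "bounded K" using assms compact_imp_bounded by blast
  show "support_fun K (c *\<^sub>R v) \<le> c * support_fun K v"
    using assms(3) by (intro support_fun_least assms) (auto intro!: mult_left_mono support_fun_upper b)
  obtain x where "x \<in> K" "x \<bullet> v = support_fun K v" using support_fun_attained[OF assms(1,2)] by blast
  then show "c * support_fun K v \<le> support_fun K (c *\<^sub>R v)"
    using support_fun_upper[OF b, of x "c *\<^sub>R v"] by simp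
qed

lemma support_fun_translation:
  assumes "compact K" "K \<noteq> {}"
  shows "support_fun ((+) z ` K) v = z \<bullet> v + support_fun K v"
proof (rule antisym)
  have b: "bounded K" using assms compact_imp_bounded by blast
  show "support_fun ((+) z ` K) v \<le> z \<bullet> v + support_fun K v"
    using assms by (intro support_fun_least) (auto simp: inner_add_left support_fun_upper b)
  obtain x where "x \<in> K" "x \<bullet> v = support_fun K v" using support_fun_attained[OF assms] by blast
  then show "z \<bullet> v + support_fun K v \<le> support_fun ((+) z ` K) v"
    using support_fun_upper[of "(+) z ` K" "z + x" v] bounded_translation[OF b, of z]
    by (simp add: inner_add_left)
qed

lemma support_fun_orthogonal_image:
  assumes "orthogonal_transformation f"
  shows "support_fun (f ` K) (f v) = support_fun K v"
  using assms by (simp add: support_fun_def image_image orthogonal_transformation_def)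

lemma support_fun_uminus: "support_fun (uminus ` K) v = support_fun K (- v)"
  by (simp add: support_fun_def image_image)

lemma support_fun_Lipschitz:
  assumes "compact K" "K \<noteq> {}" "\<And>x. x \<in> K \<Longrightarrow> norm x \<le> D"
  shows "\<bar>support_fun K u - support_fun K v\<bar> \<le> D * norm (u - v)"
proof -
  have b: "bounded K" using assms compact_imp_bounded by blast
  have "support_fun K u \<le> support_fun K v + D * norm (u - v)" for u v
  proof (rule support_fun_least[OF assms(2)])
    fix x assume x: "x \<in> K"
    have "x \<bullet> u = x \<bullet> v + x \<bullet> (u - v)" by (simp add: inner_diff_right)
    also have "x \<bullet> (u - v) \<le> norm x * norm (u - v)" by (rule norm_cauchy_schwarz)
    also have "\<dots> \<le> D * norm (u - v)" using assms(3)[OF x] by (simp add: mult_right_mono)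
    finally show "x \<bullet> u \<le> support_fun K v + D * norm (u - v)"
      using support_fun_upper[OF b x, of v] by simp
  qed
  from this[of u v] this[of v u] show ?thesis by (simp add: norm_minus_commute abs_le_iff)
qed

lemma compact_norm_bound:
  assumes "compact (K :: 'a::euclidean_space set)"
  obtains D where "D > 0" "\<And>x. x \<in> K \<Longrightarrow> norm x \<le> D"
  using compact_imp_bounded[OF assms] bounded_pos by blast

lemma continuous_on_support_fun:
  assumes "compact (K :: 'a::euclidean_space set)" "K \<noteq> {}"
  shows "continuous_on UNIV (support_fun K)"
proof -
  obtain D where D: "D > 0" "\<And>x. x \<in> K \<Longrightarrow> norm x \<le> D" using compact_norm_bound[OF assms(1)] by blast
  have "D-lipschitz_on UNIV (support_fun K)"
    using support_fun_Lipschitz[OF assms D(2)] D(1) by (intro lipschitz_onI) (auto simp: dist_norm)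
  then show ?thesis by (rule lipschitz_on_continuous_on)
qed

lemma support_fun_abs_le:
  assumes "compact K" "K \<noteq> {}" "\<And>x. x \<in> K \<Longrightarrow> norm x \<le> D" "D \<ge> 0"
  shows "\<bar>support_fun K v\<bar> \<le> D * norm v"
proof -
  obtain x where x: "x \<in> K" "x \<bullet> v = support_fun K v" using support_fun_attained[OF assms(1,2)] by blast
  have "\<bar>x \<bullet> v\<bar> \<le> norm x * norm v" by (rule Cauchy_Schwarz_ineq2)
  also have "\<dots> \<le> D * norm v" using assms(3)[OF x(1)] by (simp add: mult_right_mono)
  finally show ?thesis using x by simp
qed

lemma support_fun_determines:
  assumes "compact K" "convex K" "K \<noteq> {}" "bounded L"
    and "\<And>v. support_fun L v \<le> support_fun K v"
  shows "L \<subseteq> K"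
proof
  fix x assume x: "x \<in> L"
  show "x \<in> K"
  proof (rule ccontr)
    assume "x \<notin> K"
    from separating_hyperplane_closed_point[OF assms(2) compact_imp_closed[OF assms(1)] this]
    obtain a b where ab: "a \<bullet> x < b" "\<forall>y\<in>K. a \<bullet> y > b" by blast
    have "support_fun K (- a) \<le> - b"
      by (rule support_fun_least[OF assms(3)]) (use ab in \<open>auto simp: inner_commute less_imp_le\<close>)
    moreover have "- (a \<bullet> x) \<le> support_fun L (- a)"
      using support_fun_upper[OF assms(4) x, of "- a"] by (simp add: inner_commute)
    ultimately show False using ab(1) assms(5)[of "- a"] by linarith
  qed
qed


section \<open>Width bounds by lenses\<close>

text \<open>Centred at 0 with axis \<open>u\<close>. For a unit vector \<open>u\<close> and
  \<open>0 \<le> \<rho>\<close>, \<open>\<rho> < R\<close>, the inradius is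
  \<open>R - \<rho>\<close>, and the inscribed ball about 0 touches the boundary in the directions
  \<open>u\<close> and \<open>- u\<close>.\<close>

abbreviation lens :: "real \<Rightarrow> real \<Rightarrow> 'a::euclidean_space \<Rightarrow> 'a set" where
  "lens R \<rho> u \<equiv> cball (\<rho> *\<^sub>R u) R \<inter> cball (- (\<rho> *\<^sub>R u)) R"

text \<open>After cancelling \<rho>^2 \<tau>^2, membership in the ball of parameter
  \<open>\<tau>\<close> is an inequality affine in \<open>\<tau>\<close>, hence a convex combination
  of those for 0 and 1. All these balls pass through the edge of the lens, the points orthogonal to
  \<open>u\<close> at distance sqrt (R^2 - \<rho>^2) from 0.\<close>

lemma mem_cball_combination:
  fixes x u :: "'a::euclidean_space"
  assumes u: "norm u = 1" and x: "norm (x + \<rho> *\<^sub>R u) \<le> R" "(norm x)\<^sup>2 \<le> R\<^sup>2 - \<rho>\<^sup>2" and \<tau>: "0 \<le> \<tau>" "\<tau> \<le> 1"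
  shows "norm (x + (\<rho> * \<tau>) *\<^sub>R u) \<le> sqrt (R\<^sup>2 - \<rho>\<^sup>2 + \<rho>\<^sup>2 * \<tau>\<^sup>2)"
proof (rule real_le_rsqrt)
  have uu: "u \<bullet> u = 1" using u by (simp add: dot_square_norm)
  have sq: "(norm (x + (\<rho> * t) *\<^sub>R u))\<^sup>2 = (norm x)\<^sup>2 + 2 * \<rho> * t * (x \<bullet> u) + \<rho>\<^sup>2 * t\<^sup>2" for t
    unfolding power2_norm_eq_inner
    by (simp add: inner_add_left inner_add_right uu inner_commute[of u x] power2_eq_square algebra_simps)
  have "(norm (x + \<rho> *\<^sub>R u))\<^sup>2 \<le> R\<^sup>2" using x(1) by (simp add: power_mono)
  then have "\<tau> * ((norm x)\<^sup>2 + 2 * \<rho> * (x \<bullet> u) + \<rho>\<^sup>2) \<le> \<tau> * R\<^sup>2"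
    using sq[of 1] \<tau> by (intro mult_left_mono) auto
  moreover have "(1 - \<tau>) * (norm x)\<^sup>2 \<le> (1 - \<tau>) * (R\<^sup>2 - \<rho>\<^sup>2)" using x(2) \<tau> by (intro mult_left_mono) auto
  ultimately show "(norm (x + (\<rho> * \<tau>) *\<^sub>R u))\<^sup>2 \<le> R\<^sup>2 - \<rho>\<^sup>2 + \<rho>\<^sup>2 * \<tau>\<^sup>2"
    unfolding sq by (simp add: algebra_simps)
qed

lemma inner_le_of_mem_cball_combination:
  fixes x u v :: "'a::euclidean_space"
  assumes "norm u = 1" "norm (x + \<rho> *\<^sub>R u) \<le> R" "(norm x)\<^sup>2 \<le> R\<^sup>2 - \<rho>\<^sup>2" "0 \<le> \<tau>" "\<tau> \<le> 1" "norm v = 1"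
  shows "x \<bullet> v \<le> sqrt (R\<^sup>2 - \<rho>\<^sup>2 + \<rho>\<^sup>2 * \<tau>\<^sup>2) - \<rho> * \<tau> * (u \<bullet> v)"
proof -
  have "(x + (\<rho> * \<tau>) *\<^sub>R u) \<bullet> v \<le> norm (x + (\<rho> * \<tau>) *\<^sub>R u)"
    using norm_cauchy_schwarz[of _ v] assms(6) by simp
  also note mem_cball_combination[OF assms(1-5)]
  finally show ?thesis by (simp add: inner_add_left)
qed

text \<open>The third bound, from the parallelogram law, is the member \<tau> = 0 of the
  pencil.\<close>

lemma norm_le_of_mem_lens:
  fixes x u :: "'a::euclidean_space"
  assumes u: "norm u = 1" and x: "x \<in> lens R \<rho> u"
  shows "norm (x + \<rho> *\<^sub>R u) \<le> R" "norm (x - \<rho> *\<^sub>R u) \<le> R" "(norm x)\<^sup>2 \<le> R\<^sup>2 - \<rho>\<^sup>2"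
proof -
  show 1: "norm (x + \<rho> *\<^sub>R u) \<le> R" "norm (x - \<rho> *\<^sub>R u) \<le> R"
    using x norm_minus_cancel[of "x + \<rho> *\<^sub>R u"] by (simp_all add: dist_norm norm_minus_commute)
  have uu: "u \<bullet> u = 1" using u by (simp add: dot_square_norm)
  have "(norm (x + \<rho> *\<^sub>R u))\<^sup>2 + (norm (x - \<rho> *\<^sub>R u))\<^sup>2 = 2 * (norm x)\<^sup>2 + 2 * \<rho>\<^sup>2"
    unfolding power2_norm_eq_inner
    by (simp add: inner_add_left inner_add_right inner_diff_left inner_diff_right uu power2_eq_square algebra_simps)
  moreover have "(norm (x + \<rho> *\<^sub>R u))\<^sup>2 \<le> R\<^sup>2" "(norm (x - \<rho> *\<^sub>R u))\<^sup>2 \<le> R\<^sup>2" using 1 by (simp_all add: power_mono)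
  ultimately show "(norm x)\<^sup>2 \<le> R\<^sup>2 - \<rho>\<^sup>2" by linarith
qed

text \<open>The lens lies in the pencils of both \<open>u\<close> and \<open>- u\<close>; the better
  of the two bounds carries the absolute value.\<close>

lemma support_lens_le:
  fixes u v :: "'a::euclidean_space"
  assumes u: "norm u = 1" "norm v = 1" and \<tau>: "0 \<le> \<tau>" "\<tau> \<le> 1" and \<rho>: "0 \<le> \<rho>" "\<rho> < R"
  shows "support_fun (lens R \<rho> u) v \<le> sqrt (R\<^sup>2 - \<rho>\<^sup>2 + \<rho>\<^sup>2 * \<tau>\<^sup>2) - \<rho> * \<tau> * \<bar>u \<bullet> v\<bar>"
proof (rule support_fun_least)
  have "0 \<in> lens R \<rho> u" using u \<rho> by simp
  then show "lens R \<rho> u \<noteq> {}" by blast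
next
  fix x assume "x \<in> lens R \<rho> u"
  note n = norm_le_of_mem_lens[OF u(1) this]
  have "norm (x + \<rho> *\<^sub>R (- u)) \<le> R" using n(2) by simp
  from inner_le_of_mem_cball_combination[OF _ this n(3) \<tau> u(2)]
    inner_le_of_mem_cball_combination[OF u(1) n(1) n(3) \<tau> u(2)] u
  show "x \<bullet> v \<le> sqrt (R\<^sup>2 - \<rho>\<^sup>2 + \<rho>\<^sup>2 * \<tau>\<^sup>2) - \<rho> * \<tau> * \<bar>u \<bullet> v\<bar>"
    by (simp add: abs_if)
qed

text \<open>With \<open>support_lens_le\<close>, this makes the support function a minimum over
  \<open>\<tau>\<close> of expressions affine and nonincreasing in
  \<open>\<bar>u \<bullet> v\<bar>\<close>. The later estimates use only this, without
  distinguishing support points on a cap from those on the edge.\<close>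

lemma support_lens_attained:
  fixes u v :: "'a::euclidean_space"
  assumes u: "norm u = 1" "norm v = 1" and \<rho>: "0 \<le> \<rho>" "\<rho> < R"
  shows "\<exists>\<tau>. 0 \<le> \<tau> \<and> \<tau> \<le> 1 \<and>
    support_fun (lens R \<rho> u) v = sqrt (R\<^sup>2 - \<rho>\<^sup>2 + \<rho>\<^sup>2 * \<tau>\<^sup>2) - \<rho> * \<tau> * \<bar>u \<bullet> v\<bar>"
proof -
  have "\<exists>\<tau>. 0 \<le> \<tau> \<and> \<tau> \<le> 1 \<and>
    support_fun (lens R \<rho> e) v \<ge> sqrt (R\<^sup>2 - \<rho>\<^sup>2 + \<rho>\<^sup>2 * \<tau>\<^sup>2) - \<rho> * \<tau> * (e \<bullet> v)"
    if e: "norm e = 1" and t0: "e \<bullet> v \<ge> 0" for e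
  proof -
    define t where "t = e \<bullet> v"
    have R: "R > 0" using \<rho> by simp
    define s where "s = sqrt (R\<^sup>2 - \<rho>\<^sup>2)"
    have "\<rho>\<^sup>2 < R\<^sup>2" using \<rho> by (simp add: power_strict_mono)
    then have s: "s > 0" "s\<^sup>2 = R\<^sup>2 - \<rho>\<^sup>2" by (simp_all add: s_def)
    \<comment> \<open>for \<open>\<tau> < 1\<close> the support point lies on the edge of the lens, the sphere of radius \<open>s\<close> orthogonal to \<open>e\<close>\<close>
    define \<tau> where "\<tau> = (if \<rho> \<le> R * t then 1 else s * t / (\<rho> * sqrt (1 - t\<^sup>2)))"
    define q where "q = sqrt (R\<^sup>2 - \<rho>\<^sup>2 + \<rho>\<^sup>2 * \<tau>\<^sup>2)"
    have vv: "v \<bullet> v = 1" and ee: "e \<bullet> e = 1" using u e by (simp_all add: dot_square_norm)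
    \<comment> \<open>The point of the pencil ball with outer normal \<open>v\<close>. It remains to
      see that it lies in the lens; membership in both balls at once means \<open>(norm x)\<^sup>2 +
      2 * \<rho> * \<bar>x \<bullet> e\<bar> \<le> s\<^sup>2\<close>.\<close>
    define x where "x = q *\<^sub>R v - (\<rho> * \<tau>) *\<^sub>R e"
    have xx: "(norm x)\<^sup>2 = q\<^sup>2 + \<rho>\<^sup>2 * \<tau>\<^sup>2 - 2 * q * \<rho> * \<tau> * t"
      unfolding x_def power2_norm_eq_inner t_def
      by (simp add: inner_diff_left inner_diff_right vv ee inner_commute[of v e] power2_eq_square algebra_simps)
    have xe: "x \<bullet> e = q * t - \<rho> * \<tau>"
      by (simp add: x_def inner_diff_left ee t_def inner_commute[of v e])
    have "0 \<le> \<tau> \<and> \<tau> \<le> 1 \<and> (norm x)\<^sup>2 + 2 * \<rho> * \<bar>x \<bullet> e\<bar> \<le> s\<^sup>2"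
    proof (cases "\<rho> \<le> R * t")
      case True
      then have t1: "\<tau> = 1" and qR: "q = R" using R by (simp_all add: \<tau>_def q_def)
      have "(norm x)\<^sup>2 + 2 * \<rho> * \<bar>x \<bullet> e\<bar> = R\<^sup>2 + \<rho>\<^sup>2 - 2 * R * \<rho> * t + 2 * \<rho> * (R * t - \<rho>)"
        unfolding xx xe t1 qR using True by simp
      also have "\<dots> = s\<^sup>2" unfolding s(2) by (simp add: power2_eq_square algebra_simps)
      finally show ?thesis using t1 by simp
    next
      case False
      have \<rho>0: "\<rho> > 0" using False t0 R by (smt (verit) mult_nonneg_nonneg t_def)
      have Rt: "R * t < \<rho>" using False by simp
      then have "t < 1" using \<rho> R by (smt (verit) mult_le_cancel_left1)
      then have t2: "t\<^sup>2 < 1" using t0 by (simp add: t_def abs_square_less_1)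
      define c where "c = sqrt (1 - t\<^sup>2)"
      have c: "c > 0" "c\<^sup>2 = 1 - t\<^sup>2" using t2 by (simp_all add: c_def)
      have tau: "\<rho> * \<tau> = s * t / c" using False \<rho>0 by (simp add: \<tau>_def c_def)
      have nn: "0 \<le> R\<^sup>2 - \<rho>\<^sup>2 + \<rho>\<^sup>2 * \<tau>\<^sup>2" unfolding s(2)[symmetric] by simp
      have "q\<^sup>2 = s\<^sup>2 + (\<rho> * \<tau>)\<^sup>2" using nn by (simp add: q_def s(2) power_mult_distrib)
      also have "\<dots> = s\<^sup>2 * ((c\<^sup>2 + t\<^sup>2) / c\<^sup>2)"
        unfolding tau using c(1) by (simp add: power_divide power_mult_distrib add_divide_distrib distrib_left)
      also have "\<dots> = (s / c)\<^sup>2" using c(2) by (simp add: power_divide)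
      finally have "q\<^sup>2 = (s / c)\<^sup>2" .
      then have q: "q = s / c"
        by (rule power2_eq_imp_eq) (use nn s c in \<open>simp_all add: q_def\<close>)
      have qt: "q * t = \<rho> * \<tau>" using q tau by simp
      have "(s * t)\<^sup>2 \<le> (\<rho> * c)\<^sup>2"
      proof -
        have "(R * t)\<^sup>2 \<le> \<rho>\<^sup>2" using Rt t0 R by (intro power_mono) (auto simp: t_def)
        then show ?thesis unfolding power_mult_distrib s(2) c(2) by (simp add: algebra_simps)
      qed
      then have "s * t \<le> \<rho> * c" by (rule power2_le_imp_le) (use \<rho>0 c in simp)
      then have "\<rho> * \<tau> \<le> \<rho> * 1" unfolding tau using c by (simp add: field_simps)
      then have "\<tau> \<le> 1" using \<rho>0 by simp
      moreover have "\<tau> \<ge> 0" using False s \<rho>0 c t0 by (simp add: \<tau>_def c_def t_def)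
      moreover have "(norm x)\<^sup>2 = s\<^sup>2"
      proof -
        have "(norm x)\<^sup>2 = q\<^sup>2 - (q * t)\<^sup>2"
        proof -
          have "\<rho>\<^sup>2 * \<tau>\<^sup>2 = (q * t)\<^sup>2" unfolding qt by (simp add: power_mult_distrib)
          moreover have "2 * q * \<rho> * \<tau> * t = 2 * (q * t)\<^sup>2"
            unfolding power2_eq_square by (subst (2) qt) simp
          ultimately show ?thesis unfolding xx by simp
        qed
        also have "\<dots> = q\<^sup>2 * c\<^sup>2" by (simp add: c(2) power_mult_distrib algebra_simps)
        also have "\<dots> = s\<^sup>2" unfolding q using c(1) by (simp add: power_divide)
        finally show ?thesis .
      qed
      ultimately show ?thesis using xe qt by simp
    qed
    then have \<tau>: "0 \<le> \<tau>" "\<tau> \<le> 1" and b: "(norm x)\<^sup>2 + 2 * \<rho> * \<bar>x \<bullet> e\<bar> \<le> s\<^sup>2" by auto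
    have sq: "(norm (x + \<rho> *\<^sub>R e))\<^sup>2 = (norm x)\<^sup>2 + 2 * \<rho> * (x \<bullet> e) + \<rho>\<^sup>2"
      "(norm (x - \<rho> *\<^sub>R e))\<^sup>2 = (norm x)\<^sup>2 - 2 * \<rho> * (x \<bullet> e) + \<rho>\<^sup>2"
      unfolding power2_norm_eq_inner
      by (simp_all add: inner_add_left inner_add_right inner_diff_left inner_diff_right ee inner_commute[of e x] power2_eq_square algebra_simps)
    have "\<rho> * (x \<bullet> e) \<le> \<rho> * \<bar>x \<bullet> e\<bar>" "\<rho> * - (x \<bullet> e) \<le> \<rho> * \<bar>x \<bullet> e\<bar>"
      using \<rho>(1) by (intro mult_left_mono; simp)+
    then have "(norm (x + \<rho> *\<^sub>R e))\<^sup>2 \<le> R\<^sup>2" "(norm (x - \<rho> *\<^sub>R e))\<^sup>2 \<le> R\<^sup>2"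
      using b unfolding sq s(2) by simp_all
    then have "norm (x + \<rho> *\<^sub>R e) \<le> R" "norm (x - \<rho> *\<^sub>R e) \<le> R" using R by (auto intro: power2_le_imp_le)
    then have "x \<in> lens R \<rho> e"
      using norm_minus_cancel[of "x + \<rho> *\<^sub>R e"] by (simp add: dist_norm norm_minus_commute)
    then have "x \<bullet> v \<le> support_fun (lens R \<rho> e) v" by (intro support_fun_upper) auto
    moreover have "x \<bullet> v = q - \<rho> * \<tau> * t" by (simp add: x_def inner_diff_left vv t_def)
    ultimately show ?thesis using \<tau> unfolding q_def t_def by (intro exI[of _ \<tau>]) simp
  qed
  note main = this
  have "lens R \<rho> (- u) = lens R \<rho> u" by auto
  moreover have "\<exists>e\<in>{u, - u}. e \<bullet> v = \<bar>u \<bullet> v\<bar>" by (auto simp: abs_if)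
  ultimately obtain \<tau> where \<tau>: "0 \<le> \<tau>" "\<tau> \<le> 1"
    "support_fun (lens R \<rho> u) v \<ge> sqrt (R\<^sup>2 - \<rho>\<^sup>2 + \<rho>\<^sup>2 * \<tau>\<^sup>2) - \<rho> * \<tau> * \<bar>u \<bullet> v\<bar>"
    using main[of u] main[of "- u"] u by (auto simp: abs_if split: if_splits)
  then show ?thesis using support_lens_le[OF u \<tau>(1,2) \<rho>] by (intro exI[of _ \<tau>]) auto
qed

text \<open>The parameter that is optimal for the smaller inner product is tried for the larger
  one.\<close>

lemma support_lens_antimono:
  fixes u u' v v' :: "'a::euclidean_space"
  assumes "norm u = 1" "norm v = 1" "norm u' = 1" "norm v' = 1" and \<rho>: "0 \<le> \<rho>" "\<rho> < R"
    and le: "\<bar>u \<bullet> v\<bar> \<le> \<bar>u' \<bullet> v'\<bar>"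
  shows "support_fun (lens R \<rho> u') v' \<le> support_fun (lens R \<rho> u) v"
proof -
  from support_lens_attained[OF assms(1,2) \<rho>] obtain \<tau> where \<tau>: "0 \<le> \<tau>" "\<tau> \<le> 1"
    "support_fun (lens R \<rho> u) v = sqrt (R\<^sup>2 - \<rho>\<^sup>2 + \<rho>\<^sup>2 * \<tau>\<^sup>2) - \<rho> * \<tau> * \<bar>u \<bullet> v\<bar>" by blast
  have "\<rho> * \<tau> * \<bar>u \<bullet> v\<bar> \<le> \<rho> * \<tau> * \<bar>u' \<bullet> v'\<bar>" using \<rho> \<tau> le by (intro mult_left_mono) auto
  then show ?thesis using support_lens_le[OF assms(3,4) \<tau>(1,2) \<rho>] \<tau>(3) by linarith
qed

text \<open>\<open>R - \<rho>\<close> is the value on the axis. Off the axis, strictness comes from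
  the terms \<open>(1 - \<tau>) * (R - \<rho>)\<close> and
  \<open>\<tau> * (R * (1 - \<beta>))\<close>, at least one of which is positive.\<close>

lemma support_lens_gt:
  fixes u v :: "'a::euclidean_space"
  assumes u: "norm u = 1" "norm v = 1" and \<rho>: "0 < \<rho>" "\<rho> < R" and lt: "\<bar>u \<bullet> v\<bar> < 1"
  shows "R - \<rho> < support_fun (lens R \<rho> u) v"
proof -
  from support_lens_attained[OF u _ \<rho>(2)] \<rho>(1) obtain \<tau> where \<tau>: "0 \<le> \<tau>" "\<tau> \<le> 1"
    "support_fun (lens R \<rho> u) v = sqrt (R\<^sup>2 - \<rho>\<^sup>2 + \<rho>\<^sup>2 * \<tau>\<^sup>2) - \<rho> * \<tau> * \<bar>u \<bullet> v\<bar>" by auto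
  define \<beta> where "\<beta> = \<bar>u \<bullet> v\<bar>"
  define q where "q = sqrt (R\<^sup>2 - \<rho>\<^sup>2 + \<rho>\<^sup>2 * \<tau>\<^sup>2)"
  have R: "R > 0" using \<rho> by simp
  have s2: "R\<^sup>2 - \<rho>\<^sup>2 \<ge> 0" using \<rho> by (simp add: power_mono)
  \<comment> \<open>Cauchy-Schwarz for (s, \<rho>) and (s, \<rho> \<tau>) with s^2 = R^2 - \<rho>^2,
    vectors of lengths \<open>R\<close> and \<open>q\<close>.\<close>
  have "(R\<^sup>2 - \<rho>\<^sup>2 + \<rho>\<^sup>2 * \<tau>)\<^sup>2 \<le> (R * q)\<^sup>2"
  proof -
    have "(R * q)\<^sup>2 = R\<^sup>2 * (R\<^sup>2 - \<rho>\<^sup>2 + \<rho>\<^sup>2 * \<tau>\<^sup>2)" using s2 by (simp add: q_def power_mult_distrib)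
    moreover have "R\<^sup>2 * (R\<^sup>2 - \<rho>\<^sup>2 + \<rho>\<^sup>2 * \<tau>\<^sup>2) - (R\<^sup>2 - \<rho>\<^sup>2 + \<rho>\<^sup>2 * \<tau>)\<^sup>2 = (R\<^sup>2 - \<rho>\<^sup>2) * (\<rho> * (1 - \<tau>))\<^sup>2"
      by algebra
    moreover have "(R\<^sup>2 - \<rho>\<^sup>2) * (\<rho> * (1 - \<tau>))\<^sup>2 \<ge> 0" using s2 by simp
    ultimately show ?thesis by linarith
  qed
  then have Rq: "R\<^sup>2 - \<rho>\<^sup>2 + \<rho>\<^sup>2 * \<tau> \<le> R * q" by (rule power2_le_imp_le) (use R s2 in \<open>simp add: q_def\<close>)
  have "(1 - \<tau>) * (R - \<rho>) + \<tau> * (R * (1 - \<beta>)) > 0"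
  proof (cases "\<tau> = 1")
    case True then show ?thesis using R lt by (simp add: \<beta>_def)
  next
    case False
    then have "(1 - \<tau>) * (R - \<rho>) > 0" using \<tau> \<rho> by simp
    moreover have "\<tau> * (R * (1 - \<beta>)) \<ge> 0" using \<tau> R lt by (simp add: \<beta>_def)
    ultimately show ?thesis by linarith
  qed
  then have "\<rho> * ((1 - \<tau>) * (R - \<rho>) + \<tau> * (R * (1 - \<beta>))) > 0" using \<rho> by simp
  then have "R * (R - \<rho>) < (R\<^sup>2 - \<rho>\<^sup>2 + \<rho>\<^sup>2 * \<tau>) - R * (\<rho> * \<tau> * \<beta>)" by (simp add: power2_eq_square algebra_simps)
  also have "\<dots> \<le> R * (q - \<rho> * \<tau> * \<beta>)" using Rq by (simp add: algebra_simps)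
  finally show ?thesis using R \<tau>(3) unfolding q_def \<beta>_def by simp
qed

text \<open>With \<open>\<alpha>\<close> and \<open>-\<beta>\<close> the largest and smallest of the numbers \<open>u \<bullet> v\<close>, the support function of the
  lens is a concave function of \<open>u \<bullet> v\<close>, so its mean is at least the value of the chord
  over \<open>[-\<beta>, \<alpha>]\<close> at the mean \<open>0\<close>; monotonicity turns the chord value into the plain average.\<close>
lemma width_le_mean_lens_width:
  fixes K S :: "'a::euclidean_space set"
  assumes S: "finite S" "S \<noteq> {}" and unit: "\<And>u. u \<in> S \<Longrightarrow> norm u = 1"
    and w: "\<And>u. u \<in> S \<Longrightarrow> w u > (0::real)" "sum w S = 1" "(\<Sum>u\<in>S. w u *\<^sub>R u) = 0"
    and \<rho>: "0 \<le> \<rho>" "\<rho> < R" and K: "K \<noteq> {}" "\<And>u. u \<in> S \<Longrightarrow> K \<subseteq> cball (- (\<rho> *\<^sub>R u)) R"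
    and v: "norm v = 1"
  shows "support_fun K v + support_fun K (- v) \<le> 2 * (\<Sum>u\<in>S. w u * support_fun (lens R \<rho> u) v)"
    and "\<lbrakk>0 < \<rho>; v \<in> S; support_fun K v + support_fun K (- v) = 2 * (\<Sum>u\<in>S. w u * support_fun (lens R \<rho> u) v)\<rbrakk>
      \<Longrightarrow> - v \<in> S"
proof -
  define H where "H u = support_fun (lens R \<rho> u) v" for u
  have nm: "norm (x + \<rho> *\<^sub>R u) \<le> R" if "x \<in> K" "u \<in> S" for x u
    using K(2)[OF that(2)] that(1) by (force simp: dist_norm norm_minus_commute add.commute)
  have nx: "(norm x)\<^sup>2 \<le> R\<^sup>2 - \<rho>\<^sup>2" if x: "x \<in> K" for x
  proof -
    have "(norm x)\<^sup>2 + 2 * \<rho> * (x \<bullet> u) + \<rho>\<^sup>2 \<le> R\<^sup>2" if u: "u \<in> S" for u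
    proof -
      have "u \<bullet> u = 1" using unit[OF u] by (simp add: dot_square_norm)
      then have "(norm (x + \<rho> *\<^sub>R u))\<^sup>2 = (norm x)\<^sup>2 + 2 * \<rho> * (x \<bullet> u) + \<rho>\<^sup>2"
        unfolding power2_norm_eq_inner
        by (simp add: inner_add_left inner_add_right inner_commute[of u x] power2_eq_square algebra_simps)
      then show ?thesis using nm[OF x u] by (metis power_mono norm_ge_zero)
    qed
    then have "(\<Sum>u\<in>S. w u * ((norm x)\<^sup>2 + 2 * \<rho> * (x \<bullet> u) + \<rho>\<^sup>2)) \<le> (\<Sum>u\<in>S. w u * R\<^sup>2)"
      using w(1) by (intro sum_mono mult_left_mono) (auto simp: less_imp_le)
    also have "\<dots> = R\<^sup>2" using w(2) by (simp flip: sum_distrib_right)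
    also have "(\<Sum>u\<in>S. w u * ((norm x)\<^sup>2 + 2 * \<rho> * (x \<bullet> u) + \<rho>\<^sup>2))
      = (\<Sum>u\<in>S. w u * ((norm x)\<^sup>2 + \<rho>\<^sup>2)) + 2 * \<rho> * (\<Sum>u\<in>S. x \<bullet> (w u *\<^sub>R u))"
      unfolding sum_distrib_left sum.distrib[symmetric] by (rule sum.cong) (simp_all add: algebra_simps)
    also have "\<dots> = (norm x)\<^sup>2 + \<rho>\<^sup>2"
    proof -
      have "(\<Sum>u\<in>S. x \<bullet> (w u *\<^sub>R u)) = 0" using w(3) by (simp only: inner_sum_right[symmetric]) simp
      then show ?thesis using w(2) by (simp flip: sum_distrib_right)
    qed
    finally show ?thesis by simp
  qed
  have "Max ((\<lambda>u. u \<bullet> v) ` S) \<in> (\<lambda>u. u \<bullet> v) ` S" "Min ((\<lambda>u. u \<bullet> v) ` S) \<in> (\<lambda>u. u \<bullet> v) ` S"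
    using S by (intro Max_in Min_in; simp)+
  then obtain a b where ab: "a \<in> S" "a \<bullet> v = Max ((\<lambda>u. u \<bullet> v) ` S)"
      "b \<in> S" "b \<bullet> v = Min ((\<lambda>u. u \<bullet> v) ` S)" by force
  have a: "a \<in> S" "\<And>u. u \<in> S \<Longrightarrow> u \<bullet> v \<le> a \<bullet> v" using ab S by auto
  have b: "b \<in> S" "\<And>u. u \<in> S \<Longrightarrow> b \<bullet> v \<le> u \<bullet> v" using ab S by auto
  define \<alpha> \<beta> where "\<alpha> = a \<bullet> v" and "\<beta> = - (b \<bullet> v)"
  have sum0: "(\<Sum>u\<in>S. w u * (u \<bullet> v)) = 0"
    using arg_cong[OF w(3), of "\<lambda>x. x \<bullet> v"] by (simp add: inner_sum_left)
  have \<alpha>0: "\<alpha> \<ge> 0"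
  proof -
    have "(\<Sum>u\<in>S. w u * (u \<bullet> v)) \<le> (\<Sum>u\<in>S. w u * \<alpha>)"
      using w(1) a(2) by (intro sum_mono mult_left_mono) (auto simp: \<alpha>_def less_imp_le)
    then show ?thesis using sum0 w(2) by (simp flip: sum_distrib_right)
  qed
  have \<beta>0: "\<beta> \<ge> 0"
  proof -
    have "(\<Sum>u\<in>S. w u * - \<beta>) \<le> (\<Sum>u\<in>S. w u * (u \<bullet> v))"
      using w(1) b(2) by (intro sum_mono mult_left_mono) (auto simp: \<beta>_def less_imp_le)
    then show ?thesis using sum0 w(2) by (simp flip: sum_distrib_right add: sum_negf)
  qed
  \<comment> \<open>\<open>a \<bullet> v\<close> and \<open>- (b \<bullet> v)\<close> are
    nonnegative, so the one-sided pencil bounds valid for \<open>K\<close>, taken at the optimal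
    parameters, coincide with the values for the lenses of \<open>a\<close> and
    \<open>b\<close>.\<close>
  have hK: "support_fun K v \<le> H a" "support_fun K (- v) \<le> H b"
  proof -
    from support_lens_attained[OF unit[OF a(1)] v \<rho>] obtain \<tau> where \<tau>: "0 \<le> \<tau>" "\<tau> \<le> 1"
      "H a = sqrt (R\<^sup>2 - \<rho>\<^sup>2 + \<rho>\<^sup>2 * \<tau>\<^sup>2) - \<rho> * \<tau> * \<bar>a \<bullet> v\<bar>" unfolding H_def by blast
    show "support_fun K v \<le> H a"
      using inner_le_of_mem_cball_combination[OF unit[OF a(1)] nm[OF _ a(1)] nx \<tau>(1,2) v] \<tau>(3) \<alpha>0
      by (intro support_fun_least K(1)) (simp add: \<alpha>_def)
    from support_lens_attained[OF unit[OF b(1)] v \<rho>] obtain \<tau> where \<tau>: "0 \<le> \<tau>" "\<tau> \<le> 1"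
      "H b = sqrt (R\<^sup>2 - \<rho>\<^sup>2 + \<rho>\<^sup>2 * \<tau>\<^sup>2) - \<rho> * \<tau> * \<bar>b \<bullet> v\<bar>" unfolding H_def by blast
    show "support_fun K (- v) \<le> H b"
      using inner_le_of_mem_cball_combination[OF unit[OF b(1)] nm[OF _ b(1)] nx \<tau>(1,2), of _ "- v"] \<tau>(3) \<beta>0 v
      by (intro support_fun_least K(1)) (simp add: \<beta>_def)
  qed
  have chord: "(\<alpha> + \<beta>) * H u \<ge> (\<alpha> - u \<bullet> v) * H b + (u \<bullet> v + \<beta>) * H a" if u: "u \<in> S" for u
  proof -
    define c where "c = u \<bullet> v"
    have c: "- \<beta> \<le> c" "c \<le> \<alpha>" using a(2) b(2) u by (auto simp: c_def \<alpha>_def \<beta>_def)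
    from support_lens_attained[OF unit[OF u] v \<rho>] obtain \<tau> where \<tau>: "0 \<le> \<tau>" "\<tau> \<le> 1"
      "H u = sqrt (R\<^sup>2 - \<rho>\<^sup>2 + \<rho>\<^sup>2 * \<tau>\<^sup>2) - \<rho> * \<tau> * \<bar>c\<bar>" unfolding H_def c_def by blast
    define q where "q = sqrt (R\<^sup>2 - \<rho>\<^sup>2 + \<rho>\<^sup>2 * \<tau>\<^sup>2)"
    have "H a \<le> q - \<rho> * \<tau> * \<alpha>" "H b \<le> q - \<rho> * \<tau> * \<beta>"
      using support_lens_le[OF unit[OF a(1)] v \<tau>(1,2) \<rho>] support_lens_le[OF unit[OF b(1)] v \<tau>(1,2) \<rho>] \<alpha>0 \<beta>0
      unfolding H_def q_def \<alpha>_def \<beta>_def by simp_all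
    then have "(\<alpha> - c) * H b + (c + \<beta>) * H a \<le> (\<alpha> - c) * (q - \<rho> * \<tau> * \<beta>) + (c + \<beta>) * (q - \<rho> * \<tau> * \<alpha>)"
      using c by (intro add_mono mult_left_mono) auto
    also have "\<dots> = (\<alpha> + \<beta>) * q - \<rho> * \<tau> * ((\<alpha> - c) * \<beta> + (c + \<beta>) * \<alpha>)" by (simp add: algebra_simps)
    also have "\<dots> \<le> (\<alpha> + \<beta>) * q - \<rho> * \<tau> * ((\<alpha> + \<beta>) * \<bar>c\<bar>)"
    proof -
      \<comment> \<open>The chord of the absolute value function over
        \<open>[-\<beta>, \<alpha>]\<close> lies above its graph.\<close>
      have "(\<alpha> + \<beta>) * \<bar>c\<bar> \<le> (\<alpha> - c) * \<beta> + (c + \<beta>) * \<alpha>"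
      proof (cases "c \<ge> 0")
        case True
        have "(\<alpha> - c) * \<beta> + (c + \<beta>) * \<alpha> - (\<alpha> + \<beta>) * c = 2 * (\<beta> * (\<alpha> - c))" by algebra
        then show ?thesis using True c \<beta>0 by (smt (verit) mult_nonneg_nonneg)
      next
        case False
        have "(\<alpha> - c) * \<beta> + (c + \<beta>) * \<alpha> + (\<alpha> + \<beta>) * c = 2 * (\<alpha> * (\<beta> + c))" by algebra
        then show ?thesis using False c \<alpha>0 by (smt (verit) mult_nonneg_nonneg mult_minus_right)
      qed
      then show ?thesis using \<rho> \<tau> by (intro diff_left_mono mult_left_mono) auto
    qed
    also have "\<dots> = (\<alpha> + \<beta>) * H u" unfolding \<tau>(3) q_def by (simp add: algebra_simps)
    finally show ?thesis unfolding c_def .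
  qed
  have mean: "(\<alpha> + \<beta>) * (\<Sum>u\<in>S. w u * H u) \<ge> \<alpha> * H b + \<beta> * H a"
  proof -
    have "\<alpha> * H b + \<beta> * H a = (\<Sum>u\<in>S. w u * (\<alpha> * H b + \<beta> * H a)) + (\<Sum>u\<in>S. w u * (u \<bullet> v)) * (H a - H b)"
      using w(2) sum0 by (simp flip: sum_distrib_right)
    also have "\<dots> = (\<Sum>u\<in>S. w u * ((\<alpha> - u \<bullet> v) * H b + (u \<bullet> v + \<beta>) * H a))"
      unfolding sum_distrib_right sum.distrib[symmetric] by (rule sum.cong) (simp_all add: algebra_simps)
    also have "\<dots> \<le> (\<Sum>u\<in>S. w u * ((\<alpha> + \<beta>) * H u))"
      using chord w(1) by (intro sum_mono mult_left_mono) (auto simp: less_imp_le)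
    also have "\<dots> = (\<alpha> + \<beta>) * (\<Sum>u\<in>S. w u * H u)"
      unfolding sum_distrib_left by (rule sum.cong) (simp_all add: algebra_simps)
    finally show ?thesis .
  qed
  \<comment> \<open>\<open>H\<close> is nonincreasing in the absolute value of the inner product, so
    replacing the weights of \<open>H a\<close> and \<open>H b\<close> in the chord value by equal
    ones can only lower it.\<close>
  have mono: "0 \<le> (\<alpha> - \<beta>) * (H b - H a)"
  proof (cases "\<alpha> \<ge> \<beta>")
    case True
    then have "H b \<ge> H a" unfolding H_def
      using support_lens_antimono[OF unit[OF b(1)] v unit[OF a(1)] v \<rho>] \<alpha>0 \<beta>0 by (simp add: \<alpha>_def \<beta>_def)
    then show ?thesis using True by simp
  next
    case False
    then have "H a \<ge> H b" unfolding H_def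
      using support_lens_antimono[OF unit[OF a(1)] v unit[OF b(1)] v \<rho>] \<alpha>0 \<beta>0 by (simp add: \<alpha>_def \<beta>_def)
    then show ?thesis using False by (simp add: mult_nonpos_nonpos)
  qed
  have eq: "2 * (\<alpha> * H b + \<beta> * H a) = (\<alpha> + \<beta>) * (H a + H b) + (\<alpha> - \<beta>) * (H b - H a)" by algebra
  have avg: "H a + H b \<le> 2 * (\<Sum>u\<in>S. w u * H u)"
  proof (cases "\<alpha> + \<beta> = 0")
    case True
    then have z: "\<alpha> = 0" "\<beta> = 0" using \<alpha>0 \<beta>0 by auto
    have "H a \<le> H u \<and> H b \<le> H u" if u: "u \<in> S" for u
    proof -
      have "u \<bullet> v = 0" using a(2)[OF u] b(2)[OF u] z by (simp add: \<alpha>_def \<beta>_def)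
      then show ?thesis unfolding H_def
        using support_lens_antimono[OF unit[OF u] v unit[OF a(1)] v \<rho>] support_lens_antimono[OF unit[OF u] v unit[OF b(1)] v \<rho>]
        by simp
    qed
    then have "(\<Sum>u\<in>S. w u * (H a + H b)) \<le> (\<Sum>u\<in>S. w u * (2 * H u))"
      using w(1) by (intro sum_mono mult_left_mono) (force simp: less_imp_le)+
    also have "(\<Sum>u\<in>S. w u * (H a + H b)) = H a + H b" using w(2) by (simp flip: sum_distrib_right)
    also have "(\<Sum>u\<in>S. w u * (2 * H u)) = 2 * (\<Sum>u\<in>S. w u * H u)"
      unfolding sum_distrib_left by (rule sum.cong) simp_all
    finally show ?thesis .
  next
    case False
    then have p: "\<alpha> + \<beta> > 0" using \<alpha>0 \<beta>0 by simp
    have "(\<alpha> + \<beta>) * (H a + H b) \<le> (\<alpha> + \<beta>) * (2 * (\<Sum>u\<in>S. w u * H u))"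
      using mean mono eq by (simp add: algebra_simps)
    then show ?thesis using p by simp
  qed
  then show "support_fun K v + support_fun K (- v) \<le> 2 * (\<Sum>u\<in>S. w u * support_fun (lens R \<rho> u) v)"
    using hK by (simp add: H_def)
  assume \<rho>0: "0 < \<rho>" and vS: "v \<in> S"
    and eqK: "support_fun K v + support_fun K (- v) = 2 * (\<Sum>u\<in>S. w u * support_fun (lens R \<rho> u) v)"
  \<comment> \<open>A contact normal \<open>v\<close> is itself the maximiser, and
    \<open>H a\<close> is then at most \<open>R - \<rho>\<close>, the least value of a support
    function of the lens. Unless \<open>\<beta> = 1\<close>, \<open>H b\<close> is strictly larger
    and the term in \<open>mono\<close> is strictly positive.\<close>
  have "\<alpha> = 1"
  proof (rule antisym)
    show "\<alpha> \<le> 1" using norm_cauchy_schwarz[of a v] unit[OF a(1)] v by (simp add: \<alpha>_def)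
    show "1 \<le> \<alpha>" using a(2)[OF vS] v by (simp add: \<alpha>_def dot_square_norm)
  qed
  have b1: "\<beta> \<le> 1" using Cauchy_Schwarz_ineq2[of b v] unit[OF b(1)] v by (simp add: \<beta>_def)
  have "\<beta> = 1"
  proof (rule ccontr)
    assume "\<beta> \<noteq> 1"
    then have lt: "\<beta> < 1" using b1 by simp
    have "H a \<le> R - \<rho>"
      using support_lens_le[OF unit[OF a(1)] v _ _ \<rho>, of 1] \<open>\<alpha> = 1\<close> \<rho> by (simp add: H_def \<alpha>_def)
    also have "R - \<rho> < H b"
      unfolding H_def by (rule support_lens_gt) (use unit b(1) v \<rho> \<rho>0 lt \<beta>0 in \<open>auto simp: \<beta>_def\<close>)
    finally have "0 < (\<alpha> - \<beta>) * (H b - H a)" using \<open>\<alpha> = 1\<close> lt by simp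
    then have "(\<alpha> + \<beta>) * (H a + H b) < (\<alpha> + \<beta>) * (2 * (\<Sum>u\<in>S. w u * H u))"
      using mean eq by (simp add: algebra_simps)
    then have "H a + H b < 2 * (\<Sum>u\<in>S. w u * H u)" using \<open>\<alpha> = 1\<close> \<beta>0 by simp
    then show False using hK eqK by (simp add: H_def)
  qed
  then have bv: "b \<bullet> v = -1" by (simp add: \<beta>_def)
  have "(b + v) \<bullet> (b + v) = b \<bullet> b + 2 * (b \<bullet> v) + v \<bullet> v"
    by (simp only: inner_add_left inner_add_right inner_commute[of v b] mult_2 add.assoc)
  also have "\<dots> = 0" using bv unit[OF b(1)] v by (simp add: dot_square_norm)
  finally have "b + v = 0" by simp
  then have "b = - v" by (simp add: eq_neg_iff_add_eq_0)
  then show "- v \<in> S" using b(1) by simp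
qed


section \<open>Lebesgue measure under orthogonal maps and stretchings\<close>

text \<open>Uniqueness of Haar measure: both \<open>emeasure lborel A\<close> and \<open>emeasure lborel (f -` A)\<close>, multiplied by
  the volume of the unit ball, are the integral of \<open>1\<^sub>A (f y) 1\<^sub>B (f y - x)\<close>.\<close>
lemma lborel_distr_orthogonal:
  fixes f :: "'a::euclidean_space \<Rightarrow> 'a"
  assumes f: "orthogonal_transformation f"
  shows "distr lborel borel f = lborel"
proof (rule measure_eqI)
  have lin: "linear f" using f by (simp add: orthogonal_transformation_def)
  have [measurable]: "f \<in> borel_measurable borel"
    using lin by (simp add: borel_measurable_continuous_onI linear_continuous_on linear_conv_bounded_linear)
  fix A :: "'a set" assume "A \<in> sets (distr lborel borel f)"
  then have [measurable]: "A \<in> sets borel" by simp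
  define B where "B = ball (0::'a) 1"
  have [measurable]: "B \<in> sets borel" by (simp add: B_def)
  define m where "m = emeasure lborel B"
  have m: "m \<noteq> 0" "m \<noteq> \<infinity>"
    using emeasure_lborel_ball_finite[of "0::'a" 1] unit_ball_vol_pos[of "real DIM('a)"]
    by (auto simp: m_def B_def emeasure_ball simp del: unit_ball_vol_pos)
  have nf: "norm (f y) = norm y" for y using f by (simp add: orthogonal_transformation_norm)
  have shift: "(\<integral>\<^sup>+x. g (c + x) \<partial>lborel) = (\<integral>\<^sup>+x. g x \<partial>lborel)"
    if [measurable]: "g \<in> borel_measurable borel" for g :: "'a \<Rightarrow> ennreal" and c
  proof -
    have "(\<integral>\<^sup>+x. g x \<partial>lborel) = (\<integral>\<^sup>+x. g x \<partial>distr lborel borel ((+) c))" by (simp add: lborel_distr_plus)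
    also have "\<dots> = (\<integral>\<^sup>+x. g (c + x) \<partial>lborel)" by (subst nn_integral_distr) auto
    finally show ?thesis by simp
  qed
  obtain h where h: "linear h" "\<And>x. f (h x) = x"
    using orthogonal_transformation_surj[OF f] linear_surjective_right_inverse[OF lin]
    by (metis comp_apply id_apply)
  have [measurable]: "h \<in> borel_measurable borel"
    using h by (simp add: borel_measurable_continuous_onI linear_continuous_on linear_conv_bounded_linear)
  have "emeasure lborel A * m = (\<integral>\<^sup>+y. indicator B y * (\<integral>\<^sup>+x. indicator A x \<partial>lborel) \<partial>lborel)"
    by (simp add: nn_integral_multc m_def mult.commute)
  also have "\<dots> = (\<integral>\<^sup>+y. indicator B (f y) * (\<integral>\<^sup>+x. indicator A (f y + x) \<partial>lborel) \<partial>lborel)"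
    using shift[of "indicator A"] by (intro nn_integral_cong) (simp add: B_def nf indicator_def)
  also have "\<dots> = (\<integral>\<^sup>+y. (\<integral>\<^sup>+x. indicator B (f y) * indicator A (f y + x) \<partial>lborel) \<partial>lborel)"
    by (rule nn_integral_cong) (simp add: nn_integral_cmult)
  also have "\<dots> = (\<integral>\<^sup>+x. (\<integral>\<^sup>+y. indicator B (f y) * indicator A (f y + x) \<partial>lborel) \<partial>lborel)"
    by (rule lborel_pair.Fubini') measurable
  \<comment> \<open>Translating \<open>y\<close> by \<open>- h x\<close>, where
    \<open>f (h x) = x\<close>, moves the dependence on \<open>x\<close> from \<open>A\<close> to
    \<open>B\<close>; after exchanging the integrals, the inner one is the volume of a translate of
    \<open>B\<close>.\<close>
  also have "\<dots> = (\<integral>\<^sup>+x. (\<integral>\<^sup>+y. indicator B (f (- h x + y)) * indicator A (f (- h x + y) + x) \<partial>lborel) \<partial>lborel)"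
    by (rule nn_integral_cong, subst shift) simp_all
  also have "\<dots> = (\<integral>\<^sup>+x. (\<integral>\<^sup>+y. indicator A (f y) * indicator B (- f y + x) \<partial>lborel) \<partial>lborel)"
  proof (intro nn_integral_cong)
    fix x y :: 'a
    have "f (- h x + y) = f y - x" by (simp add: linear_diff[OF lin] h)
    moreover have "f y - x \<in> B \<longleftrightarrow> - f y + x \<in> B" by (simp add: B_def norm_minus_commute)
    ultimately show "indicator B (f (- h x + y)) * indicator A (f (- h x + y) + x)
      = (indicator A (f y) * indicator B (- f y + x) :: ennreal)" by (simp add: indicator_def)
  qed
  also have "\<dots> = (\<integral>\<^sup>+y. (\<integral>\<^sup>+x. indicator A (f y) * indicator B (- f y + x) \<partial>lborel) \<partial>lborel)"
    by (rule lborel_pair.Fubini') measurable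
  also have "\<dots> = (\<integral>\<^sup>+y. indicator A (f y) * (\<integral>\<^sup>+x. indicator B (- f y + x) \<partial>lborel) \<partial>lborel)"
    by (rule nn_integral_cong) (simp add: nn_integral_cmult)
  also have "\<dots> = (\<integral>\<^sup>+y. indicator A (f y) * m \<partial>lborel)"
  proof (rule nn_integral_cong)
    fix y
    have "(\<integral>\<^sup>+x. indicator B (- f y + x) \<partial>lborel) = m" by (subst shift) (simp_all add: m_def)
    then show "indicator A (f y) * (\<integral>\<^sup>+x. indicator B (- f y + x) \<partial>lborel) = indicator A (f y) * m"
      by (rule arg_cong)
  qed
  also have "\<dots> = (\<integral>\<^sup>+y. indicator (f -` A) y \<partial>lborel) * m"
    by (simp add: nn_integral_multc indicator_vimage)
  also have "\<dots> = emeasure lborel (f -` A) * m"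
    using measurable_sets_borel[of f borel A] by (subst nn_integral_indicator) simp_all
  finally have "emeasure lborel A = emeasure lborel (f -` A)"
    using m by (simp add: mult.commute[of _ m] ennreal_mult_cancel_left)
  then show "emeasure (distr lborel borel f) A = emeasure lborel A"
    by (simp add: emeasure_distr)
qed simp

lemma orthogonal_transformation_between_units:
  fixes a b :: "'a::euclidean_space"
  assumes "norm a = 1" "norm b = 1"
  obtains f where "orthogonal_transformation f" "f a = b"
proof (cases "a = b")
  case True
  then show ?thesis using that[of id] by (simp add: orthogonal_transformation_id[unfolded id_def] id_def)
next
  case False
  define d where "d = a - b"
  have dd: "d \<bullet> d > 0" using False by (simp add: d_def)
  \<comment> \<open>The reflection in the hyperplane orthogonal to \<open>a - b\<close>.\<close>
  define f where "f x = x - (2 * (x \<bullet> d) / (d \<bullet> d)) *\<^sub>R d" for x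
  have "linear f" unfolding f_def
    by (intro linearI) (simp_all add: inner_add_left algebra_simps add_divide_distrib)
  moreover have "f x \<bullet> f y = x \<bullet> y" for x y
    unfolding f_def using dd by (simp add: inner_diff_left inner_diff_right inner_commute[of d y])
  ultimately have "orthogonal_transformation f" by (simp add: orthogonal_transformation_def)
  moreover have "f a = b"
  proof -
    have "a \<bullet> a = 1" "b \<bullet> b = 1" using assms by (simp_all add: dot_square_norm)
    then have "2 * (a \<bullet> d) = d \<bullet> d"
      unfolding d_def by (simp only: inner_diff_left inner_diff_right inner_commute[of b a]) (simp add: algebra_simps)
    then have "2 * (a \<bullet> d) / (d \<bullet> d) = 1" using dd by (metis divide_self less_irrefl)
    then have "f a = a - 1 *\<^sub>R d" unfolding f_def by (simp only:)
    then show ?thesis by (simp add: d_def)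
  qed
  ultimately show ?thesis using that by blast
qed

text \<open>For a basis vector the map is diagonal. An orthogonal map carrying that vector to
  \<open>b\<close> conjugates the two stretchings and preserves volume.\<close>

lemma emeasure_vimage_stretch_unit:
  fixes b :: "'a::euclidean_space"
  assumes b: "norm b = 1" and s: "s > 0" and A[measurable]: "A \<in> sets borel"
  shows "ennreal s * emeasure lborel ((\<lambda>x. x + ((s - 1) * (x \<bullet> b)) *\<^sub>R b) -` A) = emeasure lborel A"
proof -
  obtain e :: 'a where e: "e \<in> Basis" using nonempty_Basis by blast
  obtain f where f: "orthogonal_transformation f" "f e = b"
    using orthogonal_transformation_between_units[of e b] e b by auto
  have lin: "linear f" using f by (simp add: orthogonal_transformation_def)
  have [measurable]: "f \<in> borel_measurable borel"
    using lin by (simp add: borel_measurable_continuous_onI linear_continuous_on linear_conv_bounded_linear)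
  define T where "T b x = x + ((s - 1) * (x \<bullet> b)) *\<^sub>R b" for b x :: 'a
  have [measurable]: "T b \<in> borel_measurable borel" for b unfolding T_def by measurable
  have Tf: "T b (f x) = f (T e x)" for x
  proof -
    have "f x \<bullet> b = x \<bullet> e" using f by (metis orthogonal_transformation_def)
    then show ?thesis using f(2) by (simp add: T_def linear_add[OF lin] linear_scale[OF lin])
  qed
  define c where "c j = (if j = e then s else 1)" for j :: 'a
  have Te: "0 + (\<Sum>j\<in>Basis. (c j * (x \<bullet> j)) *\<^sub>R j) = T e x" for x
  proof -
    have "(\<Sum>j\<in>Basis. (c j * (x \<bullet> j)) *\<^sub>R j)
       = (\<Sum>j\<in>Basis. (x \<bullet> j) *\<^sub>R j + (if j = e then ((s - 1) * (x \<bullet> e)) *\<^sub>R e else 0))"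
      by (rule sum.cong) (auto simp: c_def algebra_simps)
    also have "\<dots> = T e x" using e by (simp add: sum.distrib T_def euclidean_representation)
    finally show ?thesis by simp
  qed
  have pc: "(\<Prod>j\<in>Basis. \<bar>c j\<bar>) = s"
  proof -
    have "(\<Prod>j\<in>Basis. \<bar>c j\<bar>) = (\<Prod>j\<in>Basis. if j = e then s else 1)"
      by (rule prod.cong) (use s in \<open>auto simp: c_def\<close>)
    then show ?thesis using e by simp
  qed
  have "lborel = density (distr lborel borel (\<lambda>x. 0 + (\<Sum>j\<in>Basis. (c j * (x \<bullet> j)) *\<^sub>R j))) (\<lambda>_. ennreal (\<Prod>j\<in>Basis. \<bar>c j\<bar>))"
    by (rule lborel_affine_euclidean) (use s in \<open>auto simp: c_def\<close>)
  then have L: "lborel = density (distr lborel borel (T e)) (\<lambda>_. ennreal s)"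
    unfolding Te pc .
  have fA[measurable]: "f -` A \<in> sets borel" by (rule measurable_sets_borel[OF _ A]) simp
  have inv: "emeasure lborel (f -` X) = emeasure lborel X" if [measurable]: "X \<in> sets borel" for X
    using arg_cong[OF lborel_distr_orthogonal[OF f(1)], of "\<lambda>M. emeasure M X"] by (simp add: emeasure_distr)
  have TA[measurable]: "T b -` A \<in> sets borel" by (rule measurable_sets_borel[OF _ A]) simp
  have "ennreal s * emeasure lborel (T b -` A) = ennreal s * emeasure lborel (f -` (T b -` A))"
    by (simp add: inv)
  also have "f -` (T b -` A) = T e -` (f -` A)" by (auto simp: Tf)
  also have "ennreal s * emeasure lborel (T e -` (f -` A)) = emeasure lborel (f -` A)"
    by (subst (2) L) (simp add: emeasure_density nn_integral_cmult emeasure_distr)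
  also have "\<dots> = emeasure lborel A" by (simp add: inv)
  finally show ?thesis by (simp add: T_def)
qed

text \<open>For an orthonormal \<open>B\<close>, multiplication by \<open>s\<close> on
  \<open>span B\<close> and the identity on its orthogonal complement.\<close>

definition stretch :: "'a::euclidean_space set \<Rightarrow> real \<Rightarrow> 'a \<Rightarrow> 'a" where
  "stretch B s x = x + (s - 1) *\<^sub>R (\<Sum>b\<in>B. (x \<bullet> b) *\<^sub>R b)"

text \<open>Adjoining \<open>b\<close> composes with a stretching along \<open>b\<close>, whose
  coordinate the earlier stretchings have left alone.\<close>

lemma emeasure_vimage_stretch:
  fixes B :: "'a::euclidean_space set"
  assumes B: "finite B" "pairwise orthogonal B" "\<And>b. b \<in> B \<Longrightarrow> norm b = 1" and s: "s > 0"
    and A: "A \<in> sets borel"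
  shows "ennreal (s ^ card B) * emeasure lborel (stretch B s -` A) = emeasure lborel A"
  using B A
proof (induction B arbitrary: A rule: finite_induct)
  case empty
  then show ?case by (simp add: stretch_def)
next
  case (insert b B)
  define T where "T x = x + ((s - 1) * (x \<bullet> b)) *\<^sub>R b" for x
  have ob: "b' \<bullet> b = 0" if "b' \<in> B" for b'
    using insert.prems(1) insert.hyps(2) that by (auto simp: pairwise_insert orthogonal_def)
  have st: "stretch (insert b B) s x = T (stretch B s x)" for x
  proof -
    have "stretch B s x \<bullet> b = x \<bullet> b"
      using ob by (simp add: stretch_def inner_add_left inner_sum_left)
    then show ?thesis using insert.hyps by (simp add: T_def) (simp add: stretch_def algebra_simps)
  qed
  have "T \<in> borel_measurable borel" unfolding T_def by measurable
  then have TA: "T -` A \<in> sets borel" by (rule measurable_sets_borel[OF _ insert.prems(3)])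
  have "stretch (insert b B) s -` A = stretch B s -` (T -` A)" by (auto simp: st)
  then have "ennreal (s ^ card (insert b B)) * emeasure lborel (stretch (insert b B) s -` A)
     = ennreal s * (ennreal (s ^ card B) * emeasure lborel (stretch B s -` (T -` A)))"
    using insert.hyps s by (simp add: ennreal_mult mult.assoc)
  also have "\<dots> = ennreal s * emeasure lborel (T -` A)"
    using insert.IH[OF _ _ TA] insert.prems by (simp add: pairwise_insert)
  also have "\<dots> = emeasure lborel A"
    unfolding T_def by (rule emeasure_vimage_stretch_unit[OF _ s insert.prems(3)]) (use insert.prems in simp)
  finally show ?case .
qed


section \<open>The Steiner formula\<close>

text \<open>Descent through facets: a point outside the relative interior lies on a facet, and faces
  of a facet are faces of \<open>P\<close>.\<close>

lemma polytope_point_in_rel_interior_face: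
  fixes P :: "'a::euclidean_space set"
  assumes "polytope P" "x \<in> P"
  obtains F where "F face_of P" "x \<in> rel_interior F"
proof -
  have "\<exists>F. F face_of P \<and> x \<in> rel_interior F"
    using assms
  proof (induction "nat (aff_dim P)" arbitrary: P rule: less_induct)
    case less
    show ?case
    proof (cases "x \<in> rel_interior P")
      case True
      then show ?thesis using face_of_refl[OF polytope_imp_convex[OF less.prems(1)]] by blast
    next
      case False
      then have "x \<in> \<Union>{F. F facet_of P}"
        using less.prems rel_boundary_of_polyhedron[OF polytope_imp_polyhedron[OF less.prems(1)]] by blast
      then obtain G where G: "G facet_of P" "x \<in> G" by blast
      then have Gf: "G face_of P" "aff_dim G = aff_dim P - 1" by (auto simp: facet_of_def)
      \<comment> \<open>The empty set has dimension -1, at which \<open>nat\<close> need not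
        decrease.\<close>
      have "G \<noteq> {}" using G(2) by blast
      then have "\<not> aff_dim G < 0" by (simp only: aff_dim_negative_iff) simp
      then have "nat (aff_dim G) < nat (aff_dim P)" using Gf(2) by linarith
      from less.hyps[OF this face_of_polytope_polytope[OF less.prems(1) Gf(1)] G(2)]
      obtain F where "F face_of G" "x \<in> rel_interior F" by blast
      then show ?thesis using face_of_trans Gf(1) by blast
    qed
  qed
  then show ?thesis using that by blast
qed

section \<open>Cells of the parallel set over the faces of a polytope\<close>

lemma stretch_orthogonal:
  assumes "\<And>b. b \<in> B \<Longrightarrow> x \<bullet> b = 0"
  shows "stretch B s (x + y) = x + stretch B s y"
  using assms by (simp add: stretch_def inner_add_left)

lemma stretch_span:
  fixes B :: "'a::euclidean_space set"
  assumes B: "finite B" "pairwise orthogonal B" "\<And>b. b \<in> B \<Longrightarrow> norm b = 1" and x: "x \<in> span B"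
  shows "stretch B s x = s *\<^sub>R x"
proof -
  define d where "d = x - (\<Sum>b\<in>B. (x \<bullet> b) *\<^sub>R b)"
  have db: "orthogonal d c" if c: "c \<in> B" for c
  proof -
    have "(\<Sum>b\<in>B. (x \<bullet> b) *\<^sub>R b) \<bullet> c = (\<Sum>b\<in>B. if b = c then x \<bullet> c else 0)"
      unfolding inner_sum_left
      by (rule sum.cong) (use B c in \<open>auto simp: pairwise_def orthogonal_def dot_square_norm\<close>)
    also have "\<dots> = x \<bullet> c" using B(1) c by simp
    finally show ?thesis by (simp add: d_def orthogonal_def inner_diff_left)
  qed
  have "d \<in> span B" unfolding d_def
    by (intro span_diff span_sum span_scale x) (simp add: span_base)
  then have "orthogonal d d" using orthogonal_to_span[of d B d] db by blast
  then have "(\<Sum>b\<in>B. (x \<bullet> b) *\<^sub>R b) = x" by (simp add: orthogonal_def d_def)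
  then show ?thesis by (simp add: stretch_def algebra_simps)
qed

lemma stretch_stretch_inverse:
  fixes B :: "'a::euclidean_space set"
  assumes B: "finite B" "pairwise orthogonal B" "\<And>b. b \<in> B \<Longrightarrow> norm b = 1" and s: "s \<noteq> 0"
  shows "stretch B (1/s) (stretch B s x) = x"
proof -
  define p where "p = (\<Sum>b\<in>B. (x \<bullet> b) *\<^sub>R b)"
  have p: "p \<in> span B" unfolding p_def by (intro span_sum span_scale) (simp add: span_base)
  \<comment> \<open>\<open>stretch B 2 p\<close> is \<open>p\<close> plus its projection to
    \<open>span B\<close>, so this instance says that the projection fixes \<open>p\<close>.\<close>
  have "stretch B 2 p = 2 *\<^sub>R p" by (rule stretch_span[OF B p])
  then have pp: "(\<Sum>b\<in>B. (p \<bullet> b) *\<^sub>R b) = p" by (simp add: stretch_def scaleR_2)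
  have "(\<Sum>b\<in>B. (stretch B s x \<bullet> b) *\<^sub>R b) = p + (s - 1) *\<^sub>R (\<Sum>b\<in>B. (p \<bullet> b) *\<^sub>R b)"
    unfolding scaleR_sum_right
    by (subst p_def) (simp add: stretch_def p_def[symmetric] inner_add_left scaleR_add_left sum.distrib)
  then have 1: "(\<Sum>b\<in>B. (stretch B s x \<bullet> b) *\<^sub>R b) = s *\<^sub>R p" unfolding pp by (simp add: algebra_simps)
  have "stretch B (1/s) (stretch B s x) = x + (s - 1) *\<^sub>R p + (1/s - 1) *\<^sub>R (s *\<^sub>R p)"
    unfolding stretch_def[of B "1/s"] 1 by (simp add: stretch_def p_def)
  also have "\<dots> = x + ((s - 1) + (1/s - 1) * s) *\<^sub>R p" by (simp add: scaleR_add_left)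
  also have "(s - 1) + (1/s - 1) * s = 0" using s by (simp add: field_simps)
  finally show ?thesis by simp
qed

text \<open>The part of the parallel set lying over \<open>F\<close>. For a polytope, the cells over
  the nonempty faces partition the parallel set, since the relative interiors of the faces partition
  \<open>P\<close>.\<close>

definition face_cell :: "'a::euclidean_space set \<Rightarrow> 'a set \<Rightarrow> real \<Rightarrow> 'a set" where
  "face_cell P F s = {x. closest_point P x \<in> rel_interior F \<and> dist x (closest_point P x) \<le> s}"

lemma face_cell_borel:
  fixes P F :: "'a::euclidean_space set"
  assumes P: "closed P" "convex P" "P \<noteq> {}"
  shows "face_cell P F s \<in> sets borel"
proof -
  have [measurable]: "closest_point P \<in> borel_measurable borel"
    by (intro borel_measurable_continuous_onI continuous_on_closest_point P)
  obtain T where T: "open T" "rel_interior F = affine hull F \<inter> T"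
    using openin_rel_interior[of F] by (auto simp: openin_open)
  then have [measurable]: "rel_interior F \<in> sets borel" by auto
  show ?thesis unfolding face_cell_def by measurable
qed

text \<open>On the set of points projecting into the relative interior of a face \<open>F\<close>, the affine map
  stretching the normal directions of \<open>F\<close> by \<open>s\<close> multiplies the distance to \<open>P\<close> by \<open>s\<close>.\<close>
lemma emeasure_face_cell:
  fixes P F :: "'a::euclidean_space set"
  assumes P: "closed P" "convex P" and F: "F face_of P" "F \<noteq> {}"
  shows "\<exists>k\<le>DIM('a). \<forall>s>0. emeasure lborel (face_cell P F s) = ennreal (s ^ k) * emeasure lborel (face_cell P F 1)"
proof -
  obtain a where a: "a \<in> F" using F(2) by blast
  have FP: "F \<subseteq> P" using F(1) face_of_imp_subset by blast
  then have P0: "P \<noteq> {}" using F(2) by blast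
  have cF: "convex F" using F(1) face_of_imp_convex by blast
  \<comment> \<open>The directions normal to \<open>F\<close>; the dimension of this space is the
    exponent \<open>k\<close>.\<close>
  define V where "V = {x. \<forall>y\<in>(\<lambda>y. y - a) ` F. orthogonal y x}"
  have "subspace V" unfolding V_def by (rule subspace_orthogonal_to_vectors)
  then obtain N where N: "N \<subseteq> V" "pairwise orthogonal N" "\<And>b. b \<in> N \<Longrightarrow> norm b = 1"
    "independent N" "card N = dim V" "span N = V" using orthonormal_basis_subspace by blast
  have fN: "finite N" using N(4) independent_imp_finite by blast
  define \<Phi> where "\<Phi> s x = a + stretch N s (x - a)" for s x
  have move: "\<Phi> s x \<in> face_cell P F (s * t)" if x: "x \<in> face_cell P F t" and s: "s > 0" for s t x
  proof -
    define p where "p = closest_point P x"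
    have p: "p \<in> rel_interior F" "dist x p \<le> t" using x by (auto simp: face_cell_def p_def)
    have pF: "p \<in> F" using p(1) rel_interior_subset by blast
    have dot: "(x - p) \<bullet> (y - p) \<le> 0" if "y \<in> P" for y
      using closest_point_dot[OF P(2,1) that, of x] by (simp add: p_def)
    have zero: "(x - p) \<bullet> (y - p) = 0" if y: "y \<in> F" for y
    proof -
      \<comment> \<open>As \<open>p\<close> is in the relative interior, the segment from
        \<open>y\<close> can be prolonged beyond \<open>p\<close> within \<open>F\<close>; its
        endpoint gives the opposite inequality.\<close>
      obtain e where e: "e > 1" "(1 - e) *\<^sub>R y + e *\<^sub>R p \<in> F"
        using p(1) y convex_rel_interior_iff[OF cF, of p] F(2) by blast
      then have "(x - p) \<bullet> ((1 - e) *\<^sub>R y + e *\<^sub>R p - p) \<le> 0" using dot FP by blast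
      moreover have "(1 - e) *\<^sub>R y + e *\<^sub>R p - p = (1 - e) *\<^sub>R (y - p)" by (simp add: algebra_simps)
      ultimately have "(1 - e) * ((x - p) \<bullet> (y - p)) \<le> 0" by simp
      then have "(x - p) \<bullet> (y - p) \<ge> 0" using e(1) by (simp add: mult_le_0_iff)
      then show ?thesis using dot y FP by force
    qed
    have "x - p \<in> V"
    proof -
      have "(y - a) \<bullet> (x - p) = 0" if "y \<in> F" for y
      proof -
        have "(x - p) \<bullet> (y - a) = (x - p) \<bullet> (y - p) - (x - p) \<bullet> (a - p)" by (simp add: inner_diff_right)
        then show ?thesis using zero[OF that] zero[OF a] by (simp add: inner_commute)
      qed
      then show ?thesis by (auto simp: V_def orthogonal_def)
    qed
    then have xp: "stretch N s (x - p) = s *\<^sub>R (x - p)"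
      using stretch_span[OF fN N(2,3)] N(6) by blast
    have "(p - a) \<bullet> b = 0" if "b \<in> N" for b using that N(1) pF by (auto simp: V_def orthogonal_def)
    then have "stretch N s ((p - a) + (x - p)) = (p - a) + stretch N s (x - p)" by (rule stretch_orthogonal)
    \<comment> \<open>Although the centre \<open>p\<close> varies with \<open>x\<close>, on the cell
      the affine map is the dilation from the projection, which therefore stays unchanged.\<close>
    then have \<Phi>: "\<Phi> s x = p + s *\<^sub>R (x - p)" by (simp add: \<Phi>_def xp)
    have "p = closest_point P (\<Phi> s x)"
    proof (rule closest_point_unique[OF P(2,1)])
      show "p \<in> P" using pF FP by blast
      show "\<forall>z\<in>P. dist (\<Phi> s x) p \<le> dist (\<Phi> s x) z"
      proof
        fix z assume z: "z \<in> P"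
        have "(dist (\<Phi> s x) p)\<^sup>2 \<le> (dist (\<Phi> s x) z)\<^sup>2"
        proof -
          have "\<Phi> s x - z = s *\<^sub>R (x - p) - (z - p)" by (simp add: \<Phi>)
          then have "(dist (\<Phi> s x) z)\<^sup>2 = (norm (s *\<^sub>R (x - p)))\<^sup>2 - 2 * s * ((x - p) \<bullet> (z - p)) + (norm (z - p))\<^sup>2"
            unfolding dist_norm power2_norm_eq_inner
            by (simp only: inner_diff_left inner_diff_right inner_scaleR_left inner_scaleR_right)
              (simp add: inner_commute algebra_simps)
          moreover have "s * ((x - p) \<bullet> (z - p)) \<le> 0" using dot[OF z] s by (simp add: mult_le_0_iff)
          moreover have "(dist (\<Phi> s x) p)\<^sup>2 = (norm (s *\<^sub>R (x - p)))\<^sup>2" by (simp add: \<Phi> dist_norm)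
          moreover have "2 * s * ((x - p) \<bullet> (z - p)) = 2 * (s * ((x - p) \<bullet> (z - p)))" by simp
          ultimately show ?thesis using zero_le_power2[of "norm (z - p)"] by linarith
        qed
        then show "dist (\<Phi> s x) p \<le> dist (\<Phi> s x) z" by (rule power2_le_imp_le) simp
      qed
    qed
    then show ?thesis using p s by (simp add: face_cell_def) (simp add: \<Phi> dist_norm)
  qed
  have inv: "\<Phi> (1/s) (\<Phi> s x) = x" if "s > 0" for s x
    using stretch_stretch_inverse[OF fN N(2,3), of s "x - a"] that by (simp add: \<Phi>_def)
  have cell: "\<Phi> s -` face_cell P F s = face_cell P F 1" if s: "s > 0" for s
  proof (intro set_eqI iffI)
    fix x assume "x \<in> face_cell P F 1"
    from move[OF this s] show "x \<in> \<Phi> s -` face_cell P F s" by simp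
  next
    fix x assume "x \<in> \<Phi> s -` face_cell P F s"
    then have "\<Phi> s x \<in> face_cell P F s" by simp
    from move[OF this, of "1/s"] s show "x \<in> face_cell P F 1" by (simp add: inv)
  qed
  have tr: "emeasure lborel ((\<lambda>x. c + x) -` Y) = emeasure lborel Y" if [measurable]: "Y \<in> sets borel" for Y and c :: 'a
    using arg_cong[OF lborel_distr_plus[of c], of "\<lambda>M. emeasure M Y"] by (simp add: emeasure_distr)
  have "emeasure lborel (face_cell P F s) = ennreal (s ^ card N) * emeasure lborel (face_cell P F 1)" if s: "s > 0" for s
  proof -
    define Y where "Y = (\<lambda>x. a + x) -` face_cell P F s"
    have bs: "face_cell P F t \<in> sets borel" for t by (rule face_cell_borel[OF P P0])
    have Yb: "Y \<in> sets borel" unfolding Y_def by (rule measurable_sets_borel[OF _ bs]) simp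
    have "emeasure lborel (face_cell P F s) = emeasure lborel Y" unfolding Y_def by (rule tr[OF bs, symmetric])
    also have "\<dots> = ennreal (s ^ card N) * emeasure lborel (stretch N s -` Y)"
      by (rule emeasure_vimage_stretch[OF fN N(2,3) s Yb, symmetric])
    also have "stretch N s -` Y = (\<lambda>x. a + x) -` (\<Phi> s -` face_cell P F s)"
      by (auto simp: Y_def \<Phi>_def)
    also have "emeasure lborel \<dots> = emeasure lborel (face_cell P F 1)" unfolding cell[OF s] by (rule tr[OF bs])
    finally show ?thesis .
  qed
  moreover have "card N \<le> DIM('a)" using N(5) dim_subset_UNIV[of V] by simp
  ultimately show ?thesis by blast
qed

lemma set_plus_scaled_cball:
  fixes K :: "'a::euclidean_space set"
  assumes K: "closed K" "K \<noteq> {}" and s: "s > 0"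
  shows "K + (\<lambda>b. s *\<^sub>R b) ` cball 0 1 = {x. dist x (closest_point K x) \<le> s}"
proof (intro set_eqI iffI)
  fix x assume "x \<in> K + (\<lambda>b. s *\<^sub>R b) ` cball 0 1"
  then obtain a b where ab: "a \<in> K" "norm b \<le> 1" "x = a + s *\<^sub>R b" by (auto simp: set_plus_def)
  have "dist x (closest_point K x) \<le> dist x a" by (rule closest_point_le[OF K(1) ab(1)])
  also have "dist x a \<le> s" using ab s by (simp add: dist_norm mult_left_le)
  finally show "x \<in> {x. dist x (closest_point K x) \<le> s}" by simp
next
  fix x assume x: "x \<in> {x. dist x (closest_point K x) \<le> s}"
  define b where "b = (1/s) *\<^sub>R (x - closest_point K x)"
  have "b \<in> cball 0 1" using x s by (simp add: b_def dist_norm)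
  then have "closest_point K x + s *\<^sub>R b \<in> K + (\<lambda>b. s *\<^sub>R b) ` cball 0 1"
    by (intro set_plus_intro closest_point_in_set[OF K] imageI)
  moreover have "closest_point K x + s *\<^sub>R b = x" using s by (simp add: b_def)
  ultimately show "x \<in> K + (\<lambda>b. s *\<^sub>R b) ` cball 0 1" by simp
qed

lemma compact_set_plus_scaled_cball:
  fixes K :: "'a::euclidean_space set"
  assumes "compact K"
  shows "compact (K + (\<lambda>b. s *\<^sub>R b) ` cball 0 1)"
proof -
  have "K + (\<lambda>b. s *\<^sub>R b) ` cball 0 1 = {x + y |x y. x \<in> K \<and> y \<in> (\<lambda>b. s *\<^sub>R b) ` cball 0 1}"
    by (auto simp: set_plus_def)
  then show ?thesis using compact_sums[OF assms compact_scaling[OF compact_cball[of "0::'a" 1], of s]] by simp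
qed

section \<open>Polynomial growth of parallel volumes\<close>

abbreviation parallel_volume :: "'a::euclidean_space set \<Rightarrow> real \<Rightarrow> real" where
  "parallel_volume K s \<equiv> measure lborel (K + (\<lambda>b. s *\<^sub>R b) ` cball 0 1)"

text \<open>The coefficient of \<open>s ^ i\<close> collects the cells whose volume grows with
  exponent \<open>i\<close>. The sign is recorded because the passage to convex bodies rests on
  it.\<close>

lemma parallel_volume_polytope:
  fixes P :: "'a::euclidean_space set"
  assumes P: "polytope P" "P \<noteq> {}"
  obtains c where "\<And>i. 0 \<le> c i"
    "\<And>s. s > 0 \<Longrightarrow> parallel_volume P s = (\<Sum>i\<le>DIM('a). c i * s ^ i)"
proof -
  have cP: "closed P" "convex P" "compact P"
    using P polytope_imp_compact polytope_imp_convex compact_imp_closed by blast+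
  define \<F> where "\<F> = {F. F face_of P \<and> F \<noteq> {}}"
  have fin: "finite \<F>" using finite_polytope_faces[OF P(1)] by (simp add: \<F>_def)
  have "\<forall>F\<in>\<F>. \<exists>k\<le>DIM('a). \<forall>s>0. emeasure lborel (face_cell P F s) = ennreal (s ^ k) * emeasure lborel (face_cell P F 1)"
    using emeasure_face_cell[OF cP(1,2)] by (auto simp: \<F>_def)
  then obtain k where k: "\<And>F. F \<in> \<F> \<Longrightarrow> k F \<le> DIM('a)"
    "\<And>F s. F \<in> \<F> \<Longrightarrow> s > 0 \<Longrightarrow> emeasure lborel (face_cell P F s) = ennreal (s ^ k F) * emeasure lborel (face_cell P F 1)"
    by metis
  define m where "m F = measure lborel (face_cell P F 1)" for F
  define c where "c i = (\<Sum>F\<in>{F\<in>\<F>. k F = i}. m F)" for i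
  have "parallel_volume P s = (\<Sum>i\<le>DIM('a). c i * s ^ i)" if s: "s > 0" for s
  proof -
    have bs: "face_cell P F s \<in> sets lborel" for F using face_cell_borel[OF cP(1,2) P(2)] by simp
    have U: "P + (\<lambda>b. s *\<^sub>R b) ` cball 0 1 = (\<Union>F\<in>\<F>. face_cell P F s)"
    proof (unfold set_plus_scaled_cball[OF cP(1) P(2) s], intro set_eqI iffI)
      fix x assume x: "x \<in> {x. dist x (closest_point P x) \<le> s}"
      obtain F where "F face_of P" "closest_point P x \<in> rel_interior F"
        using polytope_point_in_rel_interior_face[OF P(1) closest_point_in_set[OF cP(1) P(2)]] by blast
      then show "x \<in> (\<Union>F\<in>\<F>. face_cell P F s)"
        using x by (auto simp: \<F>_def face_cell_def)
    qed (auto simp: face_cell_def)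
    have "emeasure lborel (P + (\<lambda>b. s *\<^sub>R b) ` cball 0 1) < \<infinity>"
      by (rule emeasure_compact_finite[OF compact_set_plus_scaled_cball[OF cP(3)]])
    then have f: "emeasure lborel (face_cell P F s) \<noteq> \<infinity>" if "F \<in> \<F>" for F
      using emeasure_mono[of "face_cell P F s" "P + (\<lambda>b. s *\<^sub>R b) ` cball 0 1" lborel] that
        borel_compact[OF compact_set_plus_scaled_cball[OF cP(3)], of s]
        UN_upper[OF that, of "\<lambda>F. face_cell P F s"]
      unfolding U by (auto simp: top_unique)
    have dis: "disjoint_family_on (\<lambda>F. face_cell P F s) \<F>"
      unfolding disjoint_family_on_def
    proof (intro ballI impI)
      fix F G assume FG: "F \<in> \<F>" "G \<in> \<F>" "F \<noteq> G"
      then have "rel_interior F \<inter> rel_interior G = {}"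
        using face_of_eq[of F P G] by (auto simp: \<F>_def)
      then show "face_cell P F s \<inter> face_cell P G s = {}" by (auto simp: face_cell_def)
    qed
    have "parallel_volume P s = (\<Sum>F\<in>\<F>. measure lborel (face_cell P F s))"
      unfolding U by (rule measure_finite_Union) (use fin dis f bs in auto)
    also have "\<dots> = (\<Sum>F\<in>\<F>. m F * s ^ k F)"
    proof (rule sum.cong)
      fix F assume "F \<in> \<F>"
      from k(2)[OF this s] show "measure lborel (face_cell P F s) = m F * s ^ k F"
        using s by (simp only: measure_def m_def enn2real_mult) simp
    qed simp
    also have "\<dots> = (\<Sum>i\<le>DIM('a). \<Sum>F\<in>{F\<in>\<F>. k F = i}. m F * s ^ k F)"
      by (rule sum.group[symmetric]) (use fin k(1) in auto)
    also have "\<dots> = (\<Sum>i\<le>DIM('a). c i * s ^ i)"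
      by (rule sum.cong) (simp_all add: c_def sum_distrib_right)
    finally show ?thesis .
  qed
  moreover have "0 \<le> c i" for i unfolding c_def by (rule sum_nonneg) (simp add: m_def)
  ultimately show thesis using that by blast
qed

text \<open>Bolzano-Weierstrass, refining the subsequence once per coefficient.\<close>

lemma bounded_coefficients_convergent_subsequence:
  fixes c :: "nat \<Rightarrow> nat \<Rightarrow> real"
  assumes "\<And>m i. i \<le> n \<Longrightarrow> \<bar>c m i\<bar> \<le> M"
  shows "\<exists>r l. strict_mono (r :: nat \<Rightarrow> nat) \<and> (\<forall>i\<le>n. (\<lambda>m. c (r m) i) \<longlonglongrightarrow> l i)"
  using assms
proof (induction n)
  case 0
  have "\<forall>m. c m 0 \<in> {-M..M}" using 0[of 0] by (simp add: abs_le_iff minus_le_iff)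
  then obtain l r where "strict_mono r" "((\<lambda>m. c m 0) \<circ> r) \<longlonglongrightarrow> l"
    using compact_Icc[of "-M" M] unfolding compact_def by metis
  then show ?case by (intro exI[of _ r] exI[of _ "\<lambda>_. l"]) (simp add: o_def)
next
  case (Suc n)
  then obtain r l where r: "strict_mono r" "\<And>i. i \<le> n \<Longrightarrow> (\<lambda>m. c (r m) i) \<longlonglongrightarrow> l i" by (meson le_SucI)
  have "\<forall>m. c (r m) (Suc n) \<in> {-M..M}" using Suc.prems[of "Suc n"] by (simp add: abs_le_iff minus_le_iff)
  then obtain l' r' where r': "strict_mono r'" "((\<lambda>m. c (r m) (Suc n)) \<circ> r') \<longlonglongrightarrow> l'"
    using compact_Icc[of "-M" M] unfolding compact_def by metis
  have "(\<lambda>m. c (r (r' m)) i) \<longlonglongrightarrow> (l(Suc n := l')) i" if "i \<le> Suc n" for i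
  proof (cases "i = Suc n")
    case True then show ?thesis using r'(2) by (simp add: o_def)
  next
    case False
    then have "((\<lambda>m. c (r m) i) \<circ> r') \<longlonglongrightarrow> l i" using that r(2) by (intro LIMSEQ_subseq_LIMSEQ r'(1)) auto
    then show ?thesis using False by (simp add: o_def)
  qed
  moreover have "strict_mono (\<lambda>m. r (r' m))" using strict_mono_o[OF r(1) r'(1)] by (simp add: o_def)
  ultimately show ?case by (intro exI[of _ "\<lambda>m. r (r' m)"] exI[of _ "l(Suc n := l')"]) simp
qed

lemma parallel_volume_mono:
  fixes K L :: "'a::euclidean_space set"
  assumes "compact K" "compact L" "K + (\<lambda>b. s *\<^sub>R b) ` cball 0 1 \<subseteq> L + (\<lambda>b. t *\<^sub>R b) ` cball 0 1"
  shows "parallel_volume K s \<le> parallel_volume L t"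
  using assms fmeasurable_compact[OF compact_set_plus_scaled_cball[OF assms(1)], of s]
    fmeasurable_compact[OF compact_set_plus_scaled_cball[OF assms(2)], of t]
  by (intro measure_mono_fmeasurable) (auto simp: fmeasurable_def)

text \<open>The coefficients for inscribed polytopes are nonnegative with bounded sum, so a subsequence of
  approximating polytopes has convergent coefficients.\<close>
lemma parallel_volume_polynomial:
  fixes K :: "'a::euclidean_space set"
  assumes K: "compact K" "convex K" "K \<noteq> {}"
  obtains c where "\<And>s. s > 0 \<Longrightarrow> parallel_volume K s = (\<Sum>i\<le>DIM('a). c i * s ^ i)"
proof -
  let ?n = "DIM('a)"
  have "\<exists>P. polytope P \<and> P \<noteq> {} \<and> P \<subseteq> K \<and> K \<subseteq> P + (\<lambda>b. (1 / real (Suc m)) *\<^sub>R b) ` cball 0 1" for m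
  proof -
    define d where "d = 1 / real (Suc m)"
    have d: "d > 0" by (simp add: d_def)
    have "seq_compact K" using K(1) by (simp only: compact_eq_seq_compact_metric)
    from seq_compact_imp_totally_bounded[rule_format, OF this d]
    \<comment> \<open>A finite \<open>d\<close>-net of \<open>K\<close>; its convex hull is the
      approximating polytope.\<close>
    have "\<exists>X. finite X \<and> X \<subseteq> K \<and> K \<subseteq> (\<Union>x\<in>X. ball x d)" .
    then obtain X where X: "finite X" "X \<subseteq> K" "K \<subseteq> (\<Union>x\<in>X. ball x d)" by (elim exE conjE)
    have "K \<subseteq> convex hull X + (\<lambda>b. d *\<^sub>R b) ` cball 0 1"
    proof
      fix y assume "y \<in> K"
      then obtain x where x: "x \<in> X" "dist x y < d" using X(3) by auto
      define b where "b = (1/d) *\<^sub>R (y - x)"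
      have "b \<in> cball 0 1" using x(2) d by (simp add: b_def dist_norm norm_minus_commute)
      then have "x + d *\<^sub>R b \<in> convex hull X + (\<lambda>b. d *\<^sub>R b) ` cball 0 1"
        by (intro set_plus_intro hull_inc[OF x(1)] imageI)
      moreover have "x + d *\<^sub>R b = y" using d by (simp add: b_def)
      ultimately show "y \<in> convex hull X + (\<lambda>b. d *\<^sub>R b) ` cball 0 1" by simp
    qed
    moreover have "convex hull X \<noteq> {}" using X(3) K(3) by auto
    moreover have "convex hull X \<subseteq> K" using X(2) K(2) hull_minimal by blast
    ultimately show ?thesis using X(1) unfolding polytope_def d_def by blast
  qed
  then obtain P where P: "\<And>m. polytope (P m)" "\<And>m. P m \<noteq> {}" "\<And>m. P m \<subseteq> K"
    "\<And>m. K \<subseteq> P m + (\<lambda>b. (1 / real (Suc m)) *\<^sub>R b) ` cball 0 1" by metis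
  have cP: "compact (P m)" for m using P(1) polytope_imp_compact by blast
  have "\<exists>c. (\<forall>i. 0 \<le> c i) \<and> (\<forall>s>0. parallel_volume (P m) s = (\<Sum>i\<le>?n. c i * s ^ i))" for m
    using parallel_volume_polytope[OF P(1,2)[of m]] by metis
  then obtain c where c: "\<And>m i. 0 \<le> c m i"
    "\<And>m s. s > 0 \<Longrightarrow> parallel_volume (P m) s = (\<Sum>i\<le>?n. c m i * s ^ i)" by metis
  have up: "parallel_volume (P m) s \<le> parallel_volume K s" for m s
    by (rule parallel_volume_mono[OF cP K(1)]) (use P(3)[of m] in \<open>auto simp: set_plus_def\<close>)
  have lo: "parallel_volume K s \<le> parallel_volume (P m) (s + 1 / real (Suc m))" if s: "s > 0" for m s
  proof (rule parallel_volume_mono[OF K(1) cP])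
    define d where "d = 1 / real (Suc m)"
    have d: "d > 0" by (simp add: d_def)
    show "K + (\<lambda>b. s *\<^sub>R b) ` cball 0 1 \<subseteq> P m + (\<lambda>b. (s + 1 / real (Suc m)) *\<^sub>R b) ` cball 0 1"
    proof
      fix z assume "z \<in> K + (\<lambda>b. s *\<^sub>R b) ` cball 0 1"
      then obtain x b where xb: "x \<in> K" "norm b \<le> 1" "z = x + s *\<^sub>R b" by (auto simp: set_plus_def)
      then obtain p b' where pb: "p \<in> P m" "norm b' \<le> 1" "x = p + d *\<^sub>R b'"
        using P(4)[of m] unfolding d_def[symmetric] by (auto simp: set_plus_def)
      define b'' where "b'' = (1 / (s + d)) *\<^sub>R (d *\<^sub>R b' + s *\<^sub>R b)"
      have "norm (d *\<^sub>R b' + s *\<^sub>R b) \<le> d * norm b' + s * norm b"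
        using norm_triangle_ineq[of "d *\<^sub>R b'" "s *\<^sub>R b"] d s by simp
      also have "\<dots> \<le> d * 1 + s * 1" using xb pb d s by (intro add_mono mult_left_mono) auto
      finally have "b'' \<in> cball 0 1" using d s by (simp add: b''_def add.commute)
      then have "p + (s + d) *\<^sub>R b'' \<in> P m + (\<lambda>b. (s + d) *\<^sub>R b) ` cball 0 1"
        by (intro set_plus_intro pb(1) imageI)
      moreover have "z = p + (s + d) *\<^sub>R b''" using d s by (simp add: b''_def xb pb)
      ultimately show "z \<in> P m + (\<lambda>b. (s + 1 / real (Suc m)) *\<^sub>R b) ` cball 0 1"
        unfolding d_def by simp
    qed
  qed
  \<comment> \<open>Nonnegative coefficients make the parallel volume of \<open>P m\<close> convex
    in the radius, and \<open>s + d = (1 - d) * s + d * (s + 1)\<close>. This bounds its growth from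
    \<open>s\<close> to \<open>s + d\<close> by a multiple of \<open>d\<close> that does not depend
    on \<open>m\<close>.\<close>
  have gap: "parallel_volume K s - parallel_volume (P m) s \<le> 1 / real (Suc m) * parallel_volume K (s + 1)" if s: "s > 0" for m s
  proof -
    define d where "d = 1 / real (Suc m)"
    have d: "0 < d" "d \<le> 1" by (simp_all add: d_def)
    have "(s + d) ^ i \<le> (1 - d) * s ^ i + d * (s + 1) ^ i" for i
    proof -
      have "convex_on {0..} (\<lambda>x::real. x ^ i)"
        using convex_on_subset[OF convex_power_even[of i], of "{0..}"] convex_power_odd[of i]
        by (cases "even i") auto
      then have "((1 - d) *\<^sub>R s + d *\<^sub>R (s + 1)) ^ i \<le> (1 - d) * s ^ i + d * (s + 1) ^ i"
        using s d by (intro convex_onD[where f="\<lambda>x. x ^ i"]) auto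
      then show ?thesis by (simp add: algebra_simps)
    qed
    then have "(\<Sum>i\<le>?n. c m i * (s + d) ^ i) \<le> (\<Sum>i\<le>?n. c m i * ((1 - d) * s ^ i + d * (s + 1) ^ i))"
      using c(1) by (intro sum_mono mult_left_mono) auto
    also have "\<dots> = (1 - d) * (\<Sum>i\<le>?n. c m i * s ^ i) + d * (\<Sum>i\<le>?n. c m i * (s + 1) ^ i)"
      unfolding sum_distrib_left sum.distrib[symmetric] by (rule sum.cong) (simp_all add: algebra_simps)
    finally have "parallel_volume (P m) (s + d) \<le> (1 - d) * parallel_volume (P m) s + d * parallel_volume (P m) (s + 1)"
      using c(2)[of "s + d" m] c(2)[of s m] c(2)[of "s + 1" m] s d by simp
    also have "\<dots> \<le> 1 * parallel_volume (P m) s + d * parallel_volume K (s + 1)"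
      using d up by (intro add_mono mult_right_mono mult_left_mono) auto
    finally show ?thesis using lo[OF s, of m] by (simp add: d_def)
  qed
  have lim: "(\<lambda>m. parallel_volume (P m) s) \<longlonglongrightarrow> parallel_volume K s" if s: "s > 0" for s
  proof (rule tendsto_sandwich)
    show "\<forall>\<^sub>F m in sequentially. parallel_volume K s - 1 / real (Suc m) * parallel_volume K (s + 1) \<le> parallel_volume (P m) s"
      using gap[OF s] by (intro always_eventually allI) (simp add: algebra_simps)
    show "\<forall>\<^sub>F m in sequentially. parallel_volume (P m) s \<le> parallel_volume K s"
      using up by (intro always_eventually allI)
    have "(\<lambda>m. parallel_volume K s - 1 / real (Suc m) * parallel_volume K (s + 1)) \<longlonglongrightarrow> parallel_volume K s - 0 * parallel_volume K (s + 1)"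
      by (intro tendsto_intros LIMSEQ_Suc[OF lim_const_over_n])
    then show "(\<lambda>m. parallel_volume K s - 1 / real (Suc m) * parallel_volume K (s + 1)) \<longlonglongrightarrow> parallel_volume K s" by simp
  qed simp
  \<comment> \<open>The sum of the coefficients is the parallel volume at radius 1.\<close>
  have bnd: "\<bar>c m i\<bar> \<le> parallel_volume K 1" if "i \<le> ?n" for m i
  proof -
    have "c m i \<le> (\<Sum>i\<le>?n. c m i)" by (rule member_le_sum) (use that c(1) in auto)
    also have "\<dots> = parallel_volume (P m) 1" using c(2)[of 1 m] by simp
    also have "\<dots> \<le> parallel_volume K 1" by (rule up)
    finally show ?thesis using c(1)[of m i] by simp
  qed
  from bounded_coefficients_convergent_subsequence[of ?n c, OF bnd] obtain r l where
    r: "strict_mono r" "\<And>i. i \<le> ?n \<Longrightarrow> (\<lambda>m. c (r m) i) \<longlonglongrightarrow> l i" by blast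
  have "parallel_volume K s = (\<Sum>i\<le>?n. l i * s ^ i)" if s: "s > 0" for s
  proof (rule LIMSEQ_unique)
    show "(\<lambda>m. parallel_volume (P (r m)) s) \<longlonglongrightarrow> parallel_volume K s"
      using LIMSEQ_subseq_LIMSEQ[OF lim[OF s] r(1)] by (simp add: o_def)
    have "(\<lambda>m. \<Sum>i\<le>?n. c (r m) i * s ^ i) \<longlonglongrightarrow> (\<Sum>i\<le>?n. l i * s ^ i)"
      by (intro tendsto_sum tendsto_mult r(2) tendsto_const) auto
    then show "(\<lambda>m. parallel_volume (P (r m)) s) \<longlonglongrightarrow> (\<Sum>i\<le>?n. l i * s ^ i)"
      using c(2)[OF s] by simp
  qed
  then show thesis using that by blast
qed


section \<open>The support function and the first order expansion of volume\<close>

lemma ball_borel [measurable]: "ball a r \<in> sets (borel :: 'a::euclidean_space measure)"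
  by simp

text \<open>Polar coordinates, phrased over the unit ball. The set where \<open>g = c\<close> is
  invariant under positive dilations, and the dilation by \<open>c\<close> carries its part in the
  unit ball to its part in the ball of radius \<open>c\<close>.\<close>

lemma emeasure_star_simple:
  fixes g :: "'a::euclidean_space \<Rightarrow> real"
  assumes g[measurable]: "g \<in> borel_measurable borel" and fin: "finite (range g)" and nn: "\<And>x. 0 \<le> g x"
    and hom: "\<And>c x. c > 0 \<Longrightarrow> g (c *\<^sub>R x) = g x"
  shows "emeasure lborel {x. norm x < g x} = (\<integral>\<^sup>+x. ennreal (g x ^ DIM('a)) * indicator (ball 0 1) x \<partial>lborel)"
proof -
  define E where "E c = {x. g x = c}" for c
  have Em[measurable]: "E c \<in> sets borel" for c unfolding E_def by measurable
  have scale: "emeasure lborel (E c \<inter> ball 0 c) = ennreal (c ^ DIM('a)) * emeasure lborel (E c \<inter> ball 0 1)"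
    if c: "c \<ge> 0" for c
  proof (cases "c = 0")
    case True then show ?thesis by simp
  next
    case False
    then have c: "c > 0" using c by simp
    have L: "lborel = density (distr lborel borel (\<lambda>x::'a. 0 + c *\<^sub>R x)) (\<lambda>_. ennreal (\<bar>c\<bar> ^ DIM('a)))"
      by (rule lborel_affine) (use c in simp)
    have pre: "(\<lambda>x. 0 + c *\<^sub>R x) -` (E c \<inter> ball 0 c) = E c \<inter> ball 0 1"
      using c by (auto simp: E_def hom)
    have "emeasure lborel (E c \<inter> ball 0 c) =
      emeasure (density (distr lborel borel (\<lambda>x::'a. 0 + c *\<^sub>R x)) (\<lambda>_. ennreal (\<bar>c\<bar> ^ DIM('a)))) (E c \<inter> ball 0 c)"
      using L by simp
    also have "\<dots> = ennreal (c ^ DIM('a)) * emeasure (distr lborel borel (\<lambda>x::'a. 0 + c *\<^sub>R x)) (E c \<inter> ball 0 c)"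
      using c by (subst emeasure_density) (simp_all add: nn_integral_cmult_indicator)
    also have "emeasure (distr lborel borel (\<lambda>x::'a. 0 + c *\<^sub>R x)) (E c \<inter> ball 0 c) = emeasure lborel (E c \<inter> ball 0 1)"
      by (subst emeasure_distr) (simp_all only: pre, simp_all)
    finally show ?thesis .
  qed
  have U: "{x. norm x < g x} = (\<Union>c\<in>range g. E c \<inter> ball 0 c)" by (auto simp: E_def)
  have "emeasure lborel {x. norm x < g x} = (\<Sum>c\<in>range g. emeasure lborel (E c \<inter> ball 0 c))"
    unfolding U by (rule sum_emeasure[symmetric]) (use fin in \<open>auto simp: disjoint_family_on_def E_def\<close>)
  also have "\<dots> = (\<Sum>c\<in>range g. ennreal (c ^ DIM('a)) * emeasure lborel (E c \<inter> ball 0 1))"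
    by (rule sum.cong) (use nn scale in auto)
  also have "\<dots> = (\<Sum>c\<in>range g. \<integral>\<^sup>+x. ennreal (c ^ DIM('a)) * indicator (E c \<inter> ball 0 1) x \<partial>lborel)"
    by (rule sum.cong) (simp_all add: nn_integral_cmult_indicator)
  also have "\<dots> = (\<integral>\<^sup>+x. (\<Sum>c\<in>range g. ennreal (c ^ DIM('a)) * indicator (E c \<inter> ball 0 1) x) \<partial>lborel)"
    by (rule nn_integral_sum[symmetric]) measurable
  also have "\<dots> = (\<integral>\<^sup>+x. ennreal (g x ^ DIM('a)) * indicator (ball 0 1) x \<partial>lborel)"
  proof (rule nn_integral_cong)
    fix x
    have "(\<Sum>c\<in>range g. ennreal (c ^ DIM('a)) * indicator (E c \<inter> ball 0 1) x)
      = (\<Sum>c\<in>range g. if c = g x then ennreal (c ^ DIM('a)) * indicator (ball 0 1) x else 0)"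
      by (rule sum.cong) (auto simp: E_def indicator_def)
    also have "\<dots> = ennreal (g x ^ DIM('a)) * indicator (ball 0 1) x" using fin by simp
    finally show "(\<Sum>c\<in>range g. ennreal (c ^ DIM('a)) * indicator (E c \<inter> ball 0 1) x)
      = ennreal (g x ^ DIM('a)) * indicator (ball 0 1) x" .
  qed
  finally show ?thesis .
qed

lemma emeasure_star:
  fixes g :: "'a::euclidean_space \<Rightarrow> real"
  assumes g[measurable]: "g \<in> borel_measurable borel" and nn: "\<And>x. 0 \<le> g x"
    and hom: "\<And>c x. c > 0 \<Longrightarrow> g (c *\<^sub>R x) = g x"
  shows "emeasure lborel {x. norm x < g x} = (\<integral>\<^sup>+x. ennreal (g x ^ DIM('a)) * indicator (ball 0 1) x \<partial>lborel)"
proof -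
  \<comment> \<open>The simple functions are applied to the values of \<open>g\<close>, so that
    \<open>F i (g x)\<close> inherits the invariance under positive dilations.\<close>
  obtain F :: "nat \<Rightarrow> real \<Rightarrow> real" where F: "incseq F" "\<And>i. simple_function borel (F i)"
    "\<And>y. bdd_above (range (\<lambda>i. F i y))" "\<And>i y. 0 \<le> F i y" "(\<lambda>y. max 0 y) = (SUP i. F i)"
    using borel_measurable_implies_simple_function_sequence_real[of "\<lambda>y. max 0 y" borel] by auto
  have [measurable]: "F i \<in> borel_measurable borel" for i
    using F(2) by (rule borel_measurable_simple_function)
  have Flim: "(\<lambda>i. F i y) \<longlonglongrightarrow> y" if "y \<ge> 0" for y
  proof -
    have "(\<lambda>i. F i y) \<longlonglongrightarrow> (SUP i. F i y)"
      using F(1,3) by (intro LIMSEQ_incseq_SUP) (auto simp: incseq_def le_fun_def)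
    moreover have "(SUP i. F i y) = y" using fun_cong[OF F(5), of y] that by (simp add: image_image)
    ultimately show ?thesis by simp
  qed
  have Fle: "F i y \<le> y" if "y \<ge> 0" for i y
    using F(1) by (intro incseq_le[OF _ Flim[OF that]]) (auto simp: incseq_def le_fun_def)
  have eq: "emeasure lborel {x. norm x < F i (g x)} = (\<integral>\<^sup>+x. ennreal (F i (g x) ^ DIM('a)) * indicator (ball 0 1) x \<partial>lborel)" for i
  proof (rule emeasure_star_simple)
    have "finite (F i ` UNIV)" using simple_functionD(1)[OF F(2)[of i]] by simp
    then show "finite (range (\<lambda>x. F i (g x)))" by (rule finite_subset[rotated]) auto
  qed (use F(4) hom in auto)
  have "(\<lambda>i. emeasure lborel {x. norm x < F i (g x)}) \<longlonglongrightarrow> emeasure lborel (\<Union>i. {x. norm x < F i (g x)})"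
    using F(1) by (intro Lim_emeasure_incseq) (auto simp: incseq_def le_fun_def intro: less_le_trans)
  also have "(\<Union>i. {x. norm x < F i (g x)}) = {x. norm x < g x}"
  proof (intro set_eqI iffI)
    fix x assume "x \<in> {x. norm x < g x}"
    then have "\<forall>\<^sub>F i in sequentially. norm x < F i (g x)"
      using order_tendstoD(1)[OF Flim[OF nn[of x]]] by simp
    then obtain i where "norm x < F i (g x)"
      using eventually_happens'[OF sequentially_bot] by blast
    then show "x \<in> (\<Union>i. {x. norm x < F i (g x)})" by blast
  qed (use Fle nn in \<open>auto intro: less_le_trans\<close>)
  finally have 1: "(\<lambda>i. emeasure lborel {x. norm x < F i (g x)}) \<longlonglongrightarrow> emeasure lborel {x. norm x < g x}" .
  have "(\<lambda>i. \<integral>\<^sup>+x. ennreal (F i (g x) ^ DIM('a)) * indicator (ball 0 1) x \<partial>lborel)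
     \<longlonglongrightarrow> (\<integral>\<^sup>+x. ennreal (g x ^ DIM('a)) * indicator (ball 0 1) x \<partial>lborel)"
  proof (rule nn_integral_LIMSEQ)
    show "incseq (\<lambda>i x. ennreal (F i (g x) ^ DIM('a)) * indicator (ball (0::'a) 1) x)"
      using F(1,4) by (auto simp: incseq_def le_fun_def intro!: mult_right_mono ennreal_leI power_mono)
    fix x :: 'a
    show "(\<lambda>i. ennreal (F i (g x) ^ DIM('a)) * indicator (ball 0 1) x) \<longlonglongrightarrow> ennreal (g x ^ DIM('a)) * indicator (ball 0 1) x"
      by (cases "x \<in> ball 0 1") (auto intro!: tendsto_ennrealI tendsto_power Flim nn)
  qed measurable
  then show ?thesis by (rule LIMSEQ_unique[OF 1[unfolded eq]])
qed

lemma set_integrable_ball_bounded: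
  fixes F :: "'a::euclidean_space \<Rightarrow> real"
  assumes "F \<in> borel_measurable borel" "\<And>x. \<bar>F x\<bar> \<le> C"
  shows "set_integrable lborel (ball 0 1) F"
  unfolding set_integrable_def
  by (rule integrableI_bounded_set_indicator[where B = C])
    (use assms emeasure_lborel_ball_finite in auto)

lemma measure_star:
  fixes g :: "'a::euclidean_space \<Rightarrow> real"
  assumes [measurable]: "g \<in> borel_measurable borel" and nn: "\<And>x. 0 \<le> g x"
    and hom: "\<And>c x. c > 0 \<Longrightarrow> g (c *\<^sub>R x) = g x"
  shows "measure lborel {x. norm x < g x} = (LINT x:ball 0 1|lborel. g x ^ DIM('a))"
proof -
  have "(LINT x:ball 0 1|lborel. g x ^ DIM('a)) = enn2real (\<integral>\<^sup>+x. ennreal (indicator (ball 0 1) x *\<^sub>R g x ^ DIM('a)) \<partial>lborel)"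
    unfolding set_lebesgue_integral_def by (rule integral_eq_nn_integral) (measurable, use nn in auto)
  also have "(\<integral>\<^sup>+x. ennreal (indicator (ball 0 1) x *\<^sub>R g x ^ DIM('a)) \<partial>lborel)
      = (\<integral>\<^sup>+x. ennreal (g x ^ DIM('a)) * indicator (ball 0 1) x \<partial>lborel)"
    by (rule nn_integral_cong) (auto simp: indicator_def)
  also have "\<dots> = emeasure lborel {x. norm x < g x}" by (rule emeasure_star[OF assms, symmetric])
  finally show ?thesis by (simp add: measure_def)
qed

text \<open>An upper counterpart of the Bernoulli inequality. The crude constant
  \<open>3 ^ n\<close> only has to satisfy
  \<open>real n + 2 * 3 ^ n \<le> 3 ^ Suc n\<close>.\<close>

lemma power_one_plus_le:
  fixes y :: real
  assumes "\<bar>y\<bar> \<le> 1"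
  shows "(1 + y) ^ n \<le> 1 + real n * y + 3 ^ n * y\<^sup>2"
proof (induction n)
  case (Suc n)
  have "(1 + y) ^ Suc n \<le> (1 + y) * (1 + real n * y + 3 ^ n * y\<^sup>2)"
    using Suc assms by (simp add: mult_left_mono)
  also have "\<dots> = 1 + real (Suc n) * y + (real n + 3 ^ n) * y\<^sup>2 + 3 ^ n * (y * y\<^sup>2)"
    by (simp add: algebra_simps power2_eq_square)
  also have "y * y\<^sup>2 \<le> 1 * y\<^sup>2" using assms by (intro mult_right_mono) auto
  also have "1 + real (Suc n) * y + (real n + 3 ^ n) * y\<^sup>2 + 3 ^ n * (1 * y\<^sup>2)
     = 1 + real (Suc n) * y + (real n + 2 * 3 ^ n) * y\<^sup>2" by (simp add: algebra_simps)
  also have "(real n + 2 * 3 ^ n) * y\<^sup>2 \<le> 3 ^ Suc n * y\<^sup>2"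
  proof (rule mult_right_mono)
    have "n < 3 ^ n" by (induction n) auto
    then have "real n \<le> 3 ^ n" by (metis less_imp_le of_nat_le_iff of_nat_numeral of_nat_power)
    then show "real n + 2 * 3 ^ n \<le> 3 ^ Suc n" by simp
  qed simp
  finally show ?case by simp
qed simp

text \<open>This is the integral of the support function over the unit sphere, divided by the dimension, and
  hence \<open>unit_ball_vol (n - 1) / n\<close> times the first intrinsic volume.\<close>
definition directional_integral :: "'a::euclidean_space set \<Rightarrow> real" where
  "directional_integral K = (LINT x:ball 0 1|lborel. support_fun K (sgn x))"

lemma sgn_borel [measurable]: "(sgn :: 'a::euclidean_space \<Rightarrow> 'a) \<in> borel_measurable borel"
  unfolding sgn_div_norm[abs_def] by measurable

lemma norm_sgn_le: "norm (sgn x :: 'a::real_normed_vector) \<le> 1"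
  by (simp add: norm_sgn)

lemma support_fun_sgn_borel:
  assumes "compact (K :: 'a::euclidean_space set)" "K \<noteq> {}"
  shows "(\<lambda>x. support_fun K (sgn x)) \<in> borel_measurable borel"
  by (rule measurable_compose[OF sgn_borel borel_measurable_continuous_onI[OF continuous_on_support_fun[OF assms]]])

lemma support_fun_sgn_le:
  assumes "compact K" "K \<noteq> {}" "\<And>x. x \<in> K \<Longrightarrow> norm x \<le> D" "D \<ge> 0"
  shows "\<bar>support_fun K (sgn x)\<bar> \<le> D"
  using support_fun_abs_le[OF assms, of "sgn x"] mult_left_le[OF norm_sgn_le[of x] assms(4)] by simp

lemma set_integrable_support_fun:
  assumes "compact (K :: 'a::euclidean_space set)" "K \<noteq> {}"
  shows "set_integrable lborel (ball 0 1) (\<lambda>x. support_fun K (sgn x))"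
proof -
  obtain D where D: "D > 0" "\<And>x. x \<in> K \<Longrightarrow> norm x \<le> D" using compact_norm_bound[OF assms(1)] by blast
  show ?thesis
    by (rule set_integrable_ball_bounded[OF support_fun_sgn_borel[OF assms], of D])
      (use support_fun_sgn_le[OF assms D(2)] D(1) in auto)
qed

text \<open>Up to \<open>O(s\<^sup>2)\<close>, the set \<open>s K + B\<close> is star-shaped with radial function \<open>1 + s h\<close>, where \<open>h\<close> is the
  support function of \<open>K\<close>.\<close>
lemma measure_ball_plus_scaled:
  fixes K :: "'a::euclidean_space set"
  assumes K: "compact K" "K \<noteq> {}"
  obtains s0 C where "s0 > 0" "\<And>s. 0 < s \<Longrightarrow> s < s0 \<Longrightarrow>
    \<bar>measure lborel ((\<lambda>(y, b). s *\<^sub>R y + b) ` (K \<times> cball 0 1)) - measure lborel (ball (0::'a) 1)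
       - real DIM('a) * s * directional_integral K\<bar> \<le> C * s\<^sup>2"
proof -
  define n where "n = DIM('a)"
  define h where "h x = support_fun K (sgn x)" for x
  define vol where "vol = measure lborel (ball (0::'a) 1)"
  define I where "I = directional_integral K"
  obtain D where D: "D > 0" "\<And>x. x \<in> K \<Longrightarrow> norm x \<le> D" using compact_norm_bound[OF K(1)] by blast
  have hm[measurable]: "h \<in> borel_measurable borel" unfolding h_def by (rule support_fun_sgn_borel[OF K])
  have hD: "\<bar>h x\<bar> \<le> D" for x unfolding h_def using support_fun_sgn_le[OF K D(2)] D(1) by simp
  have hi: "set_integrable lborel (ball 0 1) h" unfolding h_def by (rule set_integrable_support_fun[OF K])
  have hh: "h (c *\<^sub>R x) = h x" if "c > 0" for c x using that by (simp add: h_def sgn_scaleR)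
  have ci: "set_integrable lborel (ball (0::'a) 1) (\<lambda>x. c)" for c :: real
    by (rule set_integrable_ball_bounded[of _ "\<bar>c\<bar>"]) auto
  have cI: "(LINT x:ball (0::'a) 1|lborel. c) = c * vol" for c :: real
    using emeasure_lborel_ball_finite[of "0::'a" 1] by (simp add: vol_def set_lebesgue_integral_def)
  have lin: "set_integrable lborel (ball 0 1) (\<lambda>x. a + c * h x)" "(LINT x:ball 0 1|lborel. a + c * h x) = a * vol + c * I" for a c
  proof -
    have i2: "set_integrable lborel (ball 0 1) (\<lambda>x. c * h x)" using hi by (rule set_integrable_mult_right)
    show "set_integrable lborel (ball 0 1) (\<lambda>x. a + c * h x)" using ci i2 by (rule set_integral_add(1))
    have "(LINT x:ball 0 1|lborel. a + c * h x) = (LINT x:ball (0::'a) 1|lborel. a) + (LINT x:ball 0 1|lborel. c * h x)"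
      using ci i2 by (rule set_integral_add(2))
    then show "(LINT x:ball 0 1|lborel. a + c * h x) = a * vol + c * I"
      by (simp add: cI I_def directional_integral_def h_def)
  qed
  \<comment> \<open>The sum of the second-order errors of the upper and the lower bound
    below.\<close>
  define C where "C = (real n + 3 ^ n * (D + 1)\<^sup>2 + real n * D\<^sup>2) * vol"
  have vol0: "vol \<ge> 0" by (simp add: vol_def)
  \<comment> \<open>Ensures \<open>s * (D + 1) < 1/2\<close>, so that \<open>g1\<close> and
    \<open>g2\<close> are nonnegative and \<open>power_one_plus_le\<close> applies.\<close>
  define s0 where "s0 = 1 / (2 * (D + 1))"
  have s0: "s0 > 0" using D(1) by (simp add: s0_def)
  show thesis
  proof (rule that[OF s0, of C])
    fix s assume s: "0 < s" "s < s0"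
    then have sD1: "s * (D + 1) < 1/2" using D(1) by (simp add: s0_def field_simps)
    have "s * (D + 1) = s * D + s" by (simp add: distrib_left)
    then have sD: "s * D < 1/2" "s < 1/2" using sD1 s(1) mult_pos_pos[OF s(1) D(1)] by linarith+
    have sh: "\<bar>s * h x\<bar> \<le> s * D" for x using hD[of x] s by (simp add: abs_mult)
    define a where "a = (s * D)\<^sup>2"
    have a: "0 \<le> a" "a \<le> 1/4" using sD s D(1) power_mono[of "s * D" "1/2" 2] by (auto simp: a_def power2_eq_square)
    define Q where "Q = (\<lambda>(y, b). s *\<^sub>R y + b) ` (K \<times> cball 0 1)"
    have "compact Q" unfolding Q_def split_beta
      by (intro compact_continuous_image compact_Times K compact_cball continuous_intros)
    then have Qf: "Q \<in> fmeasurable lborel" by (rule fmeasurable_compact)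
    \<comment> \<open>The square in \<open>g1\<close> makes the inequality strict on the closed set
      \<open>Q\<close>. The correction \<open>a\<close> in \<open>g2\<close> absorbs the length of
      the support point \<open>y\<close>: for |x| \<ge> s h, |x - s y|^2 = (|x| - s h)^2 + s^2 |y|^2
      - (s h)^2 is at most (1 - a)^2 + a \<le> 1.\<close>
    define g1 g2 where "g1 x = 1 + (s * h x + s\<^sup>2)" and "g2 x = 1 + (s * h x - a)" for x
    have gm[measurable]: "g1 \<in> borel_measurable borel" "g2 \<in> borel_measurable borel"
      unfolding g1_def g2_def by measurable
    have s2: "s\<^sup>2 \<le> s" "0 \<le> s\<^sup>2" using sD(2) s by (simp_all add: power2_eq_square)
    have gb: "0 \<le> g1 x" "g1 x \<le> 3" "0 \<le> g2 x" for x
      using sh[of x, unfolded abs_le_iff] sD s2 a unfolding g1_def g2_def by linarith+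
    have gh: "g1 (c *\<^sub>R x) = g1 x" "g2 (c *\<^sub>R x) = g2 x" if "c > 0" for c x using hh[OF that] by (simp_all add: g1_def g2_def)
    have "{x. norm x < g1 x} \<subseteq> ball 0 3" using gb(2) by (force intro: less_le_trans)
    then have g1f: "{x. norm x < g1 x} \<in> fmeasurable lborel"
    proof (rule fmeasurableI2[rotated])
      show "{x. norm x < g1 x} \<in> sets lborel" by measurable
      show "ball 0 3 \<in> fmeasurable lborel"
        using emeasure_lborel_ball_finite by (intro fmeasurableI) auto
    qed
    have Qsub: "Q \<subseteq> {x. norm x < g1 x}"
    proof
      fix x assume "x \<in> Q"
      then obtain y b where yb: "y \<in> K" "norm b \<le> 1" "x = s *\<^sub>R y + b" by (auto simp: Q_def)
      have "norm x = x \<bullet> sgn x"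
        by (cases "x = 0") (simp_all add: sgn_div_norm dot_square_norm power2_eq_square)
      also have "\<dots> = s * (y \<bullet> sgn x) + b \<bullet> sgn x" by (simp only: yb(3) inner_add_left inner_scaleR_left)
      also have "y \<bullet> sgn x \<le> h x"
        unfolding h_def by (rule support_fun_upper) (use K compact_imp_bounded yb in auto)
      also have "b \<bullet> sgn x \<le> norm b * norm (sgn x)" by (rule norm_cauchy_schwarz)
      also have "\<dots> \<le> 1 * 1" using yb(2) norm_sgn_le by (intro mult_mono) auto
      finally have "norm x \<le> s * h x + 1" using s by simp
      moreover have "s\<^sup>2 > 0" using s by simp
      ultimately show "x \<in> {x. norm x < g1 x}" unfolding g1_def mem_Collect_eq by linarith
    qed
    have subQ: "{x. norm x < g2 x} \<subseteq> Q"
    proof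
      fix x assume "x \<in> {x. norm x < g2 x}"
      then have x: "norm x < 1 + (s * h x - a)" by (simp add: g2_def)
      obtain y where y: "y \<in> K" "y \<bullet> sgn x = h x" unfolding h_def using support_fun_attained[OF K] by blast
      have "norm (x - s *\<^sub>R y) \<le> 1"
      proof (cases "norm x \<ge> s * h x")
        case True
        have xs: "x = norm x *\<^sub>R sgn x" by (cases "x = 0") (simp_all add: sgn_div_norm)
        have xy: "x \<bullet> y = norm x * h x" by (subst xs) (simp add: y(2)[symmetric] inner_commute)
        have "(norm (x - s *\<^sub>R y))\<^sup>2 = (norm x)\<^sup>2 - 2 * s * (x \<bullet> y) + s\<^sup>2 * (norm y)\<^sup>2"
          unfolding power2_norm_eq_inner
          by (simp add: inner_diff_left inner_diff_right inner_commute[of y x] power2_eq_square algebra_simps)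
        also have "\<dots> = (norm x - s * h x)\<^sup>2 + s\<^sup>2 * (norm y)\<^sup>2 - (s * h x)\<^sup>2"
          unfolding xy by (simp add: power2_eq_square algebra_simps)
        also have "(norm x - s * h x)\<^sup>2 \<le> (1 - a)\<^sup>2" using True x by (intro power_mono) auto
        also have "s\<^sup>2 * (norm y)\<^sup>2 \<le> a" using D(2)[OF y(1)] unfolding a_def power_mult_distrib
          by (intro mult_left_mono power_mono) auto
        also have "(1 - a)\<^sup>2 + a - (s * h x)\<^sup>2 \<le> 1"
        proof -
          have "a * a \<le> a * 1" using a by (intro mult_left_mono) auto
          then show ?thesis using zero_le_power2[of "s * h x"] by (simp add: power2_eq_square algebra_simps)
        qed
        finally have "(norm (x - s *\<^sub>R y))\<^sup>2 \<le> 1" by simp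
        then show ?thesis by (simp add: abs_square_le_1)
      next
        case False
        have "norm (x - s *\<^sub>R y) \<le> norm x + s * norm y" using norm_triangle_ineq4[of x "s *\<^sub>R y"] s by simp
        also have "s * norm y \<le> s * D" using D(2)[OF y(1)] s by simp
        finally show ?thesis using False sh[of x] sD by auto
      qed
      then show "x \<in> Q" unfolding Q_def using y(1) by (intro image_eqI[of _ _ "(y, x - s *\<^sub>R y)"]) auto
    qed
    have int1: "set_integrable lborel (ball 0 1) (\<lambda>x. g1 x ^ n)"
      by (rule set_integrable_ball_bounded[of _ "3 ^ n"]) (use gb in \<open>auto simp: power_mono\<close>)
    have "g2 x \<le> 3" for x using sh[of x] sD a unfolding g2_def by (auto simp: abs_le_iff)
    then have int2: "set_integrable lborel (ball 0 1) (\<lambda>x. g2 x ^ n)"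
      by (intro set_integrable_ball_bounded[of _ "3 ^ n"]) (use gb in \<open>auto simp: power_mono\<close>)
    have "measure lborel Q \<le> measure lborel {x. norm x < g1 x}"
      using Qsub Qf g1f by (intro measure_mono_fmeasurable) auto
    also have "\<dots> = (LINT x:ball 0 1|lborel. g1 x ^ n)" unfolding n_def by (rule measure_star) (use gm gb gh in auto)
    also have "\<dots> \<le> (LINT x:ball 0 1|lborel. (1 + (real n + 3 ^ n * (D + 1)\<^sup>2) * s\<^sup>2) + (real n * s) * h x)"
    proof (rule set_integral_mono[OF int1 lin(1)])
      fix x :: 'a
      define y where "y = s * h x + s\<^sup>2"
      have y1: "\<bar>y\<bar> \<le> s * (D + 1)"
        using sh[of x] s2 unfolding y_def distrib_left abs_le_iff by linarith
      then have "y\<^sup>2 \<le> (s * (D + 1))\<^sup>2" by (metis power2_abs power_mono abs_ge_zero)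
      then have "3 ^ n * y\<^sup>2 \<le> 3 ^ n * (s * (D + 1))\<^sup>2" by simp
      moreover have "(1 + y) ^ n \<le> 1 + real n * y + 3 ^ n * y\<^sup>2" by (rule power_one_plus_le) (use y1 sD1 in simp)
      moreover have "1 + real n * y + 3 ^ n * (s * (D + 1))\<^sup>2
          = (1 + (real n + 3 ^ n * (D + 1)\<^sup>2) * s\<^sup>2) + (real n * s) * h x"
        unfolding y_def power_mult_distrib by (simp add: algebra_simps)
      ultimately show "g1 x ^ n \<le> (1 + (real n + 3 ^ n * (D + 1)\<^sup>2) * s\<^sup>2) + (real n * s) * h x"
        unfolding g1_def y_def[symmetric] by linarith
    qed
    finally have up: "measure lborel Q \<le> (1 + (real n + 3 ^ n * (D + 1)\<^sup>2) * s\<^sup>2) * vol + real n * s * I"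
      unfolding lin(2) .
    have "(1 - real n * a) * vol + real n * s * I = (LINT x:ball 0 1|lborel. (1 - real n * a) + (real n * s) * h x)"
      unfolding lin(2) by simp
    also have "\<dots> \<le> (LINT x:ball 0 1|lborel. g2 x ^ n)"
    proof (rule set_integral_mono[OF lin(1) int2])
      fix x :: 'a
      have "1 + real n * (s * h x - a) \<le> g2 x ^ n" unfolding g2_def
        by (rule Bernoulli_inequality) (use gb(3)[of x] in \<open>simp add: g2_def\<close>)
      then show "(1 - real n * a) + (real n * s) * h x \<le> g2 x ^ n" by (simp add: algebra_simps)
    qed
    also have "\<dots> = measure lborel {x. norm x < g2 x}" unfolding n_def by (rule measure_star[symmetric]) (use gm gb gh in auto)
    also have "\<dots> \<le> measure lborel Q" using subQ Qf by (intro measure_mono_fmeasurable) auto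
    finally have lo: "(1 - real n * a) * vol + real n * s * I \<le> measure lborel Q" .
    have "real n * a * vol \<le> C * s\<^sup>2" "(real n + 3 ^ n * (D + 1)\<^sup>2) * s\<^sup>2 * vol \<le> C * s\<^sup>2"
      using vol0 by (auto simp: C_def a_def power_mult_distrib algebra_simps)
    then show "\<bar>measure lborel ((\<lambda>(y, b). s *\<^sub>R y + b) ` (K \<times> cball 0 1)) - measure lborel (ball (0::'a) 1)
       - real DIM('a) * s * directional_integral K\<bar> \<le> C * s\<^sup>2"
      using up lo unfolding Q_def[symmetric] vol_def[symmetric] I_def[symmetric] n_def[symmetric]
      by (simp add: algebra_simps abs_le_iff)
  qed
qed


section \<open>The first intrinsic volume\<close>

lemma polynomial_coefficients_zero:
  fixes e :: "nat \<Rightarrow> real"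
  assumes "\<And>x. x > 0 \<Longrightarrow> (\<Sum>i\<le>n. e i * x ^ i) = 0" "k \<le> n"
  shows "e k = 0"
proof (rule ccontr)
  assume "e k \<noteq> 0"
  then have "finite {x. (\<Sum>i\<le>n. e i * x ^ i) = 0}" using polyfun_roots_finite[OF _ assms(2)] by blast
  moreover have "{0<..} \<subseteq> {x. (\<Sum>i\<le>n. e i * x ^ i) = 0}" using assms(1) by auto
  ultimately have "finite {0::real<..}" by (rule finite_subset[rotated])
  then show False by (simp add: infinite_Ioi)
qed

text \<open>The constant terms are identified first, by letting \<open>s\<close> tend to 0; only
  then can the estimate be divided by \<open>s\<close>.\<close>

lemma polynomial_linear_coefficient:
  fixes e :: "nat \<Rightarrow> real"
  assumes n: "n \<ge> 1" and s0: "s0 > 0"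
    and le: "\<And>s. 0 < s \<Longrightarrow> s < s0 \<Longrightarrow> \<bar>(\<Sum>i\<le>n. e i * s ^ i) - a - b * s\<bar> \<le> C * s\<^sup>2"
  shows "e 1 = b"
proof -
  obtain m where m: "n = Suc m" using n by (cases n) auto
  define q where "q s = (\<Sum>i\<le>m. e (Suc i) * s ^ i)" for s
  have split: "(\<Sum>i\<le>n. e i * s ^ i) = e 0 + s * q s" for s
    unfolding m sum.atMost_Suc_shift q_def sum_distrib_left by (simp add: algebra_simps)
  have q0: "q 0 = e 1"
  proof -
    have "q 0 = (\<Sum>i\<le>m. if i = 0 then e 1 else 0)" unfolding q_def by (rule sum.cong) auto
    then show ?thesis by simp
  qed
  have "(q \<longlongrightarrow> q 0) (at_right 0)" unfolding q_def by (intro tendsto_intros)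
  then have ql: "(q \<longlongrightarrow> e 1) (at_right 0)" using q0 by simp
  have id: "((\<lambda>s. s) \<longlongrightarrow> 0) (at_right (0::real))" by (rule tendsto_ident_at)
  have ev: "\<forall>\<^sub>F s in at_right 0. 0 < s \<and> s < s0"
    by (rule eventually_at_rightI[of 0 s0]) (use s0 in auto)
  have nb: "at_right (0::real) \<noteq> bot" by simp
  have e0: "e 0 = a"
  proof -
    have "((\<lambda>s. (e 0 + s * q s) - a - b * s) \<longlongrightarrow> (e 0 + 0 * e 1) - a - b * 0) (at_right 0)"
      by (intro tendsto_intros ql id)
    moreover have "((\<lambda>s. (e 0 + s * q s) - a - b * s) \<longlongrightarrow> 0) (at_right 0)"
    proof (rule Lim_null_comparison)
      show "\<forall>\<^sub>F s in at_right 0. norm ((e 0 + s * q s) - a - b * s) \<le> C * s\<^sup>2"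
        using ev by eventually_elim (use le split in auto)
      have "((\<lambda>s. C * s\<^sup>2) \<longlongrightarrow> C * 0\<^sup>2) (at_right 0)" by (intro tendsto_intros id)
      then show "((\<lambda>s. C * s\<^sup>2) \<longlongrightarrow> 0) (at_right 0)" by simp
    qed
    ultimately have "(e 0 + 0 * e 1) - a - b * 0 = 0" by (rule tendsto_unique[OF nb])
    then show ?thesis by simp
  qed
  have "((\<lambda>s. q s - b) \<longlongrightarrow> e 1 - b) (at_right 0)" by (intro tendsto_intros ql)
  moreover have "((\<lambda>s. q s - b) \<longlongrightarrow> 0) (at_right 0)"
  proof (rule Lim_null_comparison)
    show "\<forall>\<^sub>F s in at_right 0. norm (q s - b) \<le> C * s"
      using ev
    proof eventually_elim
      case (elim s)
      have "\<bar>s * (q s - b)\<bar> \<le> s * (C * s)"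
        using le[of s] elim unfolding split e0 by (simp add: algebra_simps power2_eq_square)
      then show ?case using elim by (simp add: abs_mult)
    qed
    have "((\<lambda>s. C * s) \<longlongrightarrow> C * 0) (at_right 0)" by (intro tendsto_intros id)
    then show "((\<lambda>s. C * s) \<longlongrightarrow> 0) (at_right 0)" by simp
  qed
  ultimately have "e 1 - b = 0" by (rule tendsto_unique[OF nb])
  then show ?thesis by simp
qed

lemma sum_rev_poly:
  fixes c :: "nat \<Rightarrow> real"
  shows "(\<Sum>j=0..n. c (n - j) * x ^ (n - j)) = (\<Sum>i\<le>n. c i * x ^ i)"
  using sum.atLeastAtMost_rev[of "\<lambda>i. c i * x ^ i" 0 n] by (simp add: atMost_atLeast0)

text \<open>Gives the definite description in \<open>intrinsic_volume\<close> a value: any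
  polynomial expansion of the parallel volume provides a solution, and two solutions define the same
  polynomial on the positive reals.\<close>

lemma intrinsic_volume_eq:
  fixes K :: "'a::euclidean_space set"
  assumes K: "compact K" "convex K" "K \<noteq> {}"
    and c: "\<And>s. s > 0 \<Longrightarrow> parallel_volume K s = (\<Sum>i\<le>DIM('a). c i * s ^ i)"
    and j: "j \<le> DIM('a)"
  shows "unit_ball_vol (real (DIM('a) - j)) * intrinsic_volume j K = c (DIM('a) - j)"
proof -
  let ?n = "DIM('a)"
  define V where "V j = (if j \<le> ?n then c (?n - j) / unit_ball_vol (real (?n - j)) else 0)" for j
  have leb: "measure lebesgue (K + (\<lambda>b. s *\<^sub>R b) ` cball 0 1) = parallel_volume K s" for s
    using borel_compact[OF compact_set_plus_scaled_cball[OF K(1), of s]] by (intro measure_completion) simp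
  have pos: "unit_ball_vol (real k) \<noteq> 0" for k using unit_ball_vol_pos[of "real k"] by linarith
  have st: "steiner_coeffs K V"
    unfolding steiner_coeffs_def
  proof (intro allI impI)
    fix \<epsilon> :: real assume e: "\<epsilon> > 0"
    have "(\<Sum>j=0..?n. unit_ball_vol (real (?n - j)) * V j * \<epsilon> ^ (?n - j)) = (\<Sum>j=0..?n. c (?n - j) * \<epsilon> ^ (?n - j))"
    proof (rule sum.cong)
      fix j assume "j \<in> {0..?n}"
      then show "unit_ball_vol (real (?n - j)) * V j * \<epsilon> ^ (?n - j) = c (?n - j) * \<epsilon> ^ (?n - j)"
        using pos[of "?n - j"] by (simp add: V_def del: of_nat_diff)
    qed simp
    then show "measure lebesgue (K + (\<lambda>b. \<epsilon> *\<^sub>R b) ` cball 0 1) =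
        (\<Sum>j=0..?n. unit_ball_vol (real (?n - j)) * V j * \<epsilon> ^ (?n - j))"
      using c[OF e] by (simp only: leb sum_rev_poly)
  qed
  have uniq: "V' = V" if V': "steiner_coeffs K V'" "\<forall>i>?n. V' i = 0" for V'
  proof
    fix j
    show "V' j = V j"
    proof (cases "j \<le> ?n")
      case True
      define e where "e i = unit_ball_vol (real i) * V' (?n - i) - c i" for i
      have "(\<Sum>i\<le>?n. e i * x ^ i) = 0" if x: "x > 0" for x
      proof -
        have "(\<Sum>i\<le>?n. (unit_ball_vol (real i) * V' (?n - i)) * x ^ i)
            = (\<Sum>j=0..?n. unit_ball_vol (real (?n - j)) * V' j * x ^ (?n - j))"
          unfolding sum_rev_poly[symmetric] by (rule sum.cong) auto
        also have "\<dots> = parallel_volume K x" using V'(1) x leb by (simp add: steiner_coeffs_def)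
        finally show ?thesis unfolding e_def left_diff_distrib sum_subtractf c[OF x] by simp
      qed
      then have "e (?n - j) = 0" by (rule polynomial_coefficients_zero[OF _ diff_le_self])
      then show ?thesis using True pos[of "?n - j"] by (simp add: e_def V_def field_simps)
    next
      case False
      then show ?thesis using V'(2) by (simp add: V_def)
    qed
  qed
  have "(THE V. steiner_coeffs K V \<and> (\<forall>i>?n. V i = 0)) = V"
  proof (rule the_equality)
    show "steiner_coeffs K V \<and> (\<forall>i>?n. V i = 0)" using st by (simp add: V_def)
  qed (use uniq in blast)
  then show ?thesis using j pos[of "?n - j"] by (simp add: intrinsic_volume_def V_def)
qed

text \<open>Dilation by \<open>s\<close> turns the parallel body at radius \<open>1/s\<close> into s
  K + B and reverses the order of the coefficients, so the one belonging to the first intrinsic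
  volume becomes the linear one.\<close>

lemma intrinsic_volume_1:
  fixes K :: "'a::euclidean_space set"
  assumes K: "compact K" "convex K" "K \<noteq> {}"
  shows "unit_ball_vol (real (DIM('a) - 1)) * intrinsic_volume 1 K = real DIM('a) * directional_integral K"
proof -
  let ?n = "DIM('a)"
  have n1: "?n \<ge> 1" using DIM_positive[where 'a = 'a] by linarith
  obtain c where c: "\<And>s. s > 0 \<Longrightarrow> parallel_volume K s = (\<Sum>i\<le>?n. c i * s ^ i)"
    using parallel_volume_polynomial[OF K] by blast
  define Q where "Q s = (\<lambda>(y, b). s *\<^sub>R y + b) ` (K \<times> cball 0 1)" for s
  obtain s0 C where s0: "s0 > 0" and Q0: "\<And>s. 0 < s \<Longrightarrow> s < s0 \<Longrightarrow>
    \<bar>measure lborel ((\<lambda>(y, b). s *\<^sub>R y + b) ` (K \<times> cball 0 1)) - measure lborel (ball (0::'a) 1) - real ?n * s * directional_integral K\<bar> \<le> C * s\<^sup>2"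
    using measure_ball_plus_scaled[OF K(1,3)] by blast
  note Q = Q0[folded Q_def]
  have mQ: "measure lborel (Q s) = (\<Sum>i\<le>?n. c (?n - i) * s ^ i)" if s: "s > 0" for s
  proof -
    let ?A = "K + (\<lambda>b. (1/s) *\<^sub>R b) ` cball 0 1"
    have Qs: "Q s = (\<lambda>x. s *\<^sub>R x + 0) ` ?A"
    proof (intro set_eqI iffI)
      fix x assume "x \<in> Q s"
      then obtain y b where yb: "y \<in> K" "b \<in> cball 0 1" "x = s *\<^sub>R y + b" by (auto simp: Q_def)
      have "y + (1/s) *\<^sub>R b \<in> ?A" using yb by (intro set_plus_intro imageI)
      moreover have "x = s *\<^sub>R (y + (1/s) *\<^sub>R b) + 0" using s yb(3) by (simp add: scaleR_add_right)
      ultimately show "x \<in> (\<lambda>x. s *\<^sub>R x + 0) ` ?A" by blast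
    next
      fix x assume "x \<in> (\<lambda>x. s *\<^sub>R x + 0) ` ?A"
      then obtain y b where yb: "y \<in> K" "b \<in> cball 0 1" "x = s *\<^sub>R (y + (1/s) *\<^sub>R b)" by (auto simp: set_plus_def)
      then have "x = s *\<^sub>R y + b" using s by (simp add: scaleR_add_right)
      then show "x \<in> Q s" unfolding Q_def using yb(1,2) by (intro image_eqI[of _ _ "(y, b)"]) auto
    qed
    have cA: "compact ?A" by (rule compact_set_plus_scaled_cball[OF K(1)])
    have cQ: "compact (Q s)" unfolding Qs by (intro compact_continuous_image cA continuous_intros)
    have "measure lborel (Q s) = measure lebesgue (Q s)"
      by (rule measure_completion[symmetric]) (simp add: borel_compact cQ)
    also have "\<dots> = \<bar>s\<bar> ^ ?n * measure lebesgue ?A" unfolding Qs by (rule measure_lebesgue_affine)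
    also have "measure lebesgue ?A = parallel_volume K (1/s)"
      by (rule measure_completion) (simp add: borel_compact cA)
    also have "\<bar>s\<bar> ^ ?n * parallel_volume K (1/s) = (\<Sum>i\<le>?n. c i * s ^ (?n - i))"
      unfolding c[OF divide_pos_pos[OF zero_less_one s]] sum_distrib_left
      by (rule sum.cong) (use s in \<open>simp_all add: power_divide power_diff\<close>)
    also have "\<dots> = (\<Sum>i\<le>?n. c (?n - i) * s ^ i)"
      using sum.atLeastAtMost_rev[of "\<lambda>i. c i * s ^ (?n - i)" 0 ?n] by (simp add: atMost_atLeast0)
    finally show ?thesis .
  qed
  have "c (?n - 1) = real ?n * directional_integral K"
    by (rule polynomial_linear_coefficient[OF n1 s0, of "\<lambda>i. c (?n - i)" "measure lborel (ball (0::'a) 1)" _ C])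
      (use Q mQ in \<open>simp add: mult_ac\<close>)
  then show ?thesis using intrinsic_volume_eq[OF K c n1] by simp
qed

section \<open>Invariance and strict monotonicity of the directional integral\<close>

lemma LINT_ball_orthogonal:
  fixes F :: "'a::euclidean_space \<Rightarrow> real" and f :: "'a \<Rightarrow> 'a"
  assumes f: "orthogonal_transformation f" and F[measurable]: "F \<in> borel_measurable borel"
  shows "(LINT x:ball 0 1|lborel. F (f x)) = (LINT x:ball 0 1|lborel. F x)"
proof -
  have lin: "linear f" using f by (simp add: orthogonal_transformation_def)
  have fm[measurable]: "f \<in> borel_measurable borel"
    using lin by (simp add: borel_measurable_continuous_onI linear_continuous_on linear_conv_bounded_linear)
  have "(LINT x:ball 0 1|lborel. F x) = integral\<^sup>L (distr lborel borel f) (\<lambda>x. indicator (ball 0 1) x *\<^sub>R F x)"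
    unfolding lborel_distr_orthogonal[OF f] set_lebesgue_integral_def ..
  also have "\<dots> = integral\<^sup>L lborel (\<lambda>x. indicator (ball 0 1) (f x) *\<^sub>R F (f x))"
    by (rule integral_distr) measurable
  also have "\<dots> = (LINT x:ball 0 1|lborel. F (f x))"
    unfolding set_lebesgue_integral_def
    by (rule Bochner_Integration.integral_cong) (use f in \<open>auto simp: indicator_def orthogonal_transformation_norm\<close>)
  finally show ?thesis by simp
qed

lemma sgn_orthogonal_transformation:
  assumes "orthogonal_transformation f"
  shows "sgn (f x) = f (sgn x)"
  using assms by (simp add: sgn_div_norm orthogonal_transformation_norm orthogonal_transformation_def linear_scale)

lemma orthogonal_transformation_uminus: "orthogonal_transformation (uminus :: 'a::euclidean_space \<Rightarrow> 'a)"
  by (simp add: orthogonal_transformation_def linear_uminus)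

lemma directional_integral_orthogonal_image:
  fixes K :: "'a::euclidean_space set" and f :: "'a \<Rightarrow> 'a"
  assumes f: "orthogonal_transformation f" and K: "compact K" "K \<noteq> {}"
  shows "directional_integral (f ` K) = directional_integral K"
proof -
  have "linear f" using f by (simp add: orthogonal_transformation_def)
  then have "compact (f ` K)"
    by (intro compact_continuous_image K(1) linear_continuous_on) (simp add: linear_conv_bounded_linear)
  then have m: "(\<lambda>x. support_fun (f ` K) (sgn x)) \<in> borel_measurable borel"
    using K(2) by (intro support_fun_sgn_borel) auto
  have "directional_integral (f ` K) = (LINT x:ball 0 1|lborel. support_fun (f ` K) (sgn (f x)))"
    unfolding directional_integral_def by (rule LINT_ball_orthogonal[OF f m, symmetric])
  also have "\<dots> = directional_integral K"
    unfolding directional_integral_def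
    by (simp add: sgn_orthogonal_transformation[OF f] support_fun_orthogonal_image[OF f])
  finally show ?thesis .
qed

text \<open>The added term \<open>z \<bullet> sgn x\<close> is odd, so its integral over the ball
  vanishes.\<close>

lemma directional_integral_translation:
  fixes K :: "'a::euclidean_space set"
  assumes K: "compact K" "K \<noteq> {}"
  shows "directional_integral ((+) z ` K) = directional_integral K"
proof -
  have m: "(\<lambda>x. z \<bullet> sgn x) \<in> borel_measurable borel" by measurable
  have "\<bar>z \<bullet> sgn x\<bar> \<le> norm z" for x
    using Cauchy_Schwarz_ineq2[of z "sgn x"] mult_left_le[OF norm_sgn_le[of x] norm_ge_zero[of z]] by linarith
  then have i: "set_integrable lborel (ball 0 1) (\<lambda>x. z \<bullet> sgn x)"
    by (rule set_integrable_ball_bounded[OF m])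
  have "(LINT x:ball 0 1|lborel. z \<bullet> sgn (- x)) = (LINT x:ball 0 1|lborel. z \<bullet> sgn x)"
    by (rule LINT_ball_orthogonal[OF orthogonal_transformation_uminus m])
  moreover have "(LINT x:ball 0 1|lborel. z \<bullet> sgn (- x)) = - (LINT x:ball 0 1|lborel. z \<bullet> sgn x)"
    by (simp add: sgn_minus set_lebesgue_integral_def)
  ultimately have 0: "(LINT x:ball 0 1|lborel. z \<bullet> sgn x) = 0" by simp
  have "directional_integral ((+) z ` K) = (LINT x:ball 0 1|lborel. z \<bullet> sgn x + support_fun K (sgn x))"
    by (simp add: directional_integral_def support_fun_translation[OF K])
  also have "\<dots> = (LINT x:ball 0 1|lborel. z \<bullet> sgn x) + directional_integral K"
    unfolding directional_integral_def by (rule set_integral_add(2)[OF i set_integrable_support_fun[OF K]])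
  finally show ?thesis using 0 by simp
qed

text \<open>The zero set is closed and contains almost every point of the open unit ball, hence the
  whole ball; homogeneity reaches every \<open>v\<close>. An equality of integrals thus becomes
  usable at single directions such as the contact normals.\<close>

lemma eq_zero_of_LINT_ball_sgn_eq_zero:
  fixes F :: "'a::euclidean_space \<Rightarrow> real"
  assumes cont: "continuous_on UNIV F" and hom: "\<And>c x. c \<ge> 0 \<Longrightarrow> F (c *\<^sub>R x) = c * F x"
    and nn: "\<And>x. F x \<ge> 0" and zero: "(LINT x:ball 0 1|lborel. F (sgn x)) = 0"
  shows "F v = 0"
proof -
  have [measurable]: "F \<in> borel_measurable borel" using cont by (rule borel_measurable_continuous_onI)
  have "compact (F ` cball 0 1)"
    using compact_continuous_image[OF continuous_on_subset[OF cont]] by auto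
  then have "bounded (F ` cball 0 1)" by (rule compact_imp_bounded)
  then obtain C where C: "\<forall>y\<in>F ` cball 0 1. \<bar>y\<bar> \<le> C" unfolding bounded_real by blast
  have "\<bar>F (sgn x)\<bar> \<le> C" for x using C norm_sgn_le[of x] by simp
  then have "set_integrable lborel (ball 0 1) (\<lambda>x. F (sgn x))"
    by (intro set_integrable_ball_bounded[of _ C]) auto
  then have int: "integrable lborel (\<lambda>x. indicator (ball 0 1) x *\<^sub>R F (sgn x))"
    by (simp add: set_integrable_def)
  have AE: "AE x in lborel. indicator (ball 0 1) x *\<^sub>R F (sgn x) = 0"
    using zero integral_nonneg_eq_0_iff_AE[OF int] nn unfolding set_lebesgue_integral_def by auto
  have Fx: "F x = norm x * F (sgn x)" for x
    using hom[of "norm x" "sgn x"] by (cases "x = 0") (use hom[of 0 x] in \<open>simp_all add: sgn_div_norm\<close>)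
  have "AE x in lborel. x \<in> ball 0 1 \<longrightarrow> x \<in> {x. F x = 0}"
    using AE
  proof eventually_elim
    case (elim x)
    then show ?case using Fx[of x] by (auto simp: indicator_def)
  qed
  then have AE': "AE x\<in>ball 0 1 in lebesgue. x \<in> {x. F x = 0}" by (rule AE_completion)
  have "closed {x. F x = 0}" using continuous_closed_vimage[of "{0}" F] cont
    by (simp add: vimage_def continuous_on_eq_continuous_at)
  then have b: "F x = 0" if "x \<in> ball 0 1" for x
    using mem_closed_if_AE_lebesgue_open[OF open_ball _ AE' that] by simp
  define t where "t = 1 / (norm v + 1)"
  have np: "norm v + 1 > 0" using norm_ge_zero[of v] by linarith
  then have t: "t > 0" by (simp add: t_def)
  have "t *\<^sub>R v \<in> ball 0 1" using np by (simp add: t_def)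
  from b[OF this] show ?thesis using hom[of t v] t by simp
qed

text \<open>The difference of the support functions is nonnegative with integral zero, so the
  support functions agree.\<close>

lemma directional_integral_strict_mono:
  fixes K L :: "'a::euclidean_space set"
  assumes K: "compact K" "convex K" "K \<noteq> {}" and L: "compact L" and sub: "K \<subseteq> L"
    and eq: "directional_integral K = directional_integral L"
  shows "K = L"
proof -
  have L0: "L \<noteq> {}" and bL: "bounded L" using sub K(3) L compact_imp_bounded by auto
  define F where "F v = support_fun L v - support_fun K v" for v
  have "F v = 0" for v
  proof (rule eq_zero_of_LINT_ball_sgn_eq_zero[of F])
    show "continuous_on UNIV F" unfolding F_def
      by (intro continuous_on_diff continuous_on_support_fun K L L0)
    show "F (c *\<^sub>R x) = c * F x" if "c \<ge> 0" for c x
      using that by (simp add: F_def support_fun_scale[OF K(1,3)] support_fun_scale[OF L L0] algebra_simps)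
    show "F x \<ge> 0" for x using support_fun_mono[OF sub K(3) bL] by (simp add: F_def)
    show "(LINT x:ball 0 1|lborel. F (sgn x)) = 0"
      unfolding F_def set_integral_diff(2)[OF set_integrable_support_fun[OF L L0] set_integrable_support_fun[OF K(1,3)]]
      using eq by (simp add: directional_integral_def)
  qed
  then have "L \<subseteq> K" by (intro support_fun_determines[OF K bL]) (simp add: F_def)
  then show ?thesis using sub by simp
qed


section \<open>The extremal property of lenses\<close>

lemma compact_lens: "compact (lens R \<rho> u)"
  by (intro compact_Int compact_cball)

lemma translation_lens:
  "(+) z ` lens R \<rho> u = cball (z + \<rho> *\<^sub>R u) R \<inter> cball (z + - (\<rho> *\<^sub>R u)) R"
  by (simp add: image_Int[of "(+) z"] cball_translation[symmetric]) (simp add: add.commute)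

lemma lens_nonempty: "norm u = 1 \<Longrightarrow> 0 \<le> \<rho> \<Longrightarrow> \<rho> < R \<Longrightarrow> lens R \<rho> u \<noteq> {}"
  by (rule ex_in_conv[THEN iffD1], rule exI[of _ 0]) simp

lemma directional_integral_lens_eq:
  fixes u u' :: "'a::euclidean_space"
  assumes "norm u = 1" "norm u' = 1" "0 \<le> \<rho>" "\<rho> < R"
  shows "directional_integral (lens R \<rho> u) = directional_integral (lens R \<rho> u')"
proof -
  obtain f where f: "orthogonal_transformation f" "f u = u'"
    using orthogonal_transformation_between_units[OF assms(1,2)] by blast
  have lin: "linear f" and inj: "inj f"
    using f by (simp_all add: orthogonal_transformation_def orthogonal_transformation_inj)
  have cb: "f ` cball c r = cball (f c) r" for c r by (rule image_orthogonal_transformation_cball[OF f(1)])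
  have "f ` lens R \<rho> u = lens R \<rho> u'"
    by (simp add: image_Int[OF inj] cb linear_scale[OF lin] linear_neg[OF lin] f(2))
  then show ?thesis
    using directional_integral_orthogonal_image[OF f(1) compact_lens lens_nonempty[OF assms(1,3,4)]] by simp
qed

text \<open>A ball of radius \<open>r\<close> in the lens has its centre within \<open>R - r\<close>
  of both \<open>a\<close> and \<open>b\<close>, so half their distance is at most
  \<open>R - r\<close>, with equality for the largest ball about the midpoint. The inradius thus
  fixes the lens up to congruence.\<close>

lemma lam_convex_lens_normal_form:
  fixes L :: "'a::euclidean_space set"
  assumes lam: "lam > 0" and L: "lam_convex_lens lam L"
  obtains m u where "norm u = 1" "0 \<le> 1 / lam - inradius L" "1 / lam - inradius L < 1 / lam"
    "L = (+) m ` lens (1 / lam) (1 / lam - inradius L) u"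
proof -
  define R where "R = 1 / lam"
  have R: "R > 0" using lam by (simp add: R_def)
  obtain a b where ab: "L = cball a R \<inter> cball b R" and cb: "convex_body L"
    using L by (auto simp: lam_convex_lens_def R_def)
  define m where "m = (1/2) *\<^sub>R (a + b)"
  define d where "d = (1/2) *\<^sub>R (a - b)"
  define \<rho> where "\<rho> = norm d"
  have amb: "a = m + d" "b = m - d" by (simp_all add: m_def d_def algebra_simps flip: scaleR_add_left)
  obtain e :: 'a where e: "e \<in> Basis" using nonempty_Basis by blast
  obtain u where u: "norm u = 1" "d = \<rho> *\<^sub>R u"
  proof (cases "d = 0")
    \<comment> \<open>The two balls coincide and the axis is arbitrary.\<close>
    case True then show ?thesis using that[of e] e by (simp add: \<rho>_def)
  next
    case False then show ?thesis using that[of "sgn d"] by (simp add: \<rho>_def norm_sgn sgn_div_norm)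
  qed
  have \<rho>R: "\<rho> < R"
  proof (rule ccontr)
    assume "\<not> \<rho> < R"
    \<comment> \<open>By the parallelogram law, centres this far apart leave at most the midpoint,
      contrary to the nonempty interior.\<close>
    have "L \<subseteq> {m}"
    proof
      fix x assume "x \<in> L"
      then have "norm ((x - m) - d) \<le> R" "norm ((x - m) + d) \<le> R"
        by (auto simp: ab amb dist_norm norm_minus_commute algebra_simps)
      then have "(norm ((x - m) - d))\<^sup>2 \<le> R\<^sup>2" "(norm ((x - m) + d))\<^sup>2 \<le> R\<^sup>2" by (simp_all add: power_mono)
      moreover have "(norm ((x - m) - d))\<^sup>2 + (norm ((x - m) + d))\<^sup>2 = 2 * (norm (x - m))\<^sup>2 + 2 * \<rho>\<^sup>2"
        unfolding \<rho>_def power2_norm_eq_inner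
        by (simp only: inner_add_left inner_add_right inner_diff_left[of "x - m" d] inner_diff_right[of _ "x - m" d])
      moreover have "R\<^sup>2 \<le> \<rho>\<^sup>2" using \<open>\<not> \<rho> < R\<close> R by (simp add: power_mono)
      ultimately have "(norm (x - m))\<^sup>2 \<le> 0" by linarith
      then show "x \<in> {m}" by simp
    qed
    then have "interior L \<subseteq> interior {m}" by (rule interior_mono)
    then show False using cb by (simp add: convex_body_def)
  qed
  have "inradius L = R - \<rho>"
  proof (rule inradius_eqI)
    show "0 < R - \<rho>" using \<rho>R by simp
    show "cball m (R - \<rho>) \<subseteq> L"
      by (simp add: ab cball_subset_cball_iff amb dist_norm \<rho>_def)
    fix c r assume r: "0 < r" "cball c r \<subseteq> L"
    then have "dist c a + r \<le> R" "dist c b + r \<le> R" by (auto simp: ab cball_subset_cball_iff)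
    moreover have "dist a b \<le> dist c a + dist c b" by (metis dist_commute dist_triangle)
    moreover have "dist a b = 2 * \<rho>" by (simp add: amb dist_norm \<rho>_def flip: scaleR_2)
    ultimately show "r \<le> R - \<rho>" by linarith
  qed
  then have \<rho>: "\<rho> = R - inradius L" by simp
  have eq: "L = (+) m ` lens R \<rho> u"
    unfolding translation_lens by (simp add: ab amb u(2)[symmetric])
  have "0 \<le> \<rho>" by (simp add: \<rho>_def)
  then show thesis
    using that[OF u(1), of m] \<rho>R eq unfolding \<rho> R_def by blast
qed

lemma directional_integral_lam_convex_lens:
  fixes L :: "'a::euclidean_space set" and u :: 'a
  assumes "lam > 0" "lam_convex_lens lam L" "norm u = 1"
  shows "directional_integral L = directional_integral (lens (1 / lam) (1 / lam - inradius L) u)"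
proof -
  obtain m v where v: "norm v = 1" "0 \<le> 1 / lam - inradius L" "1 / lam - inradius L < 1 / lam"
    "L = (+) m ` lens (1 / lam) (1 / lam - inradius L) v"
    by (rule lam_convex_lens_normal_form[OF assms(1,2)])
  have "directional_integral L = directional_integral (lens (1 / lam) (1 / lam - inradius L) v)"
    using arg_cong[OF v(4), of directional_integral]
    unfolding directional_integral_translation[OF compact_lens lens_nonempty[OF v(1-3)]] .
  also note directional_integral_lens_eq[OF v(1) assms(3) v(2,3)]
  finally show ?thesis .
qed

lemma directional_integral_le_lens:
  fixes K :: "'a::euclidean_space set" and e :: 'a
  assumes dim: "DIM('a) \<ge> 2" and lam: "lam > 0" and K: "lam_convex_body lam K" and e: "norm e = 1"
  shows "directional_integral K \<le> directional_integral (lens (1 / lam) (1 / lam - inradius K) e)"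
    and "directional_integral K = directional_integral (lens (1 / lam) (1 / lam - inradius K) e) \<Longrightarrow> lam_convex_lens lam K"
proof -
  define R where "R = 1 / lam"
  define \<rho> where "\<rho> = R - inradius K"
  obtain z S w where S0: "finite S" "S \<noteq> {}" "\<forall>u\<in>S. norm u = 1" "\<forall>u\<in>S. w u > (0::real)"
    "sum w S = 1" "(\<Sum>u\<in>S. w u *\<^sub>R u) = 0" "cball z (inradius K) \<subseteq> K" "inradius K \<le> R"
    "\<forall>u\<in>S. K \<subseteq> cball (z - \<rho> *\<^sub>R u) R"
    unfolding R_def \<rho>_def by (rule lam_convex_body_contact_balls[OF dim lam K])
  note S = S0(1,2) S0(3,4)[rule_format] S0(5-8) S0(9)[rule_format]
  have cb: "convex_body K" using K by (simp add: lam_convex_body_def)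
  then have cK: "compact K" "convex K" "K \<noteq> {}" by (auto simp: convex_body_def)
  have \<rho>: "0 \<le> \<rho>" "\<rho> < R" using S(8) inradius_attained(1)[OF cb] by (simp_all add: \<rho>_def)
  define K' where "K' = (+) (- z) ` K"
  have K': "compact K'" "convex K'" "K' \<noteq> {}"
    unfolding K'_def by (rule compact_translation[OF cK(1)], rule convex_translation[OF cK(2)]) (use cK(3) in simp)
  have KK: "K = (+) z ` K'" by (simp add: K'_def image_image)
  have sub: "K' \<subseteq> cball (- (\<rho> *\<^sub>R u)) R" if u: "u \<in> S" for u
  proof
    fix x assume "x \<in> K'"
    then have "z + x \<in> K" by (auto simp: K'_def)
    then have "dist (z - \<rho> *\<^sub>R u) (z + x) \<le> R" using S(9)[OF u] by auto
    moreover have "(z - \<rho> *\<^sub>R u) - (z + x) = - (\<rho> *\<^sub>R u) - x" by simp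
    ultimately show "x \<in> cball (- (\<rho> *\<^sub>R u)) R" by (simp only: mem_cball dist_norm)
  qed
  have DK: "directional_integral K' = directional_integral K"
    unfolding K'_def by (rule directional_integral_translation[OF cK(1,3)])
  let ?D = "directional_integral (lens R \<rho> e)"
  have ne: "lens R \<rho> u \<noteq> {}" if "u \<in> S" for u by (rule lens_nonempty[OF S(3)[OF that] \<rho>])
  have cont: "continuous_on UNIV (support_fun (lens R \<rho> u))" if "u \<in> S" for u
    by (rule continuous_on_support_fun[OF compact_lens ne[OF that]])
  \<comment> \<open>The defect in the width inequality. All lenses involved are congruent, and
    \<open>v\<close> and \<open>- v\<close> contribute equally to the integral for \<open>K\<close>,
    which leads to \<open>FI\<close>.\<close>
  define F where "F v = 2 * (\<Sum>u\<in>S. w u * support_fun (lens R \<rho> u) v) - (support_fun K' v + support_fun K' (- v))" for v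
  have cK'm: "continuous_on UNIV (\<lambda>v. support_fun K' (- v))"
    by (rule continuous_on_compose2[OF continuous_on_support_fun[OF K'(1,3)] continuous_on_minus[OF continuous_on_id]]) simp
  have Fcont: "continuous_on UNIV F" unfolding F_def
    by (intro continuous_on_diff continuous_on_add continuous_on_mult continuous_on_sum continuous_on_const cont
        continuous_on_support_fun K' cK'm)
  have Fhom: "F (c *\<^sub>R x) = c * F x" if c: "c \<ge> 0" for c x
  proof -
    have "support_fun (lens R \<rho> u) (c *\<^sub>R x) = c * support_fun (lens R \<rho> u) x" if "u \<in> S" for u
      by (rule support_fun_scale[OF compact_lens ne[OF that] c])
    then have "(\<Sum>u\<in>S. w u * support_fun (lens R \<rho> u) (c *\<^sub>R x)) = c * (\<Sum>u\<in>S. w u * support_fun (lens R \<rho> u) x)"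
      unfolding sum_distrib_left by (intro sum.cong) auto
    then show ?thesis
      using support_fun_scale[OF K'(1,3) c, of x] support_fun_scale[OF K'(1,3) c, of "- x"]
      by (simp add: F_def algebra_simps)
  qed
  have Fnn: "F v \<ge> 0" for v
  proof (cases "v = 0")
    case True then show ?thesis using Fhom[of 0 0] by simp
  next
    case False
    then have "norm (sgn v) = 1" by (simp add: norm_sgn)
    then have "F (sgn v) \<ge> 0"
      unfolding F_def using width_le_mean_lens_width(1)[OF S(1-6) \<rho> K'(3) sub] by simp
    moreover have "F v = norm v * F (sgn v)" using Fhom[of "norm v" "sgn v"] False by (simp add: sgn_div_norm)
    ultimately show ?thesis by simp
  qed
  have FI: "(LINT x:ball 0 1|lborel. F (sgn x)) = 2 * ?D - 2 * directional_integral K"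
  proof -
    have i1: "set_integrable lborel (ball 0 1) (\<lambda>x. w u * support_fun (lens R \<rho> u) (sgn x))" if "u \<in> S" for u
      by (rule set_integrable_mult_right) (rule set_integrable_support_fun[OF compact_lens ne[OF that]])
    have I1: "(LINT x:ball 0 1|lborel. w u * support_fun (lens R \<rho> u) (sgn x)) = w u * ?D" if "u \<in> S" for u
      using directional_integral_lens_eq[OF S(3)[OF that] e \<rho>] by (simp add: directional_integral_def)
    have isum: "set_integrable lborel (ball 0 1) (\<lambda>x. \<Sum>u\<in>S. w u * support_fun (lens R \<rho> u) (sgn x))"
      using i1 unfolding set_integrable_def scaleR_sum_right by (intro Bochner_Integration.integrable_sum) auto
    have "(LINT x:ball 0 1|lborel. \<Sum>u\<in>S. w u * support_fun (lens R \<rho> u) (sgn x))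
        = (\<Sum>u\<in>S. LINT x:ball 0 1|lborel. w u * support_fun (lens R \<rho> u) (sgn x))"
      using i1 unfolding set_integrable_def set_lebesgue_integral_def scaleR_sum_right
      by (intro Bochner_Integration.integral_sum) auto
    also have "\<dots> = (\<Sum>u\<in>S. w u * ?D)" by (intro sum.cong refl I1)
    also have "\<dots> = ?D" using S(5) by (simp flip: sum_distrib_right)
    finally have Isum: "(LINT x:ball 0 1|lborel. \<Sum>u\<in>S. w u * support_fun (lens R \<rho> u) (sgn x)) = ?D" .
    have uK: "compact (uminus ` K')" "uminus ` K' \<noteq> {}" using K' by (auto intro: compact_negations)
    note i2 = set_integrable_support_fun[OF K'(1,3)]
      and i3 = set_integrable_support_fun[OF uK, unfolded support_fun_uminus]
    have I3: "(LINT x:ball 0 1|lborel. support_fun K' (- sgn x)) = directional_integral K"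
      using directional_integral_orthogonal_image[OF orthogonal_transformation_uminus K'(1,3)] DK
      by (simp add: directional_integral_def support_fun_uminus)
    have "(LINT x:ball 0 1|lborel. F (sgn x))
       = (LINT x:ball 0 1|lborel. 2 * (\<Sum>u\<in>S. w u * support_fun (lens R \<rho> u) (sgn x)))
         - (LINT x:ball 0 1|lborel. support_fun K' (sgn x) + support_fun K' (- sgn x))"
      unfolding F_def by (rule set_integral_diff(2)[OF set_integrable_mult_right[OF isum] set_integral_add(1)[OF i2 i3]])
    also have "\<dots> = 2 * ?D - (directional_integral K' + directional_integral K)"
      unfolding set_integral_add(2)[OF i2 i3] I3 by (simp add: Isum directional_integral_def)
    finally show ?thesis using DK by simp
  qed
  have "(LINT x:ball 0 1|lborel. F (sgn x)) \<ge> 0"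
    unfolding set_lebesgue_integral_def by (rule integral_nonneg_AE) (simp add: Fnn)
  then show "directional_integral K \<le> directional_integral (lens (1 / lam) (1 / lam - inradius K) e)"
    unfolding FI R_def \<rho>_def by simp
  assume "directional_integral K = directional_integral (lens (1 / lam) (1 / lam - inradius K) e)"
  then have eq: "directional_integral K = ?D" by (simp add: R_def \<rho>_def)
  then have F0: "F v = 0" for v
    by (intro eq_zero_of_LINT_ball_sgn_eq_zero[OF Fcont Fhom Fnn]) (simp_all add: FI)
  obtain v where v: "v \<in> S" using S(2) by blast
  \<comment> \<open>If \<open>\<rho> = 0\<close>, the lens is a ball and one supporting ball
    suffices. Otherwise the opposite contact normals \<open>v\<close> and \<open>- v\<close> supply
    the two balls of the lens.\<close>
  have "K' \<subseteq> lens R \<rho> v"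
  proof (cases "\<rho> = 0")
    case True
    then show ?thesis using sub[OF v] by simp
  next
    case False
    then have "- v \<in> S"
      using width_le_mean_lens_width(2)[OF S(1-6) \<rho> K'(3) sub S(3)[OF v] _ v] F0[of v] \<rho>(1) by (simp add: F_def)
    then show ?thesis using sub[OF v] sub[of "- v"] by simp
  qed
  moreover have "directional_integral K' = directional_integral (lens R \<rho> v)"
    using eq DK directional_integral_lens_eq[OF e S(3)[OF v] \<rho>] by simp
  ultimately have "K' = lens R \<rho> v" by (intro directional_integral_strict_mono K' compact_lens)
  then have "K = cball (z + \<rho> *\<^sub>R v) R \<inter> cball (z + - (\<rho> *\<^sub>R v)) R"
    unfolding KK by (simp only: translation_lens)
  then show "lam_convex_lens lam K" using cb unfolding lam_convex_lens_def R_def by blast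
qed

theorem theorem1:
  fixes K L :: "'a::euclidean_space set" and lam :: real
  assumes "DIM('a) \<ge> 2"
    and "lam > 0"
    and "lam_convex_body lam K"
    and "lam_convex_lens lam L"
    and "inradius K = inradius L"
  shows "intrinsic_volume 1 K \<le> intrinsic_volume 1 L \<and>
    (intrinsic_volume 1 K = intrinsic_volume 1 L \<longleftrightarrow> lam_convex_lens lam K)"
proof -
  have "convex_body K" "convex_body L"
    using assms(3,4) by (auto simp: lam_convex_body_def lam_convex_lens_def)
  then have cK: "compact K" "convex K" "K \<noteq> {}" and cL: "compact L" "convex L" "L \<noteq> {}"
    by (auto simp: convex_body_def)
  define \<kappa> where "\<kappa> = unit_ball_vol (real (DIM('a) - 1)) / real DIM('a)"
  have \<kappa>: "\<kappa> > 0" by (simp add: \<kappa>_def)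
  have D: "directional_integral K = \<kappa> * intrinsic_volume 1 K" "directional_integral L = \<kappa> * intrinsic_volume 1 L"
    using intrinsic_volume_1[OF cK] intrinsic_volume_1[OF cL] by (simp_all add: \<kappa>_def field_simps)
  obtain e :: 'a where e: "norm e = 1" using nonempty_Basis norm_Basis by blast
  note lens_L = directional_integral_lam_convex_lens[OF assms(2,4) e]
  note le = directional_integral_le_lens[OF assms(1-3) e, unfolded assms(5), folded lens_L]
  have "directional_integral K = directional_integral L" if "lam_convex_lens lam K"
    using directional_integral_lam_convex_lens[OF assms(2) that e] lens_L assms(5) by simp
  then show ?thesis using le \<kappa> by (auto simp: D)
qed

end
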